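(* Let $A$ generate a strongly continuous semigroup $T=(T(t))_{t\ge0}$ of normal operators on a Hilbert space $X$, and let $1\le p\le\infty$. Let $A_{-1}$ be the extension of $A$ to $X_{-1}$ (with domain $X$), which is a normal operator on the Hilbert space $X_{-1}$, and let $E_{-1}$ be its spectral measure, normalized so as to live on $\sigma(-A)$, i.e. $-A_{-1}=\int_{\sigma(-A)}z\,dE_{-1}(z)$. Let $b\in X_{-1}\simeq\mathcal{L}(\mathbb{C},X_{-1})$ and define the measure $$\mu(S)=\int_S(1+|z|^2)\,d\langle E_{-1}(z)b,b\rangle_{X_{-1}}$$ on Borel subsets $S$ of $\mathbb{C}$. Then $b$ is (infinite-time) $L^p$-admissible for $T$ if and only if the Laplace transform is a bounded operator $$\mathscr{L}\colon L^p([0,\infty))\to L^2(\sigma(-A),\mu),\qquad (\mathscr{L}u)(z)=\int_0^\infty e^{-zt}u(t)\,dt.$$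
   Context: $X_{-1}$ is the completion of $X$ with respect to the norm $\|x\|_{X_{-1}}=\|(rI-A)^{-1}x\|_X$ for some fixed $r\in\rho(A)$ (different $r$ give equivalent norms); it is a Hilbert space, and $T$ extends to a $C_0$-semigroup on $X_{-1}$, again denoted $T$, with generator $A_{-1}$. An element $b\in X_{-1}$ is identified with the operator $\mathbb{C}\to X_{-1}$, $z\mapsto zb$. $b$ is infinite-time $L^p$-admissible for $T$ if for every $t\ge0$ and $u\in L^p([0,t])$ the integral $\int_0^tT(t-s)bu(s)\,ds$ lies in $X$ and there is a constant $C>0$, independent of $t$, with $\|\int_0^tT(t-s)bu(s)\,ds\|_X\le C\|u\|_{L^p([0,t])}$ for all such $t,u$. Boundedness of $\mathscr{L}$ is understood as: there is $C>0$ such that $\|\mathscr{L}u\|_{L^2(\sigma(-A),\mu)}\le C\|u\|_{L^p([0,\infty))}$ for all compactly supported $u\in L^p([0,\infty))$ (for which $\mathscr{L}u$ is an entire function). *)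

theory Defs
  imports "HOL-Probability.Probability"
begin

text \<open>Complex Hilbert spaces. The scalar product is linear in its first argument; the norm is the
  one of the underlying real inner product space, since \<open>x \<bullet> y = Re \<langle>x, y\<rangle>\<close>.\<close>

class chilbert_space = real_inner + complete_space +
  fixes scaleC :: "complex \<Rightarrow> 'a \<Rightarrow> 'a"  (infixr \<open>*\<^sub>C\<close> 75)
    and cinner :: "'a \<Rightarrow> 'a \<Rightarrow> complex"
  assumes scaleC_add_right: "c *\<^sub>C (x + y) = c *\<^sub>C x + c *\<^sub>C y"
    and scaleC_add_left: "(c + d) *\<^sub>C x = c *\<^sub>C x + d *\<^sub>C x"
    and scaleC_scaleC: "c *\<^sub>C d *\<^sub>C x = (c * d) *\<^sub>C x"
    and scaleC_of_real: "complex_of_real a *\<^sub>C x = a *\<^sub>R x"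
    and cinner_commute: "cinner x y = cnj (cinner y x)"
    and cinner_add_left: "cinner (x + y) z = cinner x z + cinner y z"
    and cinner_scaleC_left: "cinner (c *\<^sub>C x) y = c * cinner x y"
    and Re_cinner: "Re (cinner x y) = x \<bullet> y"

definition clinear :: "('a::chilbert_space \<Rightarrow> 'b::chilbert_space) \<Rightarrow> bool" where
  "clinear f \<longleftrightarrow> linear f \<and> (\<forall>c x. f (c *\<^sub>C x) = c *\<^sub>C f x)"

definition bounded_clinear :: "('a::chilbert_space \<Rightarrow> 'b::chilbert_space) \<Rightarrow> bool" where
  "bounded_clinear f \<longleftrightarrow> clinear f \<and> bounded_linear f"

definition is_adjoint :: "('a::chilbert_space \<Rightarrow> 'a) \<Rightarrow> ('a \<Rightarrow> 'a) \<Rightarrow> bool" where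
  "is_adjoint f g \<longleftrightarrow> (\<forall>x y. cinner (f x) y = cinner x (g y))"

definition normal_operator :: "('a::chilbert_space \<Rightarrow> 'a) \<Rightarrow> bool" where
  "normal_operator f \<longleftrightarrow> bounded_clinear f \<and> (\<exists>g. is_adjoint f g \<and> f \<circ> g = g \<circ> f)"

text \<open>Unbounded operators are represented by their graphs: \<open>(x, y) \<in> A\<close> means that \<open>x\<close> is in
  the domain of \<open>A\<close> and \<open>A x = y\<close>.\<close>

definition uminus_op :: "('a::chilbert_space \<times> 'a) set \<Rightarrow> ('a \<times> 'a) set" where
  "uminus_op A = {(x, - y) |x y. (x, y) \<in> A}"

text \<open>\<open>(\<zeta> I - A) y = x\<close> is expressed as \<open>(y, \<zeta> y - x) \<in> A\<close>.\<close>

definition resolvent :: "('a::chilbert_space \<times> 'a) set \<Rightarrow> complex \<Rightarrow> 'a \<Rightarrow> 'a" where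
  "resolvent A \<zeta> x = (THE y. (y, \<zeta> *\<^sub>C y - x) \<in> A)"

definition resolvent_set :: "('a::chilbert_space \<times> 'a) set \<Rightarrow> complex set" where
  "resolvent_set A =
     {\<zeta>. (\<forall>x. \<exists>!y. (y, \<zeta> *\<^sub>C y - x) \<in> A) \<and> bounded_clinear (resolvent A \<zeta>)}"

definition spectrum :: "('a::chilbert_space \<times> 'a) set \<Rightarrow> complex set" where
  "spectrum A = - resolvent_set A"

text \<open>Only the values \<open>T t\<close> with \<open>t \<ge> 0\<close> are relevant.\<close>

definition C0_semigroup :: "(real \<Rightarrow> 'a::chilbert_space \<Rightarrow> 'a) \<Rightarrow> bool" where
  "C0_semigroup T \<longleftrightarrow>
     (\<forall>t\<ge>0. bounded_clinear (T t)) \<and> T 0 = id \<and>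
     (\<forall>s\<ge>0. \<forall>t\<ge>0. T (s + t) = T s \<circ> T t) \<and>
     (\<forall>x. ((\<lambda>t. T t x) \<longlongrightarrow> x) (at_right 0))"

definition generator :: "(real \<Rightarrow> 'a::chilbert_space \<Rightarrow> 'a) \<Rightarrow> ('a \<times> 'a) set" where
  "generator T = {(x, y). ((\<lambda>h. (1 / h) *\<^sub>R (T h x - x)) \<longlongrightarrow> y) (at_right 0)}"

text \<open>\<open>J\<close> exhibits the complete space \<open>'b\<close> as the completion \<open>X\<^sub>-\<^sub>1\<close> of \<open>'a\<close> for the norm
  \<open>\<parallel>(r I - A)\<^sup>-\<^sup>1 x\<parallel>\<close>; this determines \<open>'b\<close> and \<open>J\<close> up to a unique isometric isomorphism.\<close>

definition extrapolation_space ::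
  "('a::chilbert_space \<times> 'a) set \<Rightarrow> complex \<Rightarrow> ('a \<Rightarrow> 'b::chilbert_space) \<Rightarrow> bool" where
  "extrapolation_space A r J \<longleftrightarrow>
     clinear J \<and> (\<forall>x. norm (J x) = norm (resolvent A r x)) \<and> closure (range J) = UNIV"

text \<open>The extension of the semigroup to \<open>X\<^sub>-\<^sub>1\<close> by density and continuity.\<close>

definition extrapolation_semigroup ::
  "('a::chilbert_space \<Rightarrow> 'b::chilbert_space) \<Rightarrow> (real \<Rightarrow> 'a \<Rightarrow> 'a) \<Rightarrow> real \<Rightarrow> 'b \<Rightarrow> 'b" where
  "extrapolation_semigroup J T t = (THE S. bounded_clinear S \<and> (\<forall>x. S (J x) = J (T t x)))"

text \<open>\<open>A\<^sub>-\<^sub>1\<close>; its domain is the copy \<open>range J\<close> of \<open>X\<close>, and it extends the generator of \<open>T\<close>.\<close>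

definition extrapolation_generator ::
  "('a::chilbert_space \<Rightarrow> 'b::chilbert_space) \<Rightarrow> (real \<Rightarrow> 'a \<Rightarrow> 'a) \<Rightarrow> ('b \<times> 'b) set" where
  "extrapolation_generator J T = generator (extrapolation_semigroup J T)"

definition orthogonal_projection :: "('a::chilbert_space \<Rightarrow> 'a) \<Rightarrow> bool" where
  "orthogonal_projection P \<longleftrightarrow> bounded_clinear P \<and> P \<circ> P = P \<and> is_adjoint P P"

definition projection_valued_measure :: "(complex set \<Rightarrow> 'a::chilbert_space \<Rightarrow> 'a) \<Rightarrow> bool" where
  "projection_valued_measure E \<longleftrightarrow>
     (\<forall>S\<in>sets borel. orthogonal_projection (E S)) \<and> E UNIV = id \<and>
     (\<forall>S\<in>sets borel. \<forall>S'\<in>sets borel. E (S \<inter> S') = E S \<circ> E S') \<and>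
     (\<forall>F::nat \<Rightarrow> complex set. range F \<subseteq> sets borel \<longrightarrow> disjoint_family F \<longrightarrow>
        (\<forall>x. (\<lambda>n. E (F n) x) sums E (\<Union>n. F n) x))"

text \<open>The finite Borel measure \<open>S \<mapsto> \<langle>E S x, x\<rangle>\<close>.\<close>

definition spectral_scalar_measure ::
  "(complex set \<Rightarrow> 'a::chilbert_space \<Rightarrow> 'a) \<Rightarrow> 'a \<Rightarrow> complex measure" where
  "spectral_scalar_measure E x =
     measure_of UNIV (sets borel) (\<lambda>S. ennreal (Re (cinner (E S x) x)))"

definition simple_spectral_integral ::
  "(complex set \<Rightarrow> 'a::chilbert_space \<Rightarrow> 'a) \<Rightarrow> (complex \<Rightarrow> complex) \<Rightarrow> 'a \<Rightarrow> 'a" where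
  "simple_spectral_integral E s x = (\<Sum>c\<in>range s. c *\<^sub>C E (s -` {c}) x)"

text \<open>The operator \<open>\<integral> f dE\<close>. On simple functions \<open>s\<close>, \<open>\<parallel>(\<integral> s dE) x\<parallel>\<close> is the norm of \<open>s\<close> in
  \<open>L\<^sup>2(\<langle>E(\<cdot>) x, x\<rangle>)\<close>, so the limit below does not depend on the approximating sequence, and the
  domain consists of those \<open>x\<close> for which \<open>f\<close> lies in \<open>L\<^sup>2(\<langle>E(\<cdot>) x, x\<rangle>)\<close>.\<close>

definition spectral_integral ::
  "(complex set \<Rightarrow> 'a::chilbert_space \<Rightarrow> 'a) \<Rightarrow> (complex \<Rightarrow> complex) \<Rightarrow> ('a \<times> 'a) set" where
  "spectral_integral E f =
     {(x, y). \<exists>s :: nat \<Rightarrow> complex \<Rightarrow> complex.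
        (\<forall>n. simple_function borel (s n)) \<and>
        (\<lambda>n. \<integral>\<^sup>+ z. ennreal ((cmod (f z - s n z))\<^sup>2) \<partial>spectral_scalar_measure E x) \<longlonglongrightarrow> 0 \<and>
        (\<lambda>n. simple_spectral_integral E (s n) x) \<longlonglongrightarrow> y}"

text \<open>\<open>u \<in> L\<^sup>p(M)\<close> and \<open>\<parallel>u\<parallel>\<close> for \<open>1 \<le> p \<le> \<infinity>\<close>, in terms of representatives.\<close>

definition in_Lp :: "ennreal \<Rightarrow> 'a measure \<Rightarrow> ('a \<Rightarrow> complex) \<Rightarrow> bool" where
  "in_Lp p M u \<longleftrightarrow> u \<in> borel_measurable M \<and>
     (if p = \<infinity> then \<exists>C. AE x in M. cmod (u x) \<le> C
      else integrable M (\<lambda>x. cmod (u x) powr enn2real p))"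

definition Lp_norm :: "ennreal \<Rightarrow> 'a measure \<Rightarrow> ('a \<Rightarrow> complex) \<Rightarrow> real" where
  "Lp_norm p M u =
     (if p = \<infinity> then enn2real (esssup M (\<lambda>x. ennreal (cmod (u x))))
      else (LINT x|M. cmod (u x) powr enn2real p) powr (1 / enn2real p))"

text \<open>Infinite-time admissibility of \<open>b \<in> X\<^sub>-\<^sub>1\<close>; \<open>J\<close> is the embedding of \<open>X\<close> into \<open>X\<^sub>-\<^sub>1\<close> and \<open>S\<close>
  the semigroup on \<open>X\<^sub>-\<^sub>1\<close>. The library's Bochner integral is restricted to separable spaces; the
  integrand here is a continuous function times an \<open>L\<^sup>1\<close> function, so it is Bochner integrable and
  its gauge integral is the Bochner integral.\<close>

definition Lp_admissible :: "ennreal \<Rightarrow> ('a::chilbert_space \<Rightarrow> 'b::chilbert_space) \<Rightarrow>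
    (real \<Rightarrow> 'b \<Rightarrow> 'b) \<Rightarrow> 'b \<Rightarrow> bool" where
  "Lp_admissible p J S b \<longleftrightarrow>
     (\<exists>C>0. \<forall>t\<ge>0. \<forall>u. in_Lp p (lebesgue_on {0..t}) u \<longrightarrow>
        (\<exists>x. ((\<lambda>s. S (t - s) (u s *\<^sub>C b)) has_integral J x) {0..t} \<and>
             norm x \<le> C * Lp_norm p (lebesgue_on {0..t}) u))"

definition laplace_transform :: "(real \<Rightarrow> complex) \<Rightarrow> complex \<Rightarrow> complex" where
  "laplace_transform u z = (LINT t|lebesgue_on {0..}. exp (- z * complex_of_real t) * u t)"

definition compactly_supported :: "(real \<Rightarrow> complex) \<Rightarrow> bool" where
  "compactly_supported u \<longleftrightarrow> (\<exists>\<tau>. AE t in lebesgue_on {0..}. t > \<tau> \<longrightarrow> u t = 0)"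

definition laplace_bounded :: "ennreal \<Rightarrow> complex set \<Rightarrow> complex measure \<Rightarrow> bool" where
  "laplace_bounded p S \<mu> \<longleftrightarrow>
     (\<exists>C>0. \<forall>u. in_Lp p (lebesgue_on {0..}) u \<longrightarrow> compactly_supported u \<longrightarrow>
        in_Lp 2 (restrict_space \<mu> S) (laplace_transform u) \<and>
        Lp_norm 2 (restrict_space \<mu> S) (laplace_transform u)
          \<le> C * Lp_norm p (lebesgue_on {0..}) u)"

end

theory Submission
  imports Defs
begin

text \<open>The resolvent \<open>(r - A)\<^sup>-\<^sup>1\<close> extends to an isometry of \<open>X\<^sub>-\<^sub>1\<close> onto \<open>X\<close> that conjugates the two
  semigroups; hence \<open>A\<^sub>-\<^sub>1\<close> has domain \<open>X\<close> and \<open>\<parallel>x\<parallel>\<^sub>X = \<parallel>(r - A\<^sub>-\<^sub>1) x\<parallel>\<close>. With \<open>\<nu> = \<langle>E(\<cdot>) b, b\<rangle>\<close>,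
  the map \<open>f \<mapsto> (\<integral> f dE) b\<close> is an isometry of \<open>L\<^sup>2(\<nu>)\<close> into \<open>X\<^sub>-\<^sub>1\<close> turning \<open>-A\<^sub>-\<^sub>1\<close> into multiplication
  by \<open>z\<close>. On the range of \<open>E\<close> of a disc the generator is bounded, so uniqueness for the abstract
  Cauchy problem identifies the semigroup with multiplication by \<open>exp (- z t)\<close>. Therefore
  \<open>\<integral>\<^sub>0\<^sup>t T(t - s) b u(s) ds\<close> corresponds to the Laplace transform \<open>f\<close> of \<open>s \<mapsto> u (t - s)\<close>; it lies in \<open>X\<close>
  iff \<open>z f \<in> L\<^sup>2(\<nu>)\<close>, and then its norm in \<open>X\<close> is that of \<open>(r + z) f\<close> in \<open>L\<^sup>2(\<nu>)\<close>. Since \<open>- r\<close> has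
  positive distance from the closed set \<open>\<sigma>(- A)\<close>, the weights \<open>\<bar>r + z\<bar>\<^sup>2\<close> and \<open>1 + \<bar>z\<bar>\<^sup>2\<close> are
  comparable there.\<close>

section \<open>Complex Hilbert spaces and square integrable functions\<close>

text \<open>The obstacle is that no bound for \<open>exp (- z * t)\<close> on the support of
  \<open>E\<close> is at hand, nor is it assumed that \<open>E\<close> commutes with the semigroup
  on X_{-1}. The multiplication formula is therefore proved only behind a cut-off:
  \<open>E (disc m) (S t b)\<close> is represented by the exponential restricted to the disc. The
  convolution integral is treated in the same way, and monotone convergence over growing discs then
  bounds the L^2(nu) norm of the Laplace transform by the norm of that integral. So square
  integrability of the transform with respect to nu is a conclusion. The integral exists in X_{-1}
  for every L^p input, since such inputs are integrable on bounded intervals; the only question is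
  whether it lies in X. Statements about other vectors are pulled back to \<open>b\<close> by
  \<open>SI_compose\<close>, so that one scalar L^2 space does the work of an unbounded functional
  calculus. Vector-valued integrals are gauge integrals, reached as limits of finite sums that have
  the same shape on the scalar side and on the vector side.\<close>

instance chilbert_space \<subseteq> banach ..

lemma scaleC_zero_right [simp]: "c *\<^sub>C (0::'a::chilbert_space) = 0"
  using scaleC_add_right[of c 0 "0::'a"] by simp

lemma scaleC_one [simp]: "1 *\<^sub>C (x::'a::chilbert_space) = x"
  using scaleC_of_real[of 1 x] by simp

lemma scaleC_zero_left [simp]: "0 *\<^sub>C (x::'a::chilbert_space) = 0"
  using scaleC_of_real[of 0 x] by simp

lemma scaleC_minus_right [simp]: "c *\<^sub>C (- (x::'a::chilbert_space)) = - (c *\<^sub>C x)"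
  using scaleC_add_right[of c x "- x"] by (simp add: eq_neg_iff_add_eq_0 add.commute)

lemma scaleC_minus_left: "(- c) *\<^sub>C (x::'a::chilbert_space) = - (c *\<^sub>C x)"
  using scaleC_add_left[of c "- c" x] by (simp add: eq_neg_iff_add_eq_0 add.commute)

lemma scaleC_diff_right: "c *\<^sub>C ((x::'a::chilbert_space) - y) = c *\<^sub>C x - c *\<^sub>C y"
  using scaleC_add_right[of c x "- y"] by simp

lemma scaleC_diff_left: "(c - d) *\<^sub>C (x::'a::chilbert_space) = c *\<^sub>C x - d *\<^sub>C x"
  using scaleC_add_left[of c "- d" x] by (simp add: scaleC_minus_left)

lemma scaleC_scaleR: "c *\<^sub>C a *\<^sub>R (x::'a::chilbert_space) = a *\<^sub>R c *\<^sub>C x"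
  by (simp add: scaleC_of_real[symmetric] scaleC_scaleC mult.commute)

lemma scaleC_sum_right: "c *\<^sub>C (\<Sum>i\<in>I. f i) = (\<Sum>i\<in>I. c *\<^sub>C (f i::'a::chilbert_space))"
  by (induction I rule: infinite_finite_induct) (auto simp: scaleC_add_right)

lemma cinner_scaleC_right: "cinner x (c *\<^sub>C y) = cnj c * cinner (x::'a::chilbert_space) y"
  by (subst cinner_commute, simp add: cinner_scaleC_left, subst (2) cinner_commute, simp)

lemma cinner_self: "cinner (x::'a::chilbert_space) x = complex_of_real ((norm x)\<^sup>2)"
proof -
  have "Im (cinner x x) = 0"
    using arg_cong[OF cinner_commute[of x x], of Im] by simp
  then show ?thesis
    by (simp add: complex_eq_iff Re_cinner power2_norm_eq_inner)
qed

lemma norm_scaleC [simp]: "norm (c *\<^sub>C (x::'a::chilbert_space)) = cmod c * norm x"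
proof -
  have "complex_of_real ((norm (c *\<^sub>C x))\<^sup>2) = c * cnj c * complex_of_real ((norm x)\<^sup>2)"
    unfolding cinner_self[symmetric] by (simp add: cinner_scaleC_left cinner_scaleC_right)
  also have "\<dots> = complex_of_real ((cmod c * norm x)\<^sup>2)"
    by (simp only: complex_norm_square[symmetric] power_mult_distrib of_real_mult of_real_power)
  finally have "(norm (c *\<^sub>C x))\<^sup>2 = (cmod c * norm x)\<^sup>2"
    using of_real_eq_iff by blast
  then show ?thesis
    by (simp add: power2_eq_iff_nonneg)
qed

lemma bounded_linear_scaleC: "bounded_linear (\<lambda>x::'a::chilbert_space. c *\<^sub>C x)"
  by (rule bounded_linear_intro[where K = "cmod c"])
     (auto simp: scaleC_add_right scaleC_scaleR mult.commute)

lemma bounded_clinearD: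
  assumes "bounded_clinear f"
  shows "bounded_linear f" "f (x + y) = f x + f y" "f (x - y) = f x - f y"
    "f (c *\<^sub>C x) = c *\<^sub>C f x" "f (a *\<^sub>R x) = a *\<^sub>R f x" "f 0 = 0" "f (- x) = - f x"
  using assms unfolding bounded_clinear_def clinear_def
  by (auto simp: linear_add linear_diff linear_scale linear_0 linear_neg)

section \<open>Estimates for squared norms and L^2 approximation\<close>

lemma norm_add_sq_le: "(norm (x + y))\<^sup>2 \<le> 2 * (norm x)\<^sup>2 + 2 * (norm y)\<^sup>2" for x :: "'a::real_normed_vector"
proof -
  have "(norm (x + y))\<^sup>2 \<le> (norm x + norm y)\<^sup>2"
    by (rule power_mono[OF norm_triangle_ineq]) simp
  also have "\<dots> \<le> 2 * (norm x)\<^sup>2 + 2 * (norm y)\<^sup>2"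
    using sum_squares_bound[of "norm x" "norm y"] by (simp add: power2_sum)
  finally show ?thesis .
qed

lemma norm_diff_sq_le: "(norm (x - y))\<^sup>2 \<le> 2 * (norm x)\<^sup>2 + 2 * (norm y)\<^sup>2" for x :: "'a::real_normed_vector"
  using norm_add_sq_le[of x "- y"] by simp

lemma nn_integral_add_sq_le:
  assumes "f \<in> borel_measurable M" "g \<in> borel_measurable M"
  shows "(\<integral>\<^sup>+ z. ennreal ((cmod (f z + g z))\<^sup>2) \<partial>M)
    \<le> 2 * (\<integral>\<^sup>+ z. ennreal ((cmod (f z))\<^sup>2) \<partial>M) + 2 * (\<integral>\<^sup>+ z. ennreal ((cmod (g z))\<^sup>2) \<partial>M)"
proof -
  have [measurable]: "f \<in> borel_measurable M" "g \<in> borel_measurable M" by fact+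
  have "(\<integral>\<^sup>+ z. ennreal ((cmod (f z + g z))\<^sup>2) \<partial>M)
    \<le> (\<integral>\<^sup>+ z. 2 * ennreal ((cmod (f z))\<^sup>2) + 2 * ennreal ((cmod (g z))\<^sup>2) \<partial>M)"
  proof (rule nn_integral_mono)
    fix z
    have "ennreal ((cmod (f z + g z))\<^sup>2) \<le> ennreal (2 * (cmod (f z))\<^sup>2 + 2 * (cmod (g z))\<^sup>2)"
      by (intro ennreal_leI norm_add_sq_le)
    then show "ennreal ((cmod (f z + g z))\<^sup>2) \<le> 2 * ennreal ((cmod (f z))\<^sup>2) + 2 * ennreal ((cmod (g z))\<^sup>2)"
      by (simp add: ennreal_plus ennreal_mult)
  qed
  also have "\<dots> = 2 * (\<integral>\<^sup>+ z. ennreal ((cmod (f z))\<^sup>2) \<partial>M) + 2 * (\<integral>\<^sup>+ z. ennreal ((cmod (g z))\<^sup>2) \<partial>M)"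
    by (simp add: nn_integral_add nn_integral_cmult)
  finally show ?thesis .
qed

text \<open>Split \<open>f - g\<close> through the common target \<open>h\<close>. With
  \<open>f\<close> and \<open>g\<close> two approximants of \<open>h\<close>, this gives both the
  Cauchy property of an approximating sequence and the independence of its choice.\<close>

lemma nn_integral_diff_sq_le:
  assumes "f \<in> borel_measurable M" "g \<in> borel_measurable M" "h \<in> borel_measurable M"
  shows "(\<integral>\<^sup>+ z. ennreal ((cmod (f z - g z))\<^sup>2) \<partial>M)
    \<le> 2 * (\<integral>\<^sup>+ z. ennreal ((cmod (h z - f z))\<^sup>2) \<partial>M) + 2 * (\<integral>\<^sup>+ z. ennreal ((cmod (h z - g z))\<^sup>2) \<partial>M)"
  using nn_integral_add_sq_le[of "\<lambda>z. f z - h z" M "\<lambda>z. h z - g z"] assms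
  by (simp add: norm_minus_commute)

text \<open>Simple functions approximating \<open>f\<close> pointwise and dominated by \<open>2 \<bar>f\<bar>\<close> converge in \<open>L\<^sup>2\<close>.\<close>

lemma simple_function_L2_approximation:
  fixes f :: "'a \<Rightarrow> complex"
  assumes f[measurable]: "f \<in> borel_measurable M" and fin: "(\<integral>\<^sup>+ z. ennreal ((cmod (f z))\<^sup>2) \<partial>M) < \<infinity>"
  obtains s where "\<And>n::nat. simple_function M (s n)"
    "(\<lambda>n. \<integral>\<^sup>+ z. ennreal ((cmod (f z - s n z))\<^sup>2) \<partial>M) \<longlonglongrightarrow> 0"
    "(\<lambda>n. \<integral>\<^sup>+ z. ennreal ((cmod (s n z))\<^sup>2) \<partial>M) \<longlonglongrightarrow> (\<integral>\<^sup>+ z. ennreal ((cmod (f z))\<^sup>2) \<partial>M)"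
proof -
  obtain s where s: "\<And>n. simple_function M (s n)" "\<And>x. x \<in> space M \<Longrightarrow> (\<lambda>n. s n x) \<longlonglongrightarrow> f x"
    "\<And>n x. x \<in> space M \<Longrightarrow> dist (s n x) 0 \<le> 2 * dist (f x) 0"
    using borel_measurable_implies_sequence_metric[OF f, of 0] by blast
  have [measurable]: "s n \<in> borel_measurable M" for n
    using s(1) by (rule borel_measurable_simple_function)
  \<comment> \<open>The factors that arise are 2 squared here and 3 squared for the difference; 9
    covers both, so one dominating function serves both limits.\<close>
  have b1: "(cmod (s n x))\<^sup>2 \<le> 9 * (cmod (f x))\<^sup>2" if "x \<in> space M" for n x
  proof -
    have "(cmod (s n x))\<^sup>2 \<le> (2 * cmod (f x))\<^sup>2"
      using s(3)[OF that, of n] by (intro power_mono) auto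
    then show ?thesis by (simp add: power_mult_distrib) (use zero_le_power2[of "cmod (f x)"] in linarith)
  qed
  have b2: "(cmod (f x - s n x))\<^sup>2 \<le> 9 * (cmod (f x))\<^sup>2" if "x \<in> space M" for n x
  proof -
    have "(cmod (f x - s n x))\<^sup>2 \<le> (3 * cmod (f x))\<^sup>2"
      using s(3)[OF that, of n] norm_triangle_ineq4[of "f x" "s n x"] by (intro power_mono) auto
    then show ?thesis by (simp add: power_mult_distrib)
  qed
  have w: "(\<integral>\<^sup>+ x. ennreal (9 * (cmod (f x))\<^sup>2) \<partial>M) < \<infinity>"
    using fin by (simp add: ennreal_mult nn_integral_cmult ennreal_mult_less_top)
  have "(\<lambda>n. \<integral>\<^sup>+ z. ennreal ((cmod (f z - s n z))\<^sup>2) \<partial>M) \<longlonglongrightarrow> (\<integral>\<^sup>+ z. 0 \<partial>M)"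
  proof (rule nn_integral_dominated_convergence[where w = "\<lambda>x. ennreal (9 * (cmod (f x))\<^sup>2)"])
    show "AE x in M. (\<lambda>n. ennreal ((cmod (f x - s n x))\<^sup>2)) \<longlonglongrightarrow> 0"
    proof (rule AE_I2)
      fix x assume "x \<in> space M"
      then have "(\<lambda>n. (cmod (f x - s n x))\<^sup>2) \<longlonglongrightarrow> (cmod (f x - f x))\<^sup>2"
        by (intro tendsto_intros s)
      then show "(\<lambda>n. ennreal ((cmod (f x - s n x))\<^sup>2)) \<longlonglongrightarrow> 0"
        using tendsto_ennrealI by fastforce
    qed
  qed (use b2 w in \<open>auto intro!: AE_I2 ennreal_leI\<close>)
  moreover have "(\<lambda>n. \<integral>\<^sup>+ z. ennreal ((cmod (s n z))\<^sup>2) \<partial>M) \<longlonglongrightarrow> (\<integral>\<^sup>+ z. ennreal ((cmod (f z))\<^sup>2) \<partial>M)"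
  proof (rule nn_integral_dominated_convergence[where w = "\<lambda>x. ennreal (9 * (cmod (f x))\<^sup>2)"])
    show "AE x in M. (\<lambda>n. ennreal ((cmod (s n x))\<^sup>2)) \<longlonglongrightarrow> ennreal ((cmod (f x))\<^sup>2)"
      by (intro AE_I2 tendsto_ennrealI tendsto_intros s)
  qed (use b1 w in \<open>auto intro!: AE_I2 ennreal_leI\<close>)
  ultimately show ?thesis using that[of s] s(1) by simp
qed

lemma squeeze_zero_ennreal:
  fixes f g :: "nat \<Rightarrow> ennreal"
  assumes "g \<longlonglongrightarrow> 0" "\<And>n. f n \<le> c * g n" "c < \<infinity>"
  shows "f \<longlonglongrightarrow> 0"
proof (rule tendsto_sandwich[OF _ _ tendsto_const])
  show "(\<lambda>n. c * g n) \<longlonglongrightarrow> 0"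
    using ennreal_tendsto_cmult[OF _ assms(1), of c] assms(3) by simp
qed (use assms(2) in auto)

lemma tendsto_of_norm_sq_ennreal:
  fixes f :: "nat \<Rightarrow> 'a::real_normed_vector"
  assumes "(\<lambda>n. ennreal ((norm (f n - l))\<^sup>2)) \<longlonglongrightarrow> 0"
  shows "f \<longlonglongrightarrow> l"
proof -
  have "(\<lambda>n. (norm (f n - l))\<^sup>2) \<longlonglongrightarrow> 0"
    using assms tendsto_ennreal_iff[of "\<lambda>n. (norm (f n - l))\<^sup>2" sequentially 0] by simp
  then have "(\<lambda>n. sqrt ((norm (f n - l))\<^sup>2)) \<longlonglongrightarrow> sqrt 0"
    by (rule tendsto_real_sqrt)
  then show ?thesis
    using LIM_zero_iff tendsto_norm_zero_iff by fastforce
qed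

section \<open>Integration against a projection-valued measure\<close>

locale pvm =
  fixes E :: "complex set \<Rightarrow> 'a::chilbert_space \<Rightarrow> 'a"
  assumes pvm: "projection_valued_measure E"
begin

abbreviation \<nu> :: "'a \<Rightarrow> complex measure" where "\<nu> \<equiv> spectral_scalar_measure E"

abbreviation L2sq :: "'a \<Rightarrow> (complex \<Rightarrow> complex) \<Rightarrow> ennreal" where
  "L2sq x f \<equiv> (\<integral>\<^sup>+ z. ennreal ((cmod (f z))\<^sup>2) \<partial>\<nu> x)"

abbreviation SSI :: "(complex \<Rightarrow> complex) \<Rightarrow> 'a \<Rightarrow> 'a" where
  "SSI \<equiv> simple_spectral_integral E"

abbreviation SI :: "(complex \<Rightarrow> complex) \<Rightarrow> ('a \<times> 'a) set" where
  "SI \<equiv> spectral_integral E"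

lemma bounded_clinear_E: "S \<in> sets borel \<Longrightarrow> bounded_clinear (E S)"
  using pvm by (auto simp: projection_valued_measure_def orthogonal_projection_def)

lemma E_UNIV: "E UNIV = id"
  using pvm by (auto simp: projection_valued_measure_def)

lemma E_Int: "S \<in> sets borel \<Longrightarrow> S' \<in> sets borel \<Longrightarrow> E S (E S' x) = E (S \<inter> S') x"
  using pvm by (auto simp: projection_valued_measure_def)

lemma E_sums:
  assumes "range F \<subseteq> sets borel" "disjoint_family F"
  shows "(\<lambda>n. E (F n) x) sums E (\<Union>n. F n) x"
  using pvm assms unfolding projection_valued_measure_def by blast

lemma cinner_E: "S \<in> sets borel \<Longrightarrow> cinner (E S x) y = cinner x (E S y)"
  using pvm by (auto simp: projection_valued_measure_def orthogonal_projection_def is_adjoint_def)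

lemma inner_E: "S \<in> sets borel \<Longrightarrow> E S x \<bullet> y = x \<bullet> E S y"
  using cinner_E[of S x y] Re_cinner by metis

lemma E_empty [simp]: "E {} x = 0"
proof -
  have "(\<lambda>n::nat. E {} x) sums E (\<Union>n::nat. {}) x"
    by (rule E_sums) (auto simp: disjoint_family_on_def)
  then have "(\<lambda>n::nat. E {} x) \<longlonglongrightarrow> 0"
    by (intro summable_LIMSEQ_zero sums_summable)
  then show ?thesis
    by (simp add: LIMSEQ_const_iff)
qed

lemma inner_E_self: "S \<in> sets borel \<Longrightarrow> E S x \<bullet> x = (norm (E S x))\<^sup>2"
  using inner_E[of S x "E S x"] E_Int[of S S x] inner_E[of S x x] by (simp add: power2_norm_eq_inner)

lemma inner_E_disjoint:
  assumes "S \<in> sets borel" "S' \<in> sets borel" "S \<inter> S' = {}"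
  shows "cinner (E S x) (E S' y) = 0"
proof -
  have "cinner (E S x) (E S' y) = cinner x 0"
    using assms by (simp add: cinner_E E_Int)
  also have "\<dots> = 0"
    using cinner_scaleC_right[of x 0 x] by simp
  finally show ?thesis .
qed

lemma sets_nu [simp, measurable_cong]: "sets (\<nu> x) = sets borel"
  unfolding spectral_scalar_measure_def using sets.sigma_sets_eq[of "borel :: complex measure"] by (simp add: sets_measure_of)

lemma space_nu [simp]: "space (\<nu> x) = UNIV"
  by (metis sets_eq_imp_space_eq sets_nu space_borel)

text \<open>\<open>measure_of\<close> takes the prescribed values only once countable additivity is
  known. It comes from pairing the strongly convergent series for \<open>E\<close> with
  \<open>x\<close>; the terms are nonnegative because a self-adjoint idempotent satisfies
  \<open>E S x \<bullet> x = (norm (E S x))\<^sup>2\<close>.\<close>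

lemma emeasure_nu:
  assumes "S \<in> sets borel"
  shows "emeasure (\<nu> x) S = ennreal ((norm (E S x))\<^sup>2)"
proof -
  have eq: "ennreal (Re (cinner (E S x) x)) = ennreal ((norm (E S x))\<^sup>2)" if "S \<in> sets borel" for S
    using that by (simp add: Re_cinner inner_E_self)
  have "emeasure (\<nu> x) S = ennreal (Re (cinner (E S x) x))"
    unfolding spectral_scalar_measure_def
  proof (rule emeasure_measure_of_sigma)
    show "sigma_algebra UNIV (sets (borel :: complex measure))"
      using sets.sigma_algebra_axioms[of "borel :: complex measure"] by simp
    show "positive (sets borel) (\<lambda>S. ennreal (Re (cinner (E S x) x)))"
      by (simp add: positive_def Re_cinner)
    show "countably_additive (sets borel) (\<lambda>S. ennreal (Re (cinner (E S x) x)))"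
    proof (rule countably_additiveI)
      fix F :: "nat \<Rightarrow> complex set"
      assume F: "range F \<subseteq> sets borel" "disjoint_family F" "(\<Union>i. F i) \<in> sets borel"
      have "(\<lambda>n. E (F n) x \<bullet> x) sums (E (\<Union>n. F n) x \<bullet> x)"
        using bounded_linear.sums[OF bounded_linear_inner_left E_sums[OF F(1,2), of x], of x] .
      moreover have "E (F n) x \<bullet> x \<ge> 0" for n
        using F(1) by (simp add: inner_E_self range_subsetD)
      ultimately show "(\<Sum>n. ennreal (Re (cinner (E (F n) x) x))) = ennreal (Re (cinner (E (\<Union>n. F n) x) x))"
        unfolding Re_cinner by (metis suminf_ennreal_eq)
    qed
  qed (use assms in simp)
  then show ?thesis
    using eq assms by simp
qed

lemma borel_measurable_nu [simp]: "borel_measurable (\<nu> x) = borel_measurable borel"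
  by (rule measurable_cong_sets) auto

lemma simple_function_nu [simp]: "simple_function (\<nu> x) f = simple_function borel f"
  by (simp add: simple_function_def)

text \<open>Binary additivity comes from countable additivity by padding two sets with empty ones
  (\<open>binaryset\<close>); induction does the rest.\<close>

lemma E_finite_partition:
  assumes "finite I" "\<And>i. i \<in> I \<Longrightarrow> P i \<in> sets borel" "disjoint_family_on P I" "S \<in> sets borel"
    "S \<subseteq> (\<Union>i\<in>I. P i)"
  shows "E S x = (\<Sum>i\<in>I. E (S \<inter> P i) x)"
proof -
  have two: "E (A \<union> B) x = E A x + E B x" if "A \<in> sets borel" "B \<in> sets borel" "A \<inter> B = {}" for A B
  proof -
    have "(\<lambda>n. E (binaryset A B n) x) sums E (\<Union>n. binaryset A B n) x"
      using that by (intro E_sums) (auto simp: range_binaryset_eq disjoint_family_on_def binaryset_def)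
    moreover have "(\<lambda>n. E (binaryset A B n) x) sums (\<Sum>n\<in>{0,1}. E (binaryset A B n) x)"
      by (rule sums_finite) (auto simp: binaryset_def)
    ultimately show ?thesis
      using sums_unique2 by (fastforce simp: UN_binaryset_eq binaryset_def)
  qed
  have "E (S \<inter> (\<Union>i\<in>I. P i)) x = (\<Sum>i\<in>I. E (S \<inter> P i) x)"
    using assms(1,2,3)
  proof (induction I rule: finite_induct)
    case (insert i I)
    have "E (S \<inter> (\<Union>i\<in>insert i I. P i)) x = E ((S \<inter> P i) \<union> (S \<inter> (\<Union>i\<in>I. P i))) x"
      by (rule arg_cong[where f = "\<lambda>S. E S x"]) auto
    also have "\<dots> = E (S \<inter> P i) x + E (S \<inter> (\<Union>i\<in>I. P i)) x"
    proof (rule two)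
      show "S \<inter> (\<Union>i\<in>I. P i) \<in> sets borel"
        using insert assms(4) by (intro sets.Int sets.finite_UN) auto
      show "S \<inter> P i \<inter> (S \<inter> \<Union> (P ` I)) = {}"
        using insert.prems(2) insert.hyps by (fastforce simp: disjoint_family_on_def)
    qed (use insert assms(4) in auto)
    also have "\<dots> = E (S \<inter> P i) x + (\<Sum>i\<in>I. E (S \<inter> P i) x)"
      using insert by (simp add: disjoint_family_on_def)
    finally show ?case
      using insert by simp
  qed simp
  moreover have "S \<inter> (\<Union>i\<in>I. P i) = S"
    using assms(5) by auto
  ultimately show ?thesis by simp
qed

section \<open>Integrals of simple functions\<close>

lemma simple_function_vimage: "simple_function borel s \<Longrightarrow> s -` {c} \<in> sets borel"
  using simple_functionD(2)[of borel s "{c}"] by simp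

lemma simple_function_range: "simple_function (borel :: complex measure) s \<Longrightarrow> finite (range s)"
  using simple_functionD(1)[of borel s] by simp

text \<open>Simple functions to be added or multiplied have unrelated level sets. If
  \<open>s\<close> factors through \<open>q\<close>, the level sets of \<open>q\<close> refine those
  of \<open>s\<close>; letting \<open>q\<close> be a pair of functions yields a common partition on
  which sums and products are computed coefficient by coefficient.\<close>

lemma SSI_refine:
  assumes s: "simple_function borel s" and q: "simple_function borel q" and eq: "\<And>z. s z = \<phi> (q z)"
  shows "SSI s x = (\<Sum>k\<in>range q. \<phi> k *\<^sub>C E (q -` {k}) x)"
proof -
  have fin: "finite (range s)" "finite (range q)"
    using s q by (auto intro: simple_function_range)
  have "SSI s x = (\<Sum>c\<in>range s. c *\<^sub>C (\<Sum>k\<in>range q. E (s -` {c} \<inter> q -` {k}) x))"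
    unfolding simple_spectral_integral_def
  proof (intro sum.cong refl arg_cong[where f = "\<lambda>v. _ *\<^sub>C v"] E_finite_partition)
    show "disjoint_family_on (\<lambda>k. q -` {k}) (range q)"
      by (auto simp: disjoint_family_on_def)
  qed (use fin s q in \<open>auto intro: simple_function_vimage\<close>)
  also have "\<dots> = (\<Sum>k\<in>range q. \<Sum>c\<in>range s. c *\<^sub>C E (s -` {c} \<inter> q -` {k}) x)"
    unfolding scaleC_sum_right by (rule sum.swap)
  also have "\<dots> = (\<Sum>k\<in>range q. \<phi> k *\<^sub>C E (q -` {k}) x)"
  proof (rule sum.cong[OF refl])
    fix k assume k: "k \<in> range q"
    have *: "s -` {c} \<inter> q -` {k} = (if c = \<phi> k then q -` {k} else {})" for c
      by (auto simp: eq)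
    have "(\<Sum>c\<in>range s. c *\<^sub>C E (s -` {c} \<inter> q -` {k}) x)
        = (\<Sum>c\<in>range s. if c = \<phi> k then c *\<^sub>C E (q -` {k}) x else 0)"
      unfolding * by (rule sum.cong) auto
    also have "\<dots> = \<phi> k *\<^sub>C E (q -` {k}) x"
      using k fin by (auto simp: sum.delta eq image_iff)
    finally show "(\<Sum>c\<in>range s. c *\<^sub>C E (s -` {c} \<inter> q -` {k}) x) = \<phi> k *\<^sub>C E (q -` {k}) x" .
  qed
  finally show ?thesis .
qed

lemma SSI_add:
  assumes "simple_function borel s" "simple_function borel s'"
  shows "SSI (\<lambda>z. s z + s' z) x = SSI s x + SSI s' x"
proof -
  define q where "q z = (s z, s' z)" for z
  have q: "simple_function borel q"
    unfolding q_def using assms by (rule simple_function_Pair)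
  have "SSI (\<lambda>z. s z + s' z) x = (\<Sum>k\<in>range q. (fst k + snd k) *\<^sub>C E (q -` {k}) x)"
    by (rule SSI_refine) (use assms q in \<open>auto simp: q_def\<close>)
  moreover have "SSI s x = (\<Sum>k\<in>range q. fst k *\<^sub>C E (q -` {k}) x)"
    by (rule SSI_refine) (use assms q in \<open>auto simp: q_def\<close>)
  moreover have "SSI s' x = (\<Sum>k\<in>range q. snd k *\<^sub>C E (q -` {k}) x)"
    by (rule SSI_refine) (use assms q in \<open>auto simp: q_def\<close>)
  ultimately show ?thesis
    by (simp add: scaleC_add_left sum.distrib)
qed

lemma SSI_scaleC:
  assumes "simple_function borel s"
  shows "SSI (\<lambda>z. c * s z) x = c *\<^sub>C SSI s x"
proof -
  have "SSI (\<lambda>z. c * s z) x = (\<Sum>k\<in>range s. (c * k) *\<^sub>C E (s -` {k}) x)"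
    by (rule SSI_refine) (use assms in auto)
  then show ?thesis
    by (simp add: simple_spectral_integral_def scaleC_sum_right scaleC_scaleC)
qed

lemma SSI_diff:
  assumes "simple_function borel s" "simple_function borel s'"
  shows "SSI (\<lambda>z. s z - s' z) x = SSI s x - SSI s' x"
proof -
  have "simple_function borel (\<lambda>z. (-1) * s' z)"
    using assms by (intro simple_function_mult) auto
  then have "SSI (\<lambda>z. s z + (-1) * s' z) x = SSI s x + SSI (\<lambda>z. (-1) * s' z) x"
    using assms by (intro SSI_add)
  also have "\<dots> = SSI s x - SSI s' x"
    unfolding SSI_scaleC[OF assms(2)] by (simp add: scaleC_minus_left)
  finally show ?thesis by simp
qed

lemma E_SSI:
  assumes "simple_function borel s" "S \<in> sets borel"
  shows "E S (SSI s x) = SSI (\<lambda>z. indicator S z * s z) x"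
proof -
  interpret E: bounded_linear "E S"
    using bounded_clinear_E[OF assms(2)] by (rule bounded_clinearD)
  \<comment> \<open>The second component makes \<open>S\<close> a union of level sets of
    \<open>q\<close>, so \<open>E S\<close> keeps or annihilates each term as a whole.\<close>
  define q where "q z = (s z, indicator S z :: complex)" for z
  have sf: "simple_function borel (indicator S :: complex \<Rightarrow> complex)"
    using assms(2) by (rule simple_function_indicator)
  have q: "simple_function borel q"
    unfolding q_def using assms(1) sf by (rule simple_function_Pair)
  have "E S (SSI s x) = E S (\<Sum>k\<in>range q. fst k *\<^sub>C E (q -` {k}) x)"
    by (subst SSI_refine[of s q fst]) (use assms q in \<open>auto simp: q_def\<close>)
  also have "\<dots> = (\<Sum>k\<in>range q. fst k *\<^sub>C E (S \<inter> q -` {k}) x)"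
    using assms q by (simp add: E.sum bounded_clinearD(4)[OF bounded_clinear_E] E_Int simple_function_vimage)
  also have "\<dots> = (\<Sum>k\<in>range q. (snd k * fst k) *\<^sub>C E (q -` {k}) x)"
  proof (rule sum.cong[OF refl])
    fix k assume "k \<in> range q"
    then obtain w where w: "k = (s w, indicator S w)" by (auto simp: q_def)
    have "S \<inter> q -` {k} = (if w \<in> S then q -` {k} else {})"
      unfolding w by (auto simp: q_def indicator_def split: if_splits)
    then show "fst k *\<^sub>C E (S \<inter> q -` {k}) x = (snd k * fst k) *\<^sub>C E (q -` {k}) x"
      by (auto simp: w indicator_def)
  qed
  also have "\<dots> = SSI (\<lambda>z. indicator S z * s z) x"
    by (rule SSI_refine[symmetric]) (use assms q sf in \<open>auto simp: q_def intro!: simple_function_mult\<close>)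
  finally show ?thesis .
qed

text \<open>Disjoint level sets have orthogonal images under \<open>E\<close>, so Pythagoras turns
  the sum into an integral of the square. This isometry is what lets the integral extend to all of
  L^2.\<close>

lemma norm_SSI:
  assumes s: "simple_function borel s"
  shows "ennreal ((norm (SSI s x))\<^sup>2) = L2sq x s"
proof -
  have fin: "finite (range s)"
    using s by (rule simple_function_range)
  have [measurable]: "s -` {c} \<in> sets borel" for c
    using s by (rule simple_function_vimage)
  have "(norm (SSI s x))\<^sup>2 = (\<Sum>c\<in>range s. (norm (c *\<^sub>C E (s -` {c}) x))\<^sup>2)"
    unfolding simple_spectral_integral_def
  proof (rule norm_sum_Pythagorean[OF fin])
    show "pairwise (\<lambda>i j. orthogonal (i *\<^sub>C E (s -` {i}) x) (j *\<^sub>C E (s -` {j}) x)) (range s)"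
    proof (rule pairwiseI)
      fix i j :: complex assume "i \<noteq> j"
      then have "cinner (E (s -` {i}) x) (E (s -` {j}) x) = 0"
        using s by (intro inner_E_disjoint) (auto intro: simple_function_vimage)
      then show "orthogonal (i *\<^sub>C E (s -` {i}) x) (j *\<^sub>C E (s -` {j}) x)"
        by (simp add: orthogonal_def Re_cinner[symmetric] cinner_scaleC_left cinner_scaleC_right)
    qed
  qed
  then have "ennreal ((norm (SSI s x))\<^sup>2) = (\<Sum>c\<in>range s. ennreal ((cmod c)\<^sup>2) * emeasure (\<nu> x) (s -` {c}))"
    using s by (simp add: sum_ennreal[symmetric] emeasure_nu simple_function_vimage power_mult_distrib ennreal_mult)
  also have "\<dots> = (\<integral>\<^sup>+ z. (\<Sum>c\<in>range s. ennreal ((cmod c)\<^sup>2) * indicator (s -` {c}) z) \<partial>\<nu> x)"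
    using s by (subst nn_integral_sum) (auto simp: nn_integral_cmult_indicator simple_function_vimage)
  also have "\<dots> = L2sq x s"
  proof (rule nn_integral_cong)
    fix z
    have "(\<Sum>c\<in>range s. ennreal ((cmod c)\<^sup>2) * indicator (s -` {c}) z)
        = (\<Sum>c\<in>range s. if c = s z then ennreal ((cmod c)\<^sup>2) else 0)"
      by (rule sum.cong) auto
    then show "(\<Sum>c\<in>range s. ennreal ((cmod c)\<^sup>2) * indicator (s -` {c}) z) = ennreal ((cmod (s z))\<^sup>2)"
      using fin by (simp add: sum.delta)
  qed
  finally show ?thesis .
qed

section \<open>Extension to square integrable functions\<close>

lemma SI_iff: "(x, y) \<in> SI f \<longleftrightarrow> (\<exists>s. (\<forall>n. simple_function borel (s n)) \<and>
        (\<lambda>n. L2sq x (\<lambda>z. f z - s n z)) \<longlonglongrightarrow> 0 \<and> (\<lambda>n. SSI (s n) x) \<longlonglongrightarrow> y)"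
  by (simp add: spectral_integral_def)

lemma SSI_diff_le:
  assumes "f \<in> borel_measurable borel" "simple_function borel s" "simple_function borel s'"
  shows "ennreal ((norm (SSI s x - SSI s' x))\<^sup>2)
    \<le> 2 * L2sq x (\<lambda>z. f z - s z) + 2 * L2sq x (\<lambda>z. f z - s' z)"
proof -
  have "ennreal ((norm (SSI s x - SSI s' x))\<^sup>2) = L2sq x (\<lambda>z. s z - s' z)"
    using assms by (subst SSI_diff[symmetric]) (auto intro!: norm_SSI simple_function_diff)
  also have "\<dots> \<le> 2 * L2sq x (\<lambda>z. f z - s z) + 2 * L2sq x (\<lambda>z. f z - s' z)"
    using assms by (intro nn_integral_diff_sq_le) (auto intro: borel_measurable_simple_function)
  finally show ?thesis .
qed

text \<open>By the isometry the integrals of an L^2 approximating sequence are Cauchy, and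
  completeness supplies the limit. The norm identity passes to the limit because the squared norms
  of the approximants converge too.\<close>

lemma SI_exists:
  assumes f: "f \<in> borel_measurable borel" and fin: "L2sq x f < \<infinity>"
  shows "\<exists>y. (x, y) \<in> SI f \<and> ennreal ((norm y)\<^sup>2) = L2sq x f"
proof -
  obtain s where s: "\<And>n. simple_function borel (s n)" "(\<lambda>n. L2sq x (\<lambda>z. f z - s n z)) \<longlonglongrightarrow> 0"
    "(\<lambda>n. L2sq x (s n)) \<longlonglongrightarrow> L2sq x f"
    using simple_function_L2_approximation[of f "\<nu> x"] f fin by (auto simp del: infinity_ennreal_def)
  have "Cauchy (\<lambda>n. SSI (s n) x)"
  proof (rule metric_CauchyI)
    fix e :: real assume e: "0 < e"
    \<comment> \<open>A quarter, because the estimate below counts each of the two errors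
      twice.\<close>
    have "\<forall>\<^sub>F n in sequentially. L2sq x (\<lambda>z. f z - s n z) < ennreal (e\<^sup>2 / 4)"
      using e by (intro order_tendstoD(2)[OF s(2)]) auto
    then obtain N where N: "\<And>n. n \<ge> N \<Longrightarrow> L2sq x (\<lambda>z. f z - s n z) < ennreal (e\<^sup>2 / 4)"
      by (auto simp: eventually_sequentially)
    show "\<exists>M. \<forall>m\<ge>M. \<forall>n\<ge>M. dist (SSI (s m) x) (SSI (s n) x) < e"
    proof (intro exI[of _ N] allI impI)
      fix m n assume mn: "m \<ge> N" "n \<ge> N"
      have "ennreal ((norm (SSI (s m) x - SSI (s n) x))\<^sup>2)
          \<le> 2 * L2sq x (\<lambda>z. f z - s m z) + 2 * L2sq x (\<lambda>z. f z - s n z)"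
        by (rule SSI_diff_le[OF f s(1) s(1)])
      also have "\<dots> < 2 * ennreal (e\<^sup>2 / 4) + 2 * ennreal (e\<^sup>2 / 4)"
        by (intro add_strict_mono ennreal_mult_strict_left_mono N mn) auto
      also have "\<dots> = ennreal (e\<^sup>2)"
        by (simp add: ennreal_mult''[symmetric] ennreal_plus[symmetric] del: ennreal_plus
            flip: ennreal_numeral)
      finally have "(norm (SSI (s m) x - SSI (s n) x))\<^sup>2 < e\<^sup>2"
        by (simp add: ennreal_less_iff)
      then show "dist (SSI (s m) x) (SSI (s n) x) < e"
        using e by (simp add: dist_norm power_less_imp_less_base)
    qed
  qed
  then obtain y where y: "(\<lambda>n. SSI (s n) x) \<longlonglongrightarrow> y"
    using Cauchy_convergent convergent_def by blast
  have "(\<lambda>n. ennreal ((norm (SSI (s n) x))\<^sup>2)) \<longlonglongrightarrow> ennreal ((norm y)\<^sup>2)"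
    by (intro tendsto_ennrealI tendsto_intros y)
  then have "ennreal ((norm y)\<^sup>2) = L2sq x f"
    using s(1,3) by (simp add: norm_SSI LIMSEQ_unique)
  then show ?thesis
    using s y by (auto simp: SI_iff)
qed

lemma SI_unique:
  assumes f: "f \<in> borel_measurable borel" and "(x, y) \<in> SI f" "(x, y') \<in> SI f"
  shows "y = y'"
proof -
  obtain s where s: "\<And>n. simple_function borel (s n)" "(\<lambda>n. L2sq x (\<lambda>z. f z - s n z)) \<longlonglongrightarrow> 0"
      "(\<lambda>n. SSI (s n) x) \<longlonglongrightarrow> y"
    using assms by (auto simp: SI_iff)
  obtain s' where s': "\<And>n. simple_function borel (s' n)" "(\<lambda>n. L2sq x (\<lambda>z. f z - s' n z)) \<longlonglongrightarrow> 0"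
      "(\<lambda>n. SSI (s' n) x) \<longlonglongrightarrow> y'"
    using assms by (auto simp: SI_iff)
  have "(\<lambda>n. ennreal ((norm ((SSI (s n) x - SSI (s' n) x) - 0))\<^sup>2)) \<longlonglongrightarrow> 0"
  proof (rule squeeze_zero_ennreal[where c = 2])
    show "(\<lambda>n. L2sq x (\<lambda>z. f z - s n z) + L2sq x (\<lambda>z. f z - s' n z)) \<longlonglongrightarrow> 0"
      using tendsto_add[OF s(2) s'(2)] by simp
  qed (use SSI_diff_le[OF f s(1) s'(1)] in \<open>auto simp: distrib_left\<close>)
  then have "(\<lambda>n. SSI (s n) x - SSI (s' n) x) \<longlonglongrightarrow> 0"
    by (rule tendsto_of_norm_sq_ennreal)
  moreover have "(\<lambda>n. SSI (s n) x - SSI (s' n) x) \<longlonglongrightarrow> y - y'"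
    by (intro tendsto_intros s s')
  ultimately show ?thesis
    using LIMSEQ_unique by fastforce
qed

text \<open>Some approximant lies within distance 1 in L^2, and a simple function has finite L^2
  norm since \<open>norm_SSI\<close> equates it with the norm of a vector.\<close>

lemma SI_finite:
  assumes f: "f \<in> borel_measurable borel" and "(x, y) \<in> SI f"
  shows "L2sq x f < \<infinity>"
proof -
  obtain s where s: "\<And>n::nat. simple_function borel (s n)" "(\<lambda>n. L2sq x (\<lambda>z. f z - s n z)) \<longlonglongrightarrow> 0"
    using assms by (auto simp: SI_iff)
  have "\<forall>\<^sub>F n in sequentially. L2sq x (\<lambda>z. f z - s n z) < 1"
    by (intro order_tendstoD(2)[OF s(2)]) auto
  then obtain n where n: "L2sq x (\<lambda>z. f z - s n z) < 1"
    by (auto simp: eventually_sequentially)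
  have "L2sq x f \<le> 2 * L2sq x (\<lambda>z. f z - s n z) + 2 * L2sq x (s n)"
    using nn_integral_add_sq_le[of "\<lambda>z. f z - s n z" "\<nu> x" "s n"] f s(1)
    by (auto intro: borel_measurable_simple_function)
  also have "\<dots> < \<infinity>"
    using order_less_trans[OF n, of \<top>] by (simp add: norm_SSI[OF s(1), symmetric] ennreal_mult_less_top)
  finally show ?thesis .
qed

lemma SI_norm:
  assumes f: "f \<in> borel_measurable borel" and "(x, y) \<in> SI f"
  shows "ennreal ((norm y)\<^sup>2) = L2sq x f"
  using SI_exists[OF f SI_finite[OF assms]] SI_unique[OF f] assms(2) by blast

lemma SI_simple: "simple_function borel s \<Longrightarrow> (x, SSI s x) \<in> SI s"
  by (auto simp: SI_iff intro!: exI[of _ "\<lambda>_. s"])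

lemma SI_add:
  assumes f: "f \<in> borel_measurable borel" "(x, y) \<in> SI f"
    and g: "g \<in> borel_measurable borel" "(x, w) \<in> SI g"
  shows "(x, y + w) \<in> SI (\<lambda>z. f z + g z)"
proof -
  obtain s where s: "\<And>n. simple_function borel (s n)" "(\<lambda>n. L2sq x (\<lambda>z. f z - s n z)) \<longlonglongrightarrow> 0"
      "(\<lambda>n. SSI (s n) x) \<longlonglongrightarrow> y"
    using assms by (auto simp: SI_iff)
  obtain s' where s': "\<And>n. simple_function borel (s' n)" "(\<lambda>n. L2sq x (\<lambda>z. g z - s' n z)) \<longlonglongrightarrow> 0"
      "(\<lambda>n. SSI (s' n) x) \<longlonglongrightarrow> w"
    using assms by (auto simp: SI_iff)
  have [measurable]: "s n \<in> borel_measurable borel" "s' n \<in> borel_measurable borel"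
      "f \<in> borel_measurable borel" "g \<in> borel_measurable borel" for n
    using s(1) s'(1) f(1) g(1) by (auto intro: borel_measurable_simple_function)
  have "(\<lambda>n. L2sq x (\<lambda>z. (f z + g z) - (s n z + s' n z))) \<longlonglongrightarrow> 0"
  proof (rule squeeze_zero_ennreal[where c = 2])
    show "(\<lambda>n. L2sq x (\<lambda>z. f z - s n z) + L2sq x (\<lambda>z. g z - s' n z)) \<longlonglongrightarrow> 0"
      using tendsto_add[OF s(2) s'(2)] by simp
    show "L2sq x (\<lambda>z. (f z + g z) - (s n z + s' n z)) \<le> 2 * (L2sq x (\<lambda>z. f z - s n z) + L2sq x (\<lambda>z. g z - s' n z))" for n
      using nn_integral_add_sq_le[of "\<lambda>z. f z - s n z" "\<nu> x" "\<lambda>z. g z - s' n z"]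
      by (simp add: distrib_left algebra_simps)
  qed simp
  moreover have "(\<lambda>n. SSI (\<lambda>z. s n z + s' n z) x) \<longlonglongrightarrow> y + w"
    unfolding SSI_add[OF s(1) s'(1)] by (intro tendsto_intros s s')
  ultimately show ?thesis
    unfolding SI_iff using s(1) s'(1)
    by (intro exI[of _ "\<lambda>n z. s n z + s' n z"]) (auto intro: simple_function_add)
qed

lemma SI_scaleC:
  assumes f: "f \<in> borel_measurable borel" "(x, y) \<in> SI f"
  shows "(x, c *\<^sub>C y) \<in> SI (\<lambda>z. c * f z)"
proof -
  obtain s where s: "\<And>n. simple_function borel (s n)" "(\<lambda>n. L2sq x (\<lambda>z. f z - s n z)) \<longlonglongrightarrow> 0"
      "(\<lambda>n. SSI (s n) x) \<longlonglongrightarrow> y"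
    using assms by (auto simp: SI_iff)
  have [measurable]: "s n \<in> borel_measurable borel" "f \<in> borel_measurable borel" for n
    using s(1) f(1) by (auto intro: borel_measurable_simple_function)
  have "(\<lambda>n. L2sq x (\<lambda>z. c * f z - c * s n z)) \<longlonglongrightarrow> 0"
  proof (rule squeeze_zero_ennreal[OF s(2), where c = "ennreal ((cmod c)\<^sup>2)"])
    show "L2sq x (\<lambda>z. c * f z - c * s n z) \<le> ennreal ((cmod c)\<^sup>2) * L2sq x (\<lambda>z. f z - s n z)" for n
      by (subst nn_integral_cmult[symmetric])
         (auto simp: right_diff_distrib[symmetric] norm_mult power_mult_distrib ennreal_mult)
  qed simp
  moreover have "(\<lambda>n. SSI (\<lambda>z. c * s n z) x) \<longlonglongrightarrow> c *\<^sub>C y"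
    unfolding SSI_scaleC[OF s(1)] using bounded_linear.tendsto[OF bounded_linear_scaleC s(3)] .
  ultimately show ?thesis
    unfolding SI_iff using s(1)
    by (intro exI[of _ "\<lambda>n z. c * s n z"]) (auto intro: simple_function_mult)
qed

lemma SI_diff:
  assumes f: "f \<in> borel_measurable borel" "(x, y) \<in> SI f"
    and g: "g \<in> borel_measurable borel" "(x, w) \<in> SI g"
  shows "(x, y - w) \<in> SI (\<lambda>z. f z - g z)"
  using SI_add[OF f _ SI_scaleC[OF g, of "-1"]] g(1) by (simp add: scaleC_minus_left)

lemma SI_E:
  assumes f: "f \<in> borel_measurable borel" "(x, y) \<in> SI f" and S: "S \<in> sets borel"
  shows "(x, E S y) \<in> SI (\<lambda>z. indicator S z * f z)"
proof -
  obtain s where s: "\<And>n. simple_function borel (s n)" "(\<lambda>n. L2sq x (\<lambda>z. f z - s n z)) \<longlonglongrightarrow> 0"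
      "(\<lambda>n. SSI (s n) x) \<longlonglongrightarrow> y"
    using assms by (auto simp: SI_iff)
  have "(\<lambda>n. L2sq x (\<lambda>z. indicator S z * f z - indicator S z * s n z)) \<longlonglongrightarrow> 0"
  proof (rule squeeze_zero_ennreal[OF s(2), where c = 1])
    show "L2sq x (\<lambda>z. indicator S z * f z - indicator S z * s n z) \<le> 1 * L2sq x (\<lambda>z. f z - s n z)" for n
      by (auto simp: indicator_def intro!: nn_integral_mono)
  qed simp
  moreover have "(\<lambda>n. SSI (\<lambda>z. indicator S z * s n z) x) \<longlonglongrightarrow> E S y"
    unfolding E_SSI[OF s(1) S, symmetric]
    using bounded_linear.tendsto[OF bounded_clinearD(1)[OF bounded_clinear_E[OF S]] s(3)] .
  ultimately show ?thesis
    unfolding SI_iff using s(1) S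
    by (intro exI[of _ "\<lambda>n z. indicator S z * s n z"])
       (auto intro!: simple_function_mult simple_function_indicator)
qed

lemma SI_sum:
  assumes "finite I" "\<And>i. i \<in> I \<Longrightarrow> f i \<in> borel_measurable borel" "\<And>i. i \<in> I \<Longrightarrow> (x, y i) \<in> SI (f i)"
  shows "(x, \<Sum>i\<in>I. y i) \<in> SI (\<lambda>z. \<Sum>i\<in>I. f i z)"
  using assms
proof (induction I rule: finite_induct)
  case empty
  show ?case using SI_simple[of "\<lambda>_. 0" x] by (simp add: simple_spectral_integral_def)
next
  case (insert i I)
  then show ?case by (simp add: SI_add)
qed

lemma SI_one: "(x, x) \<in> SI (\<lambda>_. 1)"
  using SI_simple[of "\<lambda>_. 1" x] by (simp add: simple_spectral_integral_def E_UNIV vimage_def)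

lemma SI_indicator: "S \<in> sets borel \<Longrightarrow> (x, E S x) \<in> SI (indicator S)"
  using SI_E[OF _ SI_one] by simp

lemma SI_tendsto:
  assumes "\<And>n::nat. f n \<in> borel_measurable borel" "\<And>n. (x, y n) \<in> SI (f n)"
    and "g \<in> borel_measurable borel" "(\<lambda>n. L2sq x (\<lambda>z. f n z - g z)) \<longlonglongrightarrow> 0" "(x, w) \<in> SI g"
  shows "y \<longlonglongrightarrow> w"
proof (rule tendsto_of_norm_sq_ennreal)
  have "ennreal ((norm (y n - w))\<^sup>2) = L2sq x (\<lambda>z. f n z - g z)" for n
    by (rule SI_norm) (use assms in \<open>auto intro!: SI_diff\<close>)
  then show "(\<lambda>n. ennreal ((norm (y n - w))\<^sup>2)) \<longlonglongrightarrow> 0"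
    using assms(4) by simp
qed

text \<open>By \<open>SI_E\<close>, the vector \<open>E S y\<close> is the integral of
  \<open>f\<close> cut off to \<open>S\<close>, and its squared norm is the measure of
  \<open>S\<close> on both sides.\<close>

lemma nu_eq_density:
  assumes f: "f \<in> borel_measurable borel" "(x, y) \<in> SI f"
  shows "\<nu> y = density (\<nu> x) (\<lambda>z. ennreal ((cmod (f z))\<^sup>2))"
proof (rule measure_eqI)
  fix S assume "S \<in> sets (\<nu> y)"
  then have S[measurable]: "S \<in> sets borel" by simp
  have [measurable]: "f \<in> borel_measurable borel" by fact
  have "emeasure (\<nu> y) S = L2sq x (\<lambda>z. indicator S z * f z)"
    unfolding emeasure_nu[OF S] by (rule SI_norm[OF _ SI_E[OF f S]]) simp
  also have "\<dots> = emeasure (density (\<nu> x) (\<lambda>z. ennreal ((cmod (f z))\<^sup>2))) S"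
    by (subst emeasure_density) (auto simp: indicator_def intro!: nn_integral_cong)
  finally show "emeasure (\<nu> y) S = emeasure (density (\<nu> x) (\<lambda>z. ennreal ((cmod (f z))\<^sup>2))) S" .
qed simp

lemma L2sq_SI:
  assumes f: "f \<in> borel_measurable borel" "(x, y) \<in> SI f" and g: "g \<in> borel_measurable borel"
  shows "L2sq y g = L2sq x (\<lambda>z. g z * f z)"
proof -
  have [measurable]: "f \<in> borel_measurable borel" "g \<in> borel_measurable borel" by fact+
  show ?thesis
    unfolding nu_eq_density[OF f]
    by (subst nn_integral_density)
       (auto simp: norm_mult power_mult_distrib ennreal_mult mult.commute)
qed

text \<open>This reads an operator applied to a represented vector \<open>y\<close> as a
  multiplication seen from the original vector \<open>x\<close>. Forward: by the density formula,
  simple approximants of \<open>g\<close> in L^2 of \<open>y\<close>, multiplied by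
  \<open>f\<close>, approximate the product in L^2 of \<open>x\<close>. Backward: the same formula
  yields some integral of \<open>g\<close> at \<open>y\<close>, which the forward direction and
  uniqueness identify with \<open>w\<close>.\<close>

lemma SI_compose:
  assumes f: "f \<in> borel_measurable borel" "(x, y) \<in> SI f" and g: "g \<in> borel_measurable borel"
  shows "(y, w) \<in> SI g \<longleftrightarrow> (x, w) \<in> SI (\<lambda>z. g z * f z)"
proof -
  have [measurable]: "f \<in> borel_measurable borel" "g \<in> borel_measurable borel" by fact+
  have imp: "(x, w) \<in> SI (\<lambda>z. g z * f z)" if w: "(y, w) \<in> SI g" for w
  proof -
    obtain s where s: "\<And>n. simple_function borel (s n)" "(\<lambda>n. L2sq y (\<lambda>z. g z - s n z)) \<longlonglongrightarrow> 0"
      "(\<lambda>n. SSI (s n) y) \<longlonglongrightarrow> w"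
      using w by (auto simp: SI_iff)
    have [measurable]: "s n \<in> borel_measurable borel" for n
      using s(1) by (rule borel_measurable_simple_function)
    have sf: "(x, SSI (s n) y) \<in> SI (\<lambda>z. s n z * f z)" for n
    proof -
      have "(x, \<Sum>c\<in>range (s n). c *\<^sub>C E (s n -` {c}) y)
          \<in> SI (\<lambda>z. \<Sum>c\<in>range (s n). c * (indicator (s n -` {c}) z * f z))"
        using s(1)[of n] f simple_function_vimage[OF s(1)[of n]]
        by (intro SI_sum SI_scaleC SI_E simple_function_range) auto
      moreover have "(\<Sum>c\<in>range (s n). c * (indicator (s n -` {c}) z * f z)) = s n z * f z" for z
      proof -
        have "(\<Sum>c\<in>range (s n). c * (indicator (s n -` {c}) z * f z))
            = (\<Sum>c\<in>range (s n). if c = s n z then c * f z else 0)"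
          by (rule sum.cong) auto
        then show ?thesis
          using simple_function_range[OF s(1)[of n]] by (simp add: sum.delta)
      qed
      ultimately show ?thesis
        by (simp add: simple_spectral_integral_def)
    qed
    have "L2sq x (\<lambda>z. g z * f z) < \<infinity>"
      using SI_finite[OF g w] L2sq_SI[OF f g] by simp
    then obtain w' where w': "(x, w') \<in> SI (\<lambda>z. g z * f z)"
      using SI_exists[of "\<lambda>z. g z * f z" x] by auto
    have "(\<lambda>n. SSI (s n) y) \<longlonglongrightarrow> w'"
    proof (rule SI_tendsto[OF _ sf _ _ w'])
      have "L2sq x (\<lambda>z. s n z * f z - g z * f z) = L2sq y (\<lambda>z. g z - s n z)" for n
        by (subst L2sq_SI[OF f]) (auto simp: left_diff_distrib[symmetric] norm_mult norm_minus_commute)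
      then show "(\<lambda>n. L2sq x (\<lambda>z. s n z * f z - g z * f z)) \<longlonglongrightarrow> 0"
        using s(2) by simp
    qed auto
    then show ?thesis
      using w' s(3) LIMSEQ_unique by blast
  qed
  show ?thesis
  proof
    assume w: "(x, w) \<in> SI (\<lambda>z. g z * f z)"
    then have "L2sq y g < \<infinity>"
      using SI_finite[OF _ w] L2sq_SI[OF f g] by simp
    then obtain w' where w': "(y, w') \<in> SI g"
      using SI_exists[OF g] by blast
    have "w' = w"
      by (rule SI_unique[OF _ imp[OF w'] w]) simp
    then show "(y, w) \<in> SI g"
      using w' by simp
  qed (rule imp)
qed

end

section \<open>Strongly continuous semigroups\<close>

text \<open>Baire category: the closed sets \<open>C k\<close> cover the space, so one of them
  contains a ball, and linearity spreads the bound on that ball to all vectors.\<close>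

lemma uniform_boundedness:
  fixes F :: "nat \<Rightarrow> 'a::banach \<Rightarrow> 'b::real_normed_vector"
  assumes lin: "\<And>n. bounded_linear (F n)" and bdd: "\<And>x. \<exists>K. \<forall>n. norm (F n x) \<le> K"
  shows "\<exists>K. \<forall>n x. norm (F n x) \<le> K * norm x"
proof -
  define C where "C k = {x. \<forall>n. norm (F n x) \<le> real k}" for k :: nat
  have "\<exists>k. x \<in> C k" for x
  proof -
    obtain K where K: "\<And>n. norm (F n x) \<le> K" using bdd by blast
    obtain k :: nat where "K \<le> real k" using real_arch_simple by blast
    then have "norm (F n x) \<le> real k" for n using K[of n] by linarith
    then show ?thesis by (auto simp: C_def)
  qed
  then have "\<Union> (range C) = UNIV" by blast
  moreover have "closed (C k)" for k
  proof -
    have "C k = (\<Inter>n. {x. norm (F n x) \<le> real k})" by (auto simp: C_def)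
    moreover have "closed {x. norm (F n x) \<le> real k}" for n
      by (intro closed_Collect_le continuous_intros linear_continuous_on lin)
    ultimately show ?thesis by auto
  qed
  moreover have "completely_metrizable_space (euclidean :: 'a topology)"
    by (rule completely_metrizable_space_euclidean)
  moreover have "euclidean interior_of \<Union> (range C) \<noteq> {}"
    using calculation(1) by simp
  ultimately have "\<exists>k. interior (C k) \<noteq> {}"
    using Baire_category_alt[of "euclidean :: 'a topology" "range C"]
    by (metis closed_closedin countableI_type countable_image imageE euclidean_interior_of)
  then obtain k where "interior (C k) \<noteq> {}" by blast
  then obtain x0 e where e: "e > 0" "ball x0 e \<subseteq> C k"
    by (meson ex_in_conv mem_interior)
  have "norm (F n x) \<le> (4 * real k / e) * norm x" for n x
  proof (cases "x = 0")
    case True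
    then show ?thesis using lin by (simp add: linear_simps(3))
  next
    case False
    \<comment> \<open>This scales \<open>x\<close> to length \<open>e / 2\<close>, so the shifted
      centre stays in the ball. Two values bounded by \<open>k\<close> differ by at most
      \<open>2 * k\<close>, and division by \<open>c\<close> produces the factor
      \<open>4 * k / e\<close>.\<close>
    define c where "c = e / (2 * norm x)"
    have c: "c > 0" using e False by (simp add: c_def)
    have "norm (c *\<^sub>R x) < e" using e False by (simp add: c_def)
    then have "x0 + c *\<^sub>R x \<in> C k" "x0 \<in> C k"
      using e by (auto intro!: subsetD[OF e(2)] simp: dist_norm)
    then have "norm (F n (x0 + c *\<^sub>R x)) \<le> real k" "norm (F n x0) \<le> real k"
      by (auto simp: C_def)
    then have "norm (F n (x0 + c *\<^sub>R x) - F n x0) \<le> 2 * real k"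
      using norm_triangle_ineq4[of "F n (x0 + c *\<^sub>R x)" "F n x0"] by linarith
    moreover have "F n (x0 + c *\<^sub>R x) - F n x0 = c *\<^sub>R F n x"
      using lin by (simp add: linear_simps)
    ultimately have "c * norm (F n x) \<le> 2 * real k" using c by simp
    then have "norm (F n x) \<le> 2 * real k / c" using c by (simp add: field_simps)
    then show ?thesis using False e by (simp add: c_def field_simps)
  qed
  then show ?thesis by blast
qed

locale c0_semigroup =
  fixes T :: "real \<Rightarrow> 'a::chilbert_space \<Rightarrow> 'a"
  assumes c0: "C0_semigroup T"
begin

lemma bounded_clinear_T: "t \<ge> 0 \<Longrightarrow> bounded_clinear (T t)"
  using c0 by (simp add: C0_semigroup_def)

lemmas T_linear = bounded_clinearD[OF bounded_clinear_T]

lemma T_0 [simp]: "T 0 x = x"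
  using c0 by (simp add: C0_semigroup_def)

lemma T_add: "s \<ge> 0 \<Longrightarrow> t \<ge> 0 \<Longrightarrow> T (s + t) x = T s (T t x)"
  using c0 by (simp add: C0_semigroup_def)

lemma T_commute: "s \<ge> 0 \<Longrightarrow> t \<ge> 0 \<Longrightarrow> T s (T t x) = T t (T s x)"
  by (metis T_add add.commute)

lemma T_continuous_0: "continuous (at 0 within {0..}) (\<lambda>t. T t x)"
proof -
  have "at 0 within {0..} = at_right (0::real)"
    by (intro at_within_nhd[of _ UNIV]) auto
  then show ?thesis
    using c0 by (simp add: C0_semigroup_def continuous_within)
qed

lemma T_near_id:
  assumes "e > 0"
  obtains d where "d > 0" "\<And>h. 0 \<le> h \<Longrightarrow> h < d \<Longrightarrow> norm (T h x - x) < e"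
proof -
  obtain d where "d > 0" "\<forall>h\<in>{0..}. dist h 0 < d \<longrightarrow> dist (T h x) (T 0 x) < e"
    using T_continuous_0[of x] assms unfolding continuous_within_eps_delta by blast
  then show ?thesis using that[of d] by (simp add: dist_norm)
qed

text \<open>Otherwise there are times tending to 0 along which the operator norms are unbounded.
  Strong continuity at 0 bounds each orbit along these times, so uniform boundedness gives a
  contradiction.\<close>

lemma T_bound_near_0: "\<exists>\<delta>>0. \<exists>M\<ge>1. \<forall>t\<in>{0..\<delta>}. \<forall>x. norm (T t x) \<le> M * norm x"
proof (rule ccontr)
  assume "\<not> ?thesis"
  then have "\<forall>\<delta>>0. \<forall>M\<ge>1. \<exists>t\<in>{0..\<delta>}. \<exists>x. norm (T t x) > M * norm x"
    by (meson not_le)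
  then have "\<exists>t\<in>{0..1 / real (Suc n)}. \<exists>x. norm (T t x) > real (Suc n) * norm x" for n
    by simp
  then obtain t where t: "\<And>n. t n \<in> {0..1 / real (Suc n)}"
      "\<And>n. \<exists>x. norm (T (t n) x) > real (Suc n) * norm x"
    by metis
  have lim: "t \<longlonglongrightarrow> 0"
  proof (rule tendsto_sandwich[OF _ _ tendsto_const])
    show "(\<lambda>n. 1 / real (Suc n)) \<longlonglongrightarrow> 0"
      using LIMSEQ_inverse_real_of_nat by (simp add: inverse_eq_divide)
  qed (use t(1) in auto)
  have "\<exists>K. \<forall>n x. norm (T (t n) x) \<le> K * norm x"
  proof (rule uniform_boundedness)
    show "bounded_linear (T (t n))" for n
      using t(1)[of n] by (intro T_linear) auto
    show "\<exists>K. \<forall>n. norm (T (t n) x) \<le> K" for x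
    proof -
      have "(\<lambda>n. T (t n) x) \<longlonglongrightarrow> T 0 x"
        using continuous_within_tendsto_compose'[OF T_continuous_0 _ lim, of x] t(1) by simp
      then have "bounded (range (\<lambda>n. T (t n) x))"
        by (rule convergent_imp_bounded)
      then show ?thesis by (auto simp: bounded_iff)
    qed
  qed
  then obtain K where K: "\<And>n x. norm (T (t n) x) \<le> K * norm x" by blast
  obtain n :: nat where n: "K \<le> real n" using real_arch_simple by blast
  obtain x where x: "norm (T (t n) x) > real (Suc n) * norm x" using t(2) by blast
  have "norm (T (t n) x) \<le> real (Suc n) * norm x"
    using K[of n x] n mult_right_mono[of K "real (Suc n)" "norm x"] by simp
  then show False using x by simp
qed

lemma T_bound:
  obtains M where "M \<ge> 1" "\<And>t x. 0 \<le> t \<Longrightarrow> t \<le> \<tau> \<Longrightarrow> norm (T t x) \<le> M * norm x"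
proof -
  obtain \<delta> M where \<delta>: "\<delta> > 0" and M: "M \<ge> 1" "\<And>t x. 0 \<le> t \<Longrightarrow> t \<le> \<delta> \<Longrightarrow> norm (T t x) \<le> M * norm x"
    using T_bound_near_0 by auto
  \<comment> \<open>One factor \<open>M\<close> is spent per step of length \<open>\<delta>\<close>;
    \<open>M \<ge> 1\<close> keeps earlier bounds valid as the exponent grows.\<close>
  have *: "norm (T t x) \<le> M ^ Suc n * norm x" if "0 \<le> t" "t \<le> real (Suc n) * \<delta>" for t x n
    using that
  proof (induction n arbitrary: t)
    case 0
    then show ?case using M by simp
  next
    case (Suc n)
    show ?case
    proof (cases "t \<le> real (Suc n) * \<delta>")
      case True
      then have "norm (T t x) \<le> M ^ Suc n * norm x" using Suc by blast
      also have "\<dots> \<le> M ^ Suc (Suc n) * norm x"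
        using M(1) by (intro mult_right_mono power_increasing) auto
      finally show ?thesis .
    next
      case False
      have \<delta>t: "\<delta> \<le> t"
        using False \<delta> by (simp add: algebra_simps) (smt (verit) mult_nonneg_nonneg of_nat_0_le_iff)
      have "T t x = T \<delta> (T (t - \<delta>) x)"
        using T_add[of \<delta> "t - \<delta>" x] \<delta> \<delta>t by simp
      then have "norm (T t x) \<le> M * norm (T (t - \<delta>) x)"
        using M(2)[of \<delta>] \<delta> by simp
      also have "\<dots> \<le> M * (M ^ Suc n * norm x)"
        using Suc \<delta>t M(1) by (intro mult_left_mono Suc.IH) (auto simp: algebra_simps)
      finally show ?thesis by simp
    qed
  qed
  obtain n :: nat where "\<tau> / \<delta> \<le> real n" using real_arch_simple by blast
  then have n: "\<tau> \<le> real (Suc n) * \<delta>" using \<delta> by (simp add: field_simps)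
  show ?thesis
  proof (rule that[of "M ^ Suc n"])
    show "1 \<le> M ^ Suc n" using M(1) by (rule one_le_power)
  qed (use * n order_trans in blast)
qed

text \<open>Continuity from either side reduces to the right limit at 0: for
  \<open>a \<le> b\<close> the increment is \<open>T a (T (b - a) x - x)\<close>, and
  \<open>T a\<close> is bounded uniformly on the interval.\<close>

lemma T_continuous_on: "continuous_on {0..\<tau>} (\<lambda>t. T t x)"
proof -
  obtain M where M: "M \<ge> 1" "\<And>t x. 0 \<le> t \<Longrightarrow> t \<le> \<tau> \<Longrightarrow> norm (T t x) \<le> M * norm x"
    using T_bound by blast
  show ?thesis
    unfolding continuous_on_iff
  proof (intro ballI allI impI)
    fix t e :: real assume t: "t \<in> {0..\<tau>}" and e: "0 < e"
    obtain d where d: "d > 0" "\<And>h. 0 \<le> h \<Longrightarrow> h < d \<Longrightarrow> norm (T h x - x) < e / M"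
      using T_near_id[of "e / M"] e M(1) by auto
    have *: "norm (T b x - T a x) < e" if "0 \<le> a" "a \<le> b" "b \<le> \<tau>" "b - a < d" for a b
    proof -
      have "T b x - T a x = T a (T (b - a) x - x)"
        using T_add[of a "b - a" x] that by (simp add: T_linear)
      then have "norm (T b x - T a x) \<le> M * norm (T (b - a) x - x)"
        using M(2) that by simp
      also have "\<dots> < M * (e / M)"
        using d(2)[of "b - a"] that M(1) by (intro mult_strict_left_mono) auto
      finally show ?thesis using M(1) by simp
    qed
    show "\<exists>d>0. \<forall>t'\<in>{0..\<tau>}. dist t' t < d \<longrightarrow> dist (T t' x) (T t x) < e"
    proof (intro exI[of _ d] conjI ballI impI d(1))
      fix t' assume t': "t' \<in> {0..\<tau>}" "dist t' t < d"
      show "dist (T t' x) (T t x) < e"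
        using *[of t t'] *[of t' t] t t'
        by (cases "t \<le> t'") (auto simp: dist_norm norm_minus_commute)
    qed
  qed
qed

section \<open>The generator and its Cauchy problem\<close>

lemma generatorD:
  "(x, y) \<in> generator T \<Longrightarrow> ((\<lambda>h. (1 / h) *\<^sub>R (T h x - x)) \<longlongrightarrow> y) (at_right 0)"
  by (simp add: generator_def)

lemma generator_unique: "(x, y) \<in> generator T \<Longrightarrow> (x, y') \<in> generator T \<Longrightarrow> y = y'"
  unfolding generator_def by (auto intro: tendsto_unique[of "at_right (0::real)"])

lemma generator_zero: "(0, 0) \<in> generator T"
proof -
  have "\<forall>\<^sub>F h in at_right 0. (0::'a) = (1 / h) *\<^sub>R (T h 0 - 0)"
    unfolding eventually_at_right_field by (intro exI[of _ 1]) (auto simp: T_linear)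
  then have "((\<lambda>h. (1 / h) *\<^sub>R (T h 0 - 0)) \<longlongrightarrow> (0::'a)) (at_right 0)"
    by (rule Lim_transform_eventually[OF tendsto_const])
  then show ?thesis by (simp add: generator_def)
qed

lemma generator_T:
  assumes "(x, y) \<in> generator T" "t \<ge> 0"
  shows "(T t x, T t y) \<in> generator T"
proof -
  have "((\<lambda>h. T t ((1 / h) *\<^sub>R (T h x - x))) \<longlongrightarrow> T t y) (at_right 0)"
    by (intro bounded_linear.tendsto[OF T_linear(1)] generatorD assms)
  moreover have "\<forall>\<^sub>F h in at_right 0. T t ((1 / h) *\<^sub>R (T h x - x)) = (1 / h) *\<^sub>R (T h (T t x) - T t x)"
    unfolding eventually_at_right_field using assms(2)
    by (intro exI[of _ 1]) (auto simp: T_linear T_commute[of t])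
  ultimately have "((\<lambda>h. (1 / h) *\<^sub>R (T h (T t x) - T t x)) \<longlongrightarrow> T t y) (at_right 0)"
    by (rule Lim_transform_eventually)
  then show ?thesis by (simp add: generator_def)
qed

text \<open>The averages of the orbit of \<open>x\<close> over short intervals starting at 0 lie in
  the domain and converge to \<open>x\<close>. Surjectivity of the isometry from X_{-1} to X rests
  on this density.\<close>

lemma dense_generator_domain: "closure (Domain (generator T)) = UNIV"
proof -
  have "x \<in> closure (Domain (generator T))" for x
  proof -
    define F where "F u = integral {0..u} (\<lambda>s. T s x)" for u
    have int: "(\<lambda>s. T s x) integrable_on {a..b}" if "0 \<le> a" for a b
      by (intro integrable_continuous_interval continuous_on_subset[OF T_continuous_on[of b]])
         (use that in auto)
    have right: "((\<lambda>k. (1 / k) *\<^sub>R (F (h + k) - F h)) \<longlongrightarrow> T h x) (at_right 0)" if h: "h \<ge> 0" for h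
    proof -
      have "(F has_vector_derivative T h x) (at h within {0..h+1})"
        unfolding F_def using h by (intro integral_has_vector_derivative T_continuous_on) auto
      note F = this[unfolded has_vector_derivative_def has_derivative_within_alt]
      show ?thesis
      proof (rule tendstoI)
        fix e :: real assume e: "0 < e"
        obtain d where d: "d > 0" "\<And>y. y \<in> {0..h+1} \<Longrightarrow> norm (y - h) < d \<Longrightarrow>
            norm (F y - F h - (y - h) *\<^sub>R T h x) \<le> e / 2 * norm (y - h)"
          using F e half_gt_zero[OF e] by blast
        have "dist ((1 / k) *\<^sub>R (F (h + k) - F h)) (T h x) < e" if k: "0 < k" "k < min d 1" for k
        proof -
          have "(1 / k) *\<^sub>R (F (h + k) - F h) - T h x = (1 / k) *\<^sub>R (F (h + k) - F h - k *\<^sub>R T h x)"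
            using k by (simp add: scaleR_diff_right)
          then have "dist ((1 / k) *\<^sub>R (F (h + k) - F h)) (T h x)
              = (1 / k) * norm (F (h + k) - F h - k *\<^sub>R T h x)"
            unfolding dist_norm using k by simp
          also have "\<dots> \<le> (1 / k) * (e / 2 * k)"
            using d(2)[of "h + k"] h k by (intro mult_left_mono) auto
          also have "\<dots> < e" using e k by simp
          finally show ?thesis .
        qed
        then show "\<forall>\<^sub>F k in at_right 0. dist ((1 / k) *\<^sub>R (F (h + k) - F h)) (T h x) < e"
          unfolding eventually_at_right_field using d(1) by (intro exI[of _ "min d 1"]) auto
      qed
    qed
    have F0: "F 0 = 0" by (simp add: F_def)
    have dom: "F h \<in> Domain (generator T)" if h: "h \<ge> 0" for h
    proof -
      \<comment> \<open>Applying \<open>T k\<close> shifts the interval of integration, so only two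
        end pieces survive in \<open>T k (F h) - F h\<close>; each is a right difference quotient of
        \<open>F\<close> after division by \<open>k\<close>.\<close>
      have "T k (F h) = F (h + k) - F k" if k: "k \<ge> 0" for k
      proof -
        have "T k (F h) = integral {0..h} (T k \<circ> (\<lambda>s. T s x))"
          unfolding F_def by (rule integral_linear[symmetric]) (use int k T_linear in auto)
        also have "\<dots> = integral {0..h} ((\<lambda>s. T s x) \<circ> (+) k)"
          by (rule integral_cong) (use k T_add in auto)
        also have "\<dots> = integral {k..h + k} (\<lambda>s. T s x)"
          using integral_shift_cbox_plus[of 0 h "\<lambda>s. T s x" k] by simp
        also have "\<dots> = F (h + k) - F k"
          unfolding F_def using Henstock_Kurzweil_Integration.integral_combine[where a = 0 and c = k and b = "h + k" and f = "\<lambda>s. T s x"] int[of 0 "h + k"] h k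
          by (simp add: algebra_simps)
        finally show ?thesis .
      qed
      then have "\<forall>\<^sub>F k in at_right 0. (1 / k) *\<^sub>R (F (h + k) - F h) - (1 / k) *\<^sub>R (F (0 + k) - F 0)
          = (1 / k) *\<^sub>R (T k (F h) - F h)"
        unfolding eventually_at_right_field F0
        by (intro exI[of _ 1]) (auto simp: scaleR_diff_right)
      moreover have "((\<lambda>k. (1 / k) *\<^sub>R (F (h + k) - F h) - (1 / k) *\<^sub>R (F (0 + k) - F 0)) \<longlongrightarrow> T h x - T 0 x) (at_right 0)"
        using h by (intro tendsto_diff right) auto
      ultimately have "((\<lambda>k. (1 / k) *\<^sub>R (T k (F h) - F h)) \<longlongrightarrow> T h x - T 0 x) (at_right 0)"
        by (rule Lim_transform_eventually[rotated])
      then have "(F h, T h x - T 0 x) \<in> generator T"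
        by (simp add: generator_def)
      then show ?thesis by blast
    qed
    have scale: "c *\<^sub>R y \<in> Domain (generator T)" if y: "y \<in> Domain (generator T)" for c y
    proof -
      obtain v where v: "(y, v) \<in> generator T" using y by blast
      have "((\<lambda>h. c *\<^sub>R (1 / h) *\<^sub>R (T h y - y)) \<longlongrightarrow> c *\<^sub>R v) (at_right 0)"
        by (intro tendsto_intros generatorD v)
      moreover have "\<forall>\<^sub>F h in at_right 0. c *\<^sub>R (1 / h) *\<^sub>R (T h y - y) = (1 / h) *\<^sub>R (T h (c *\<^sub>R y) - c *\<^sub>R y)"
        unfolding eventually_at_right_field
        by (intro exI[of _ 1]) (auto simp: T_linear scaleR_diff_right)
      ultimately have "(c *\<^sub>R y, c *\<^sub>R v) \<in> generator T"
        unfolding generator_def by (auto elim: Lim_transform_eventually)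
      then show ?thesis by blast
    qed
    have "((\<lambda>k. (1 / k) *\<^sub>R F k) \<longlongrightarrow> x) (at_right 0)"
      using right[of 0] by (simp add: F0)
    moreover have "\<forall>\<^sub>F k in at_right 0. (1 / k) *\<^sub>R F k \<in> closure (Domain (generator T))"
      unfolding eventually_at_right_field
      by (intro exI[of _ 1]) (auto intro!: subsetD[OF closure_subset] scale dom)
    ultimately show ?thesis
      by (intro Lim_in_closed_set[OF closed_closure _ trivial_limit_at_right_real])
  qed
  then show ?thesis by blast
qed

text \<open>The point is that \<open>s \<mapsto> T (t - s) (g s)\<close> has derivative zero.\<close>

lemma cauchy_problem_unique:
  assumes t: "t \<ge> 0"
    and g: "\<And>s. s \<in> {0..t} \<Longrightarrow> (g has_vector_derivative g' s) (at s within {0..t})"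
    and gen: "\<And>s. s \<in> {0..t} \<Longrightarrow> (g s, g' s) \<in> generator T"
  shows "T t (g 0) = g t"
proof -
  obtain M where M: "M \<ge> 1" "\<And>s x. 0 \<le> s \<Longrightarrow> s \<le> t \<Longrightarrow> norm (T s x) \<le> M * norm x"
    using T_bound by blast
  define \<phi> where "\<phi> s = T (t - s) (g s)" for s
  have "(\<phi> has_vector_derivative 0) (at s within {0..t})" if s: "s \<in> {0..t}" for s
    unfolding has_vector_derivative_def has_derivative_within_alt
  proof (intro conjI allI impI)
    show "bounded_linear (\<lambda>x. x *\<^sub>R (0::'a))" by simp
  next
    fix e :: real assume e: "0 < e"
    \<comment> \<open>Chosen for the worse case \<open>y < s\<close> below, where the errors add up
      to \<open>M * (M * e' + 2 * e')\<close> per unit of time.\<close>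
    define e' where "e' = e / (M * (M + 2))"
    have e': "e' > 0" using e M(1) by (simp add: e'_def)
    obtain d1 where d1: "d1 > 0" "\<And>y. y \<in> {0..t} \<Longrightarrow> norm (y - s) < d1 \<Longrightarrow>
        norm (g y - g s - (y - s) *\<^sub>R g' s) \<le> e' * norm (y - s)"
      using g[OF s] e' unfolding has_vector_derivative_def has_derivative_within_alt by blast
    have "\<forall>\<^sub>F h in at_right 0. dist ((1 / h) *\<^sub>R (T h (g s) - g s)) (g' s) < e'"
      by (rule tendstoD[OF generatorD[OF gen[OF s]] e'])
    then obtain d2 where d2: "d2 > 0" "\<And>h. 0 < h \<Longrightarrow> h < d2 \<Longrightarrow> dist ((1 / h) *\<^sub>R (T h (g s) - g s)) (g' s) < e'"
      unfolding eventually_at_right_field by auto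
    have d2': "norm (T h (g s) - g s - h *\<^sub>R g' s) \<le> e' * h" if "0 < h" "h < d2" for h
    proof -
      have "T h (g s) - g s - h *\<^sub>R g' s = h *\<^sub>R ((1 / h) *\<^sub>R (T h (g s) - g s) - g' s)"
        using that by (simp add: scaleR_diff_right)
      then show ?thesis
        using d2(2)[OF that] that by (simp add: dist_norm mult.commute mult_left_mono)
    qed
    obtain d3 where d3: "d3 > 0" "\<And>h. 0 \<le> h \<Longrightarrow> h < d3 \<Longrightarrow> norm (T h (g' s) - g' s) < e'"
      using T_near_id[OF e'] by blast
    define d where "d = min d1 (min d2 d3)"
    show "\<exists>d>0. \<forall>y\<in>{0..t}. norm (y - s) < d \<longrightarrow> norm (\<phi> y - \<phi> s - (y - s) *\<^sub>R 0) \<le> e * norm (y - s)"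
    proof (intro exI[of _ d] conjI ballI impI)
      show "d > 0" using d1 d2 d3 by (simp add: d_def)
      fix y assume y: "y \<in> {0..t}" "norm (y - s) < d"
      consider "y = s" | "s < y" | "y < s" by linarith
      then show "norm (\<phi> y - \<phi> s - (y - s) *\<^sub>R 0) \<le> e * norm (y - s)"
      proof cases
        case 1
        then show ?thesis by simp
      next
        case 2
        define h where "h = y - s"
        have h: "0 < h" "h < d" "y = s + h" using 2 y by (auto simp: h_def)
        have "T (t - s) (g s) = T (t - y) (T h (g s))"
          using T_add[of "t - y" h] h y by simp
        then have "\<phi> y - \<phi> s = T (t - y) (g y - T h (g s))"
          using y by (simp add: \<phi>_def T_linear)
        then have "norm (\<phi> y - \<phi> s) \<le> M * norm (g y - T h (g s))"
          using M(2) y s by simp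
        also have "g y - T h (g s) = (g y - g s - h *\<^sub>R g' s) - (T h (g s) - g s - h *\<^sub>R g' s)"
          by simp
        also have "M * norm \<dots> \<le> M * (e' * h + e' * h)"
        proof (rule mult_left_mono[OF order_trans[OF norm_triangle_ineq4 add_mono]])
          show "norm (g y - g s - h *\<^sub>R g' s) \<le> e' * h"
            using d1(2)[OF y(1)] h by (simp add: d_def)
          show "norm (T h (g s) - g s - h *\<^sub>R g' s) \<le> e' * h"
            using d2' h by (simp add: d_def)
        qed (use M(1) in auto)
        also have "\<dots> \<le> M * (M + 2) * e' * h"
          using M(1) e' h by (simp add: algebra_simps)
        also have "\<dots> = e * h" using M(1) by (simp add: e'_def)
        finally show ?thesis using h by simp
      next
        case 3
        define h where "h = s - y"
        have h: "0 < h" "h < d" "y = s - h" using 3 y by (auto simp: h_def)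
        have "T (t - y) (g y) = T (t - s) (T h (g y))"
          using T_add[of "t - s" h "g y"] h s by (simp add: diff_diff_eq2 diff_add_eq)
        then have "\<phi> y - \<phi> s = T (t - s) (T h (g y) - g s)"
          using s by (simp add: \<phi>_def T_linear)
        then have "norm (\<phi> y - \<phi> s) \<le> M * norm (T h (g y) - g s)"
          using M(2) y s by simp
        \<comment> \<open>To the left of \<open>s\<close> the operator \<open>T h\<close> acts on
          the moving vector \<open>g y\<close>. The three pieces are the Taylor remainder of
          \<open>g\<close> under \<open>T h\<close>, the generator quotient at the fixed vector
          \<open>g s\<close>, and the strong continuity error at \<open>g' s\<close>.\<close>
        also have "T h (g y) - g s = T h (g y - g s + h *\<^sub>R g' s) + ((T h (g s) - g s - h *\<^sub>R g' s)
            - h *\<^sub>R (T h (g' s) - g' s))"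
          using h by (simp add: T_linear scaleR_diff_right)
        also have "M * norm \<dots> \<le> M * (M * (e' * h) + (e' * h + e' * h))"
        proof (rule mult_left_mono[OF order_trans[OF norm_triangle_ineq
              add_mono[OF _ order_trans[OF norm_triangle_ineq4 add_mono]]]])
          have "norm (g y - g s + h *\<^sub>R g' s) \<le> e' * h"
            using d1(2)[OF y(1)] h by (simp add: d_def)
          then show "norm (T h (g y - g s + h *\<^sub>R g' s)) \<le> M * (e' * h)"
            using M(1) h y s by (intro order_trans[OF M(2)] mult_left_mono) auto
          show "norm (T h (g s) - g s - h *\<^sub>R g' s) \<le> e' * h"
            using d2' h by (simp add: d_def)
          show "norm (h *\<^sub>R (T h (g' s) - g' s)) \<le> e' * h"
            using d3(2)[of h] h by (simp add: d_def mult.commute)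
        qed (use M(1) in auto)
        also have "\<dots> = M * (M + 2) * e' * h" by (simp add: algebra_simps)
        also have "\<dots> = e * h" using M(1) by (simp add: e'_def)
        finally show ?thesis using h by simp
      qed
    qed
  qed
  then obtain c where "\<And>s. s \<in> {0..t} \<Longrightarrow> \<phi> s = c"
    using has_vector_derivative_zero_constant[of "{0..t}" \<phi>] by blast
  then have "\<phi> 0 = \<phi> t" using t by simp
  then show ?thesis by (simp add: \<phi>_def)
qed

end

section \<open>Resolvents and the extrapolation space\<close>

lemma bounded_clinear_compose:
  assumes "bounded_clinear f" "bounded_clinear g"
  shows "bounded_clinear (\<lambda>x. f (g x))"
  using assms unfolding bounded_clinear_def clinear_def
  by (auto intro: bounded_linear_compose bounded_linear.linear)

lemma bounded_clinearI:
  assumes "\<And>x y. f (x + y) = f x + f y" "\<And>c x. f (c *\<^sub>C x) = c *\<^sub>C f x" "\<And>x. norm (f x) \<le> norm x * K"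
  shows "bounded_clinear f"
proof -
  have "f (a *\<^sub>R x) = a *\<^sub>R f x" for a x
    using assms(2)[of "complex_of_real a" x] by (simp add: scaleC_of_real)
  then have "bounded_linear f"
    using assms(1,3) by (intro bounded_linear_intro)
  then show ?thesis
    using assms(2) by (simp add: bounded_clinear_def clinear_def bounded_linear.linear)
qed

lemma resolvent_iff:
  assumes "\<zeta> \<in> resolvent_set B"
  shows "(y, \<zeta> *\<^sub>C y - x) \<in> B \<longleftrightarrow> y = resolvent B \<zeta> x"
proof -
  have ex: "\<exists>!y. (y, \<zeta> *\<^sub>C y - x) \<in> B"
    using assms by (auto simp: resolvent_set_def)
  show ?thesis
    using theI'[OF ex] ex unfolding resolvent_def by blast
qed

lemma bounded_clinear_resolvent: "\<zeta> \<in> resolvent_set B \<Longrightarrow> bounded_clinear (resolvent B \<zeta>)"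
  by (simp add: resolvent_set_def)

text \<open>For a nearby parameter the resolvent equation is the fixed point equation
  \<open>y = R (x - c *\<^sub>C y)\<close> with \<open>c = \<xi> - \<zeta>\<close>. The radius
  \<open>1 / (2 * K)\<close> makes it a contraction with constant one half, which also bounds the
  new resolvent by \<open>2 * K\<close>.\<close>

lemma open_resolvent_set: "open (resolvent_set B)"
proof (rule openI)
  fix \<zeta> assume \<zeta>: "\<zeta> \<in> resolvent_set B"
  define R where "R = resolvent B \<zeta>"
  have bR: "bounded_clinear R"
    unfolding R_def using \<zeta> by (rule bounded_clinear_resolvent)
  note R = bounded_clinearD[OF bR]
  obtain K where K: "K > 0" "\<And>x. norm (R x) \<le> norm x * K"
    using bounded_linear.pos_bounded[OF R(1)] by blast
  have "\<xi> \<in> resolvent_set B" if \<xi>: "\<xi> \<in> ball \<zeta> (1 / (2 * K))" for \<xi>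
  proof -
    define c where "c = \<xi> - \<zeta>"
    have c: "cmod c * K \<le> 1 / 2"
      using \<xi> K(1) by (simp add: c_def dist_norm norm_minus_commute field_simps)
    have contr: "norm (R (c *\<^sub>C v)) \<le> (1 / 2) * norm v" for v
    proof -
      have "norm (R (c *\<^sub>C v)) \<le> (cmod c * K) * norm v"
        using K(2)[of "c *\<^sub>C v"] by (simp add: mult_ac)
      also have "\<dots> \<le> (1 / 2) * norm v"
        using c by (intro mult_right_mono) auto
      finally show ?thesis .
    qed
    have iff: "(y, \<xi> *\<^sub>C y - x) \<in> B \<longleftrightarrow> y = R (x - c *\<^sub>C y)" for x y
      using resolvent_iff[OF \<zeta>, of y "x - c *\<^sub>C y"] by (simp add: R_def c_def scaleC_diff_left)
    have ex: "\<exists>!y. (y, \<xi> *\<^sub>C y - x) \<in> B" for x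
    proof -
      have "\<exists>!y. R (x - c *\<^sub>C y) = y"
      proof (rule banach_fix_type[of "1/2"])
        have "R (x - c *\<^sub>C y) - R (x - c *\<^sub>C y') = - R (c *\<^sub>C (y - y'))" for y y'
          by (simp add: R scaleC_diff_right)
        then show "\<forall>y y'. dist (R (x - c *\<^sub>C y)) (R (x - c *\<^sub>C y')) \<le> 1 / 2 * dist y y'"
          unfolding dist_norm using contr by simp
      qed auto
      then show ?thesis
        unfolding iff by metis
    qed
    define Q where "Q = resolvent B \<xi>"
    have Q: "Q x = R (x - c *\<^sub>C Q x)" for x
      using theI'[OF ex] unfolding Q_def resolvent_def iff .
    have Qu: "y = Q x" if "y = R (x - c *\<^sub>C y)" for x y
      using ex[of x] Q[of x] that unfolding iff by blast
    have "bounded_clinear Q"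
    proof (rule bounded_clinearI)
      show "Q (x + y) = Q x + Q y" for x y
      proof (rule Qu[symmetric])
        have "R (x + y - c *\<^sub>C (Q x + Q y)) = R (x - c *\<^sub>C Q x) + R (y - c *\<^sub>C Q y)"
          by (simp add: R scaleC_add_right)
        then show "Q x + Q y = R (x + y - c *\<^sub>C (Q x + Q y))"
          using Q[of x] Q[of y] by simp
      qed
      show "Q (a *\<^sub>C x) = a *\<^sub>C Q x" for a x
      proof (rule Qu[symmetric])
        have "R (a *\<^sub>C x - c *\<^sub>C a *\<^sub>C Q x) = R (a *\<^sub>C (x - c *\<^sub>C Q x))"
          by (simp add: scaleC_diff_right scaleC_scaleC mult.commute)
        then show "a *\<^sub>C Q x = R (a *\<^sub>C x - c *\<^sub>C a *\<^sub>C Q x)"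
          using Q[of x] R(4)[of a "x - c *\<^sub>C Q x"] by simp
      qed
      show "norm (Q x) \<le> norm x * (2 * K)" for x
      proof -
        have "norm (Q x) = norm (R x - R (c *\<^sub>C Q x))"
          using Q[of x] by (simp add: R)
        also have "\<dots> \<le> norm (R x) + norm (R (c *\<^sub>C Q x))"
          by (rule norm_triangle_ineq4)
        also have "\<dots> \<le> norm x * K + (1 / 2) * norm (Q x)"
          by (intro add_mono K contr)
        finally show ?thesis by simp
      qed
    qed
    then show ?thesis
      using ex by (simp add: resolvent_set_def Q_def)
  qed
  then show "\<exists>e>0. ball \<zeta> e \<subseteq> resolvent_set B"
    using K(1) by (intro exI[of _ "1 / (2 * K)"]) auto
qed

text \<open>The operator \<open>- \<zeta> - (- B)\<close> is the negative of
  \<open>\<zeta> - B\<close>, so its inverse is the old resolvent after a change of sign. This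
  places \<open>- r\<close> outside the spectrum of \<open>- A\<close>.\<close>

lemma uminus_resolvent_set:
  assumes "\<zeta> \<in> resolvent_set B"
  shows "- \<zeta> \<in> resolvent_set (uminus_op B)"
proof -
  have mem: "(y, v) \<in> uminus_op B \<longleftrightarrow> (y, - v) \<in> B" for y v
    by (force simp: uminus_op_def)
  have iff: "(y, (- \<zeta>) *\<^sub>C y - x) \<in> uminus_op B \<longleftrightarrow> y = resolvent B \<zeta> (- x)" for x y
    unfolding mem resolvent_iff[OF assms, symmetric] by (simp add: scaleC_minus_left add.commute)
  have "resolvent (uminus_op B) (- \<zeta>) = (\<lambda>x. resolvent B \<zeta> (- x))"
    unfolding resolvent_def[of "uminus_op B"] iff by simp
  moreover have "bounded_clinear (\<lambda>x. resolvent B \<zeta> (- x))"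
    by (rule bounded_clinear_compose[OF bounded_clinear_resolvent[OF assms]])
       (auto intro!: bounded_clinearI[where K = 1])
  ultimately show ?thesis
    using iff by (simp add: resolvent_set_def)
qed

lemma spectrum_closed: "closed (spectrum B)"
  using open_resolvent_set[of B] by (simp add: spectrum_def closed_def)

section \<open>The isometry between the extrapolation space and X\<close>

locale extrapolation = c0_semigroup T for T :: "real \<Rightarrow> 'a::chilbert_space \<Rightarrow> 'a" +
  fixes r :: complex and J :: "'a \<Rightarrow> 'b::chilbert_space"
  assumes r: "r \<in> resolvent_set (generator T)" and J: "extrapolation_space (generator T) r J"
begin

abbreviation R :: "'a \<Rightarrow> 'a" where "R \<equiv> resolvent (generator T) r"
abbreviation S :: "real \<Rightarrow> 'b \<Rightarrow> 'b" where "S \<equiv> extrapolation_semigroup J T"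

lemmas R_linear = bounded_clinearD[OF bounded_clinear_resolvent[OF r]]

lemma R_generator: "(R x, r *\<^sub>C R x - x) \<in> generator T"
  using resolvent_iff[OF r] by blast

lemma R_T: "t \<ge> 0 \<Longrightarrow> R (T t x) = T t (R x)"
  using generator_T[OF R_generator[of x], of t] resolvent_iff[OF r, of "T t (R x)" "T t x"]
  by (simp add: T_linear)

lemma R_eq_0: "R x = 0 \<Longrightarrow> x = 0"
  using R_generator[of x] generator_unique[OF _ generator_zero] by fastforce

lemma J_linear: "J (x + y) = J x + J y" "J (x - y) = J x - J y" "J (c *\<^sub>C x) = c *\<^sub>C J x"
  using J by (auto simp: extrapolation_space_def clinear_def linear_add linear_diff)

lemma norm_J: "norm (J x) = norm (R x)"
  using J by (auto simp: extrapolation_space_def)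

text \<open>Density of \<open>range J\<close> as a proof rule: identities between continuous maps
  need only be checked on vectors \<open>J x\<close>.\<close>

lemma dense_J:
  assumes "closed {y. P y}" "\<And>x. P (J x)"
  shows "P y"
proof -
  have "closure (range J) \<subseteq> {y. P y}"
    using assms by (intro closure_minimal) auto
  then show ?thesis
    using J by (auto simp: extrapolation_space_def)
qed

lemma inj_J: "inj J"
proof (rule injI)
  fix x x' assume "J x = J x'"
  then have "norm (R (x - x')) = 0"
    using norm_J[of "x - x'"] by (simp add: J_linear)
  then show "x = x'" using R_eq_0[of "x - x'"] by simp
qed

text \<open>By the choice of norm on X_{-1}, the map \<open>J x \<mapsto> R x\<close> is isometric,
  hence uniformly continuous, and extends to the closure of \<open>range J\<close>. The norm
  identity and linearity persist because they are closed conditions.\<close>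

lemma unitary_exists:
  "\<exists>W. bounded_clinear W \<and> (\<forall>x. W (J x) = R x) \<and> (\<forall>y. norm (W y) = norm y) \<and> surj W"
proof -
  have uc: "uniformly_continuous_on (range J) (\<lambda>y. R (inv J y))"
    unfolding uniformly_continuous_on_def
  proof (intro allI impI)
    fix e :: real assume "0 < e"
    moreover have "dist (R (inv J (J x))) (R (inv J (J x'))) = dist (J x) (J x')" for x x'
      using norm_J[of "x - x'"] inj_J by (simp add: dist_norm J_linear R_linear)
    ultimately show "\<exists>d>0. \<forall>y\<in>range J. \<forall>y'\<in>range J. dist y' y < d \<longrightarrow> dist (R (inv J y')) (R (inv J y)) < e"
      by (intro exI[of _ e]) auto
  qed
  have "\<exists>W. uniformly_continuous_on (closure (range J)) W \<and> (\<forall>y\<in>range J. R (inv J y) = W y)"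
  proof (rule uniformly_continuous_on_extension_on_closure[OF uc])
    fix g assume "uniformly_continuous_on (closure (range J)) g" "\<And>x. x \<in> range J \<Longrightarrow> R (inv J x) = g x"
    then show ?thesis by blast
  qed
  then obtain W where W: "uniformly_continuous_on (closure (range J)) W"
      "\<And>y. y \<in> range J \<Longrightarrow> R (inv J y) = W y"
    by blast
  have WJ: "W (J x) = R x" for x
    using W(2)[of "J x"] inj_J by simp
  have cont: "continuous_on UNIV W"
    using W(1) J by (auto simp: extrapolation_space_def dest: uniformly_continuous_imp_continuous)
  note cont' = continuous_on_compose2[OF cont]
  have norm_W: "norm (W y) = norm y" for y
  proof (rule dense_J[of "\<lambda>y. norm (W y) = norm y"])
    show "closed {y. norm (W y) = norm y}"
      by (intro closed_Collect_eq continuous_intros cont)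
  qed (simp add: WJ norm_J)
  have add1: "W (J x + y) = W (J x) + W y" for x y
  proof (rule dense_J[of "\<lambda>y. W (J x + y) = W (J x) + W y"])
    show "closed {y. W (J x + y) = W (J x) + W y}"
      by (intro closed_Collect_eq continuous_intros cont cont') auto
    show "W (J x + J x') = W (J x) + W (J x')" for x'
      unfolding J_linear(1)[symmetric] WJ by (simp add: R_linear)
  qed
  have add: "W (y + y') = W y + W y'" for y y'
  proof (rule dense_J[of "\<lambda>y. W (y + y') = W y + W y'"])
    show "closed {y. W (y + y') = W y + W y'}"
      by (intro closed_Collect_eq continuous_intros cont cont') auto
  qed (rule add1)
  have scale: "W (c *\<^sub>C y) = c *\<^sub>C W y" for c y
  proof (rule dense_J[of "\<lambda>y. W (c *\<^sub>C y) = c *\<^sub>C W y"])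
    have *: "continuous_on A (\<lambda>y. c *\<^sub>C f y)" if "continuous_on A f" for A and f :: "'b \<Rightarrow> 'c::chilbert_space"
      using bounded_linear.continuous_on[OF bounded_linear_scaleC that] .
    show "closed {y. W (c *\<^sub>C y) = c *\<^sub>C W y}"
      by (intro closed_Collect_eq * cont cont'[where f = "\<lambda>y. c *\<^sub>C y"] continuous_on_id) auto
    show "W (c *\<^sub>C J x) = c *\<^sub>C W (J x)" for x
      unfolding J_linear(3)[symmetric] WJ by (simp add: R_linear)
  qed
  have bW: "bounded_clinear W"
    by (rule bounded_clinearI[where K = 1]) (auto simp: add scale norm_W)
  \<comment> \<open>The range of \<open>W\<close> contains the dense domain of the generator. As
    \<open>W\<close> is isometric, preimages of a convergent sequence are Cauchy, so limits are
    attained.\<close>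
  have "surj W"
  proof -
    have "v \<in> range W" for v
    proof -
      have "v \<in> closure (Domain (generator T))"
        using dense_generator_domain by simp
      then obtain d where d: "\<And>n. d n \<in> Domain (generator T)" "d \<longlonglongrightarrow> v"
        unfolding closure_sequential by blast
      have "\<exists>y. d n = W y" for n
      proof -
        obtain v' where "(d n, v') \<in> generator T" using d(1) by blast
        then have "d n = R (r *\<^sub>C d n - v')"
          using resolvent_iff[OF r, of "d n" "r *\<^sub>C d n - v'"] by simp
        then show ?thesis using WJ by metis
      qed
      then obtain y where y: "\<And>n. d n = W (y n)" by metis
      have "norm (y m - y n) = norm (d m - d n)" for m n
        using norm_W[of "y m - y n"] by (simp add: y bounded_clinearD[OF bW])
      then have "Cauchy y"
        using LIMSEQ_imp_Cauchy[OF d(2)] by (simp add: Cauchy_iff)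
      then obtain l where l: "y \<longlonglongrightarrow> l"
        using Cauchy_convergent convergent_def by blast
      have "d \<longlonglongrightarrow> W l"
        unfolding y using bounded_linear.tendsto[OF bounded_clinearD(1)[OF bW] l] .
      then show ?thesis
        using d(2) LIMSEQ_unique by blast
    qed
    then show ?thesis by blast
  qed
  then show ?thesis
    using bW WJ norm_W by blast
qed

text \<open>This is the inverse of \<open>r - A_{-1}\<close>, viewed as a map onto X. Its values on
  the dense \<open>range J\<close> determine it, so the choice operator has only one
  candidate.\<close>

definition W :: "'b \<Rightarrow> 'a" where
  "W = (SOME W. bounded_clinear W \<and> (\<forall>x. W (J x) = R x) \<and> (\<forall>y. norm (W y) = norm y) \<and> surj W)"

lemma bounded_clinear_W: "bounded_clinear W" and W_J: "W (J x) = R x"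
  and norm_W: "norm (W y) = norm y" and surj_W: "surj W"
  using someI_ex[OF unitary_exists] unfolding W_def by auto

lemmas W_linear = bounded_clinearD[OF bounded_clinear_W]

lemma W_eq_iff: "W y = W y' \<longleftrightarrow> y = y'"
  using norm_W[of "y - y'"] by (auto simp: W_linear)

text \<open>Conjugating \<open>T t\<close> by \<open>W\<close> gives a bounded operator that
  satisfies the equation \<open>Q (J x) = J (T t x)\<close>, because the resolvent commutes with
  \<open>T t\<close>. Density makes it the only such operator, so the definite description selects
  it.\<close>

lemma W_S:
  assumes t: "t \<ge> 0"
  shows "W (S t y) = T t (W y)" and "bounded_clinear (S t)"
proof -
  define Q where "Q y = inv W (T t (W y))" for y
  have WQ: "W (Q y) = T t (W y)" for y
    by (simp add: Q_def surj_f_inv_f surj_W)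
  obtain K where K: "\<And>x. norm (T t x) \<le> norm x * K"
    using bounded_linear.bounded[OF T_linear(1)[OF t]] by blast
  have bQ: "bounded_clinear Q"
  proof (rule bounded_clinearI)
    show "Q (x + y) = Q x + Q y" for x y
      using t by (subst W_eq_iff[symmetric]) (simp add: WQ W_linear T_linear)
    show "Q (c *\<^sub>C x) = c *\<^sub>C Q x" for c x
      using t by (subst W_eq_iff[symmetric]) (simp add: WQ W_linear T_linear)
    show "norm (Q y) \<le> norm y * K" for y
      using K[of "W y"] norm_W[of "Q y"] by (simp add: WQ norm_W)
  qed
  have QJ: "Q (J x) = J (T t x)" for x
    using t by (subst W_eq_iff[symmetric]) (simp add: WQ W_J R_T)
  have "S t = Q"
    unfolding extrapolation_semigroup_def
  proof (rule the_equality)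
    fix Q' assume Q': "bounded_clinear Q' \<and> (\<forall>x. Q' (J x) = J (T t x))"
    show "Q' = Q"
    proof
      fix y
      show "Q' y = Q y"
      proof (rule dense_J[of "\<lambda>y. Q' y = Q y"])
        show "closed {y. Q' y = Q y}"
          using Q' bQ by (intro closed_Collect_eq linear_continuous_on bounded_clinearD(1)) auto
      qed (use Q' QJ in auto)
    qed
  qed (use bQ QJ in auto)
  then show "W (S t y) = T t (W y)" "bounded_clinear (S t)"
    using WQ bQ by auto
qed

lemma tendsto_W_iff: "((\<lambda>h. W (f h)) \<longlongrightarrow> W y) F \<longleftrightarrow> (f \<longlongrightarrow> y) F"
proof -
  have "dist (W u) (W v) = dist u v" for u v
    using norm_W[of "u - v"] by (simp add: dist_norm W_linear)
  then show ?thesis by (simp add: tendsto_iff)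
qed

lemma C0_semigroup_S: "C0_semigroup S"
  unfolding C0_semigroup_def
proof (intro conjI allI impI)
  show "S 0 = id"
    by (rule ext) (simp add: W_eq_iff[symmetric] W_S)
  show "S (s + t) = S s \<circ> S t" if "s \<ge> 0" "t \<ge> 0" for s t
    using that by (intro ext) (simp add: W_eq_iff[symmetric] W_S T_add)
  fix y
  have "((\<lambda>t. T t (W y)) \<longlongrightarrow> W y) (at_right 0)"
    using c0 by (simp add: C0_semigroup_def)
  moreover have "\<forall>\<^sub>F t in at_right 0. T t (W y) = W (S t y)"
    unfolding eventually_at_right_field by (intro exI[of _ 1]) (auto simp: W_S)
  ultimately have "((\<lambda>t. W (S t y)) \<longlongrightarrow> W y) (at_right 0)"
    by (rule Lim_transform_eventually)
  then show "((\<lambda>t. S t y) \<longlongrightarrow> y) (at_right 0)"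
    by (simp only: tendsto_W_iff)
qed (rule W_S)

lemma generator_S_iff: "(y, v) \<in> generator S \<longleftrightarrow> (W y, W v) \<in> generator T"
proof -
  have ev: "\<forall>\<^sub>F h in at_right 0. (1 / h) *\<^sub>R (T h (W y) - W y) = W ((1 / h) *\<^sub>R (S h y - y))"
    unfolding eventually_at_right_field by (intro exI[of _ 1]) (auto simp: W_S W_linear)
  have "(W y, W v) \<in> generator T \<longleftrightarrow> ((\<lambda>h. W ((1 / h) *\<^sub>R (S h y - y))) \<longlongrightarrow> W v) (at_right 0)"
    unfolding generator_def using tendsto_cong[OF ev] by simp
  then show ?thesis
    unfolding tendsto_W_iff by (simp add: generator_def)
qed

text \<open>Conjugation by \<open>W\<close> turns the claim into the fact that the domain of the
  generator of \<open>T\<close> is the range of \<open>R\<close>, which is the image of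
  \<open>range J\<close> under \<open>W\<close>.\<close>

lemma Domain_generator_S: "Domain (generator S) = range J"
proof (intro equalityI subsetI)
  fix y assume "y \<in> Domain (generator S)"
  then obtain v where "(W y, W v) \<in> generator T" by (auto simp: generator_S_iff)
  then have "W y = R (r *\<^sub>C W y - W v)"
    using resolvent_iff[OF r, of "W y" "r *\<^sub>C W y - W v"] by simp
  then show "y \<in> range J"
    by (metis W_J W_eq_iff rangeI)
next
  fix y assume "y \<in> range J"
  then obtain x where x: "y = J x" by blast
  obtain v where "W v = r *\<^sub>C R x - x" using surj_W by (metis surjD)
  then have "(J x, v) \<in> generator S"
    using R_generator[of x] by (simp add: generator_S_iff W_J)
  then show "y \<in> Domain (generator S)" using x by blast
qed

text \<open>\<open>W\<close> sends \<open>r *\<^sub>C J x - v\<close> to \<open>x\<close>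
  isometrically. This expresses the norm of X through data in X_{-1}, where the spectral measure can
  compute it.\<close>

lemma norm_eq_generator_S:
  assumes "(J x, v) \<in> generator S"
  shows "norm x = norm (r *\<^sub>C J x - v)"
proof -
  have "(R x, W v) \<in> generator T"
    using assms by (simp add: generator_S_iff W_J)
  then have "W v = r *\<^sub>C R x - x"
    using generator_unique R_generator by blast
  then have "x = W (r *\<^sub>C J x - v)"
    by (simp add: W_linear W_J)
  then show ?thesis using norm_W by metis
qed

end

section \<open>Convolution integrals as spectral integrals\<close>

text \<open>A convergence theorem for Banach-valued gauge integrals. Errors bounded pointwise by a
  small multiple of one integrable \<open>g\<close> make both the integrals and all sufficiently
  fine Riemann sums close.\<close>

lemma has_integral_of_approximation:
  fixes F :: "real \<Rightarrow> 'v::banach"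
  assumes f: "\<And>k::nat. (f k has_integral I k) {a..b}"
    and g: "g integrable_on {a..b}" "\<And>s. s \<in> {a..b} \<Longrightarrow> 0 \<le> g s"
    and approx: "\<And>e. e > 0 \<Longrightarrow> \<forall>\<^sub>F k in sequentially. \<forall>s\<in>{a..b}. norm (F s - f k s) \<le> e * g s"
  shows "\<exists>y. (F has_integral y) {a..b} \<and> I \<longlonglongrightarrow> y"
proof -
  define G where "G = integral {a..b} g"
  have G: "(g has_integral G) {a..b}" "0 \<le> G"
    using g by (auto simp: G_def intro: integral_nonneg)
  have "Cauchy I"
  proof (rule metric_CauchyI)
    fix e :: real assume e: "0 < e"
    \<comment> \<open>Two approximants contribute \<open>2 * e' * G\<close>; adding 1 keeps the
      quotient meaningful when \<open>G = 0\<close>.\<close>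
    define e' where "e' = e / (2 * (G + 1))"
    have e': "e' > 0" using e G(2) by (simp add: e'_def)
    obtain N where N: "\<And>k s. k \<ge> N \<Longrightarrow> s \<in> {a..b} \<Longrightarrow> norm (F s - f k s) \<le> e' * g s"
      using approx[OF e'] unfolding eventually_sequentially by blast
    show "\<exists>M. \<forall>m\<ge>M. \<forall>n\<ge>M. dist (I m) (I n) < e"
    proof (intro exI[of _ N] allI impI)
      fix m n assume mn: "N \<le> m" "N \<le> n"
      have "I m - I n = integral {a..b} (\<lambda>s. f m s - f n s)"
        by (rule integral_unique[OF has_integral_diff[OF f f], symmetric])
      also have "norm \<dots> \<le> integral {a..b} (\<lambda>s. (2 * e') * g s)"
      proof (rule integral_norm_bound_integral)
        show "(\<lambda>s. f m s - f n s) integrable_on {a..b}"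
          using has_integral_diff[OF f f] by blast
        show "(\<lambda>s. 2 * e' * g s) integrable_on {a..b}"
          using integrable_linear[OF g(1) bounded_linear_mult_right[of "2 * e'"]] by (simp add: o_def)
        show "norm (f m s - f n s) \<le> 2 * e' * g s" if s: "s \<in> {a..b}" for s
          using norm_triangle_ineq4[of "F s - f n s" "F s - f m s"] N[OF mn(1) s] N[OF mn(2) s] by simp
      qed
      also have "\<dots> = 2 * e' * G"
        by (simp add: G_def)
      also have "\<dots> = e * (G / (G + 1))"
        using G(2) by (simp add: e'_def divide_simps)
      also have "\<dots> < e * 1"
        using e G(2) by (intro mult_strict_left_mono) auto
      finally show "dist (I m) (I n) < e" by (simp add: dist_norm)
    qed
  qed
  then obtain y where y: "I \<longlonglongrightarrow> y"
    using Cauchy_convergent convergent_def by blast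
  have "(F has_integral y) {a..b}"
    unfolding has_integral_real
  proof (intro allI impI)
    fix e :: real assume e: "0 < e"
    define e' where "e' = e / (3 * (G + 1))"
    have e': "e' > 0" using e G(2) by (simp add: e'_def)
    have "\<forall>\<^sub>F k in sequentially. dist (I k) y < e / 3"
      using e by (intro tendstoD[OF y]) auto
    then have "\<forall>\<^sub>F k in sequentially. dist (I k) y < e / 3 \<and> (\<forall>s\<in>{a..b}. norm (F s - f k s) \<le> e' * g s)"
      using approx[OF e'] by (rule eventually_conj)
    then obtain k where k: "dist (I k) y < e / 3" "\<And>s. s \<in> {a..b} \<Longrightarrow> norm (F s - f k s) \<le> e' * g s"
      using eventually_happens'[OF sequentially_bot] by blast
    obtain \<gamma> where \<gamma>: "gauge \<gamma>" "\<And>D. D tagged_division_of {a..b} \<Longrightarrow> \<gamma> fine D \<Longrightarrow>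
        norm ((\<Sum>(x, K)\<in>D. measure lborel K *\<^sub>R f k x) - I k) < e / 3"
      using f[of k] e unfolding has_integral_real by (metis divide_pos_pos zero_less_numeral)
    \<comment> \<open>This second gauge keeps the Riemann sums of \<open>g\<close> below
      \<open>G + 1\<close>, which is why \<open>e'\<close> was divided by
      \<open>3 * (G + 1)\<close>.\<close>
    obtain \<gamma>' where \<gamma>': "gauge \<gamma>'" "\<And>D. D tagged_division_of {a..b} \<Longrightarrow> \<gamma>' fine D \<Longrightarrow>
        norm ((\<Sum>(x, K)\<in>D. measure lborel K *\<^sub>R g x) - G) < 1"
      using G(1) unfolding has_integral_real by (metis zero_less_one)
    show "\<exists>\<gamma>. gauge \<gamma> \<and> (\<forall>D. D tagged_division_of {a..b} \<and> \<gamma> fine D \<longrightarrow>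
        norm ((\<Sum>(x, K)\<in>D. measure lborel K *\<^sub>R F x) - y) < e)"
    proof (intro exI[of _ "\<lambda>x. \<gamma> x \<inter> \<gamma>' x"] conjI allI impI gauge_Int \<gamma>(1) \<gamma>'(1))
      fix D assume "D tagged_division_of {a..b} \<and> (\<lambda>x. \<gamma> x \<inter> \<gamma>' x) fine D"
      then have D: "D tagged_division_of {a..b}" "\<gamma> fine D" "\<gamma>' fine D"
        by (auto simp: fine_Int)
      have "(\<Sum>(x, K)\<in>D. measure lborel K *\<^sub>R F x) - (\<Sum>(x, K)\<in>D. measure lborel K *\<^sub>R f k x)
          = (\<Sum>(x, K)\<in>D. measure lborel K *\<^sub>R (F x - f k x))"
        by (simp add: sum_subtractf[symmetric] scaleR_diff_right case_prod_unfold)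
      also have "norm \<dots> \<le> (\<Sum>(x, K)\<in>D. e' * (measure lborel K *\<^sub>R g x))"
      proof (rule sum_norm_le, clarify)
        fix x K assume "(x, K) \<in> D"
        then have "x \<in> {a..b}"
          using D(1) by (meson tag_in_interval)
        then show "norm (measure lborel K *\<^sub>R (F x - f k x)) \<le> e' * (measure lborel K *\<^sub>R g x)"
          using mult_left_mono[OF k(2), of x "measure lborel K"] by (simp add: mult_ac)
      qed
      also have "\<dots> = e' * (\<Sum>(x, K)\<in>D. measure lborel K *\<^sub>R g x)"
        by (simp add: sum_distrib_left case_prod_unfold)
      also have "\<dots> \<le> e' * (G + 1)"
        using \<gamma>'(2)[OF D(1,3)] e' by (intro mult_left_mono) auto
      also have "\<dots> = e / 3"
        using G(2) by (simp add: e'_def divide_simps)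
      finally have "norm ((\<Sum>(x, K)\<in>D. measure lborel K *\<^sub>R F x) - (\<Sum>(x, K)\<in>D. measure lborel K *\<^sub>R f k x)) \<le> e / 3" .
      moreover have "norm (a - d) < e" if "norm (a - b) \<le> e / 3" "norm (b - c) < e / 3" "norm (c - d) < e / 3"
        for a b c d :: 'v
        using norm_triangle_ineq[of "a - b" "b - d"] norm_triangle_ineq[of "b - c" "c - d"] that by simp
      ultimately show "norm ((\<Sum>(x, K)\<in>D. measure lborel K *\<^sub>R F x) - y) < e"
        using \<gamma>(2)[OF D(1,2)] k(1) unfolding dist_norm by blast
    qed
  qed
  then show ?thesis using y by blast
qed

text \<open>Replacing the continuous factor \<open>h\<close> by its values at the left end points of a subdivision
  turns the integral of \<open>u * h\<close> into the following sum.\<close>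

definition step_sum ::
  "('c::euclidean_space \<Rightarrow> 'v \<Rightarrow> 'w::real_normed_vector) \<Rightarrow> real \<Rightarrow> (real \<Rightarrow> 'c) \<Rightarrow> (real \<Rightarrow> 'v) \<Rightarrow> nat \<Rightarrow> 'w"
  where "step_sum B t u h k =
    (\<Sum>i<Suc k. B (integral {real i * (t / Suc k)..real (Suc i) * (t / Suc k)} u) (h (real i * (t / Suc k))))"

lemma step_point_mem:
  assumes "0 \<le> t" "i \<le> Suc k"
  shows "real i * (t / Suc k) \<in> {0..t}"
  using assms mult_right_mono[of "real i" "real (Suc k)" t] by (auto simp: field_simps)

lemma step_floor_mem:
  assumes "0 \<le> t" "s \<in> {0..t}"
  shows "t / Suc k * of_int \<lfloor>s / (t / Suc k)\<rfloor> \<in> {0..t}"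
    and "\<bar>s - t / Suc k * of_int \<lfloor>s / (t / Suc k)\<rfloor>\<bar> \<le> t / Suc k"
proof -
  have "t / Suc k * of_int \<lfloor>s / (t / Suc k)\<rfloor> \<le> s \<and> s \<le> t / Suc k * of_int \<lfloor>s / (t / Suc k)\<rfloor> + t / Suc k \<and>
      0 \<le> t / Suc k * of_int \<lfloor>s / (t / Suc k)\<rfloor>"
  \<comment> \<open>For \<open>t = 0\<close> the mesh is 0, the grid point is 0, and the interval
    contains only \<open>s = 0\<close>.\<close>
  proof (cases "t = 0")
    case False
    define \<delta> where "\<delta> = t / Suc k"
    have \<delta>: "\<delta> > 0" using False assms by (simp add: \<delta>_def)
    have "of_int \<lfloor>s / \<delta>\<rfloor> \<le> s / \<delta>" "s / \<delta> \<le> of_int \<lfloor>s / \<delta>\<rfloor> + 1"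
        "0 \<le> real_of_int \<lfloor>s / \<delta>\<rfloor>"
      using \<delta> assms by (auto simp: zero_le_floor)
    from this[THEN mult_left_mono[where c = \<delta>]]
    have "\<delta> * of_int \<lfloor>s / \<delta>\<rfloor> \<le> \<delta> * (s / \<delta>)" "\<delta> * (s / \<delta>) \<le> \<delta> * (of_int \<lfloor>s / \<delta>\<rfloor> + 1)"
        "0 \<le> \<delta> * of_int \<lfloor>s / \<delta>\<rfloor>"
      using \<delta> by simp_all
    then show ?thesis
      unfolding \<delta>_def[symmetric] using \<delta> by (simp add: algebra_simps)
  qed (use assms in simp)
  then show "t / Suc k * of_int \<lfloor>s / (t / Suc k)\<rfloor> \<in> {0..t}"
    and "\<bar>s - t / Suc k * of_int \<lfloor>s / (t / Suc k)\<rfloor>\<bar> \<le> t / Suc k"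
    using assms by auto
qed

text \<open>On the interior of each cell the rounded-down time is the left end point, so the
  integrand is a fixed linear image of \<open>u\<close> there. The cells are joined by induction,
  end points being negligible.\<close>

lemma step_sum_has_integral:
  fixes B :: "'c::euclidean_space \<Rightarrow> 'v::real_normed_vector \<Rightarrow> 'w::banach"
  assumes B: "bounded_bilinear B" and t: "0 \<le> t" and u: "u integrable_on {0..t}"
  shows "((\<lambda>s. B (u s) (h (t / Suc k * of_int \<lfloor>s / (t / Suc k)\<rfloor>))) has_integral step_sum B t u h k) {0..t}"
proof -
  define \<delta> where "\<delta> = t / Suc k"
  have \<delta>: "\<delta> \<ge> 0" using t by (simp add: \<delta>_def)
  define F where "F s = B (u s) (h (\<delta> * of_int \<lfloor>s / \<delta>\<rfloor>))" for s
  have "(F has_integral (\<Sum>i<j. B (integral {real i * \<delta>..real (Suc i) * \<delta>} u) (h (real i * \<delta>)))) {0..real j * \<delta>}"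
    if "j \<le> Suc k" for j
    using that
  proof (induction j)
    case 0
    then show ?case by (simp add: has_integral_refl)
  next
    case (Suc j)
    have "{real j * \<delta>..real (Suc j) * \<delta>} \<subseteq> {0..t}"
      using step_point_mem[OF t, of j k] step_point_mem[OF t, of "Suc j" k] Suc.prems
      unfolding \<delta>_def[symmetric] by auto
    then have "u integrable_on {real j * \<delta>..real (Suc j) * \<delta>}"
      using integrable_on_subinterval[OF u] by blast
    then have "((\<lambda>s. B (u s) (h (real j * \<delta>))) has_integral
        B (integral {real j * \<delta>..real (Suc j) * \<delta>} u) (h (real j * \<delta>))) (cbox (real j * \<delta>) (real (Suc j) * \<delta>))"
      using has_integral_linear[OF integrable_integral bounded_bilinear.bounded_linear_left[OF B]]
      by (simp add: o_def)
    then have "(F has_integral B (integral {real j * \<delta>..real (Suc j) * \<delta>} u) (h (real j * \<delta>)))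
        (cbox (real j * \<delta>) (real (Suc j) * \<delta>))"
    proof (rule has_integral_spike_interior)
      fix s assume s: "s \<in> box (real j * \<delta>) (real (Suc j) * \<delta>)"
      \<comment> \<open>A zero mesh would make the open cell empty.\<close>
      then have "\<delta> > 0" using \<delta> by (cases "\<delta> = 0") auto
      then have "\<lfloor>s / \<delta>\<rfloor> = int j"
        using s by (intro floor_unique) (auto simp: field_simps)
      then show "F s = B (u s) (h (real j * \<delta>))"
        by (simp add: F_def mult.commute)
    qed
    then show ?case
      using has_integral_combine[OF _ _ Suc.IH, of "real (Suc j) * \<delta>"] Suc.prems \<delta>
      by (simp add: mult_right_mono)
  qed
  from this[of "Suc k"] show ?thesis
    unfolding step_sum_def F_def \<delta>_def by simp
qed

text \<open>Uniform continuity of \<open>h\<close> on the compact interval bounds the error of the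
  step approximation by a small multiple of \<open>norm (u s)\<close>, which is integrable.\<close>

lemma step_sum_tendsto:
  fixes B :: "'c::euclidean_space \<Rightarrow> 'v::real_normed_vector \<Rightarrow> 'w::banach"
  assumes B: "bounded_bilinear B" and t: "0 \<le> t" and u: "u integrable_on {0..t}"
    and nu: "(\<lambda>s. norm (u s)) integrable_on {0..t}" and h: "continuous_on {0..t} h"
  shows "\<exists>y. ((\<lambda>s. B (u s) (h s)) has_integral y) {0..t} \<and> step_sum B t u h \<longlonglongrightarrow> y"
proof (rule has_integral_of_approximation[OF step_sum_has_integral[OF B t u] nu])
  fix e :: real assume e: "0 < e"
  obtain K where K: "K > 0" "\<And>a b. norm (B a b) \<le> norm a * norm b * K"
    using bounded_bilinear.pos_bounded[OF B] by blast
  have "uniformly_continuous_on {0..t} h"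
    using h by (intro compact_uniformly_continuous) auto
  then obtain d where d: "d > 0" "\<And>s s'. s \<in> {0..t} \<Longrightarrow> s' \<in> {0..t} \<Longrightarrow> dist s' s < d \<Longrightarrow> dist (h s') (h s) < e / K"
    unfolding uniformly_continuous_on_def using e K(1) by (metis divide_pos_pos)
  have "(\<lambda>k. t / real (Suc k)) \<longlonglongrightarrow> 0"
    using tendsto_mult[OF tendsto_const[of t] LIMSEQ_inverse_real_of_nat] by (simp add: divide_inverse)
  then have "\<forall>\<^sub>F k in sequentially. t / real (Suc k) < d"
    using d(1) by (rule order_tendstoD)
  then show "\<forall>\<^sub>F k in sequentially. \<forall>s\<in>{0..t}.
      norm (B (u s) (h s) - B (u s) (h (t / Suc k * of_int \<lfloor>s / (t / Suc k)\<rfloor>))) \<le> e * norm (u s)"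
  proof (eventually_elim, intro ballI)
    fix k s assume k: "t / real (Suc k) < d" and s: "s \<in> {0..t}"
    define s' where "s' = t / Suc k * of_int \<lfloor>s / (t / Suc k)\<rfloor>"
    have "dist s s' < d" "s' \<in> {0..t}"
      using step_floor_mem[OF t s, of k] k by (auto simp: s'_def dist_real_def)
    then have "norm (h s - h s') \<le> e / K"
      using d(2)[of s' s] s by (auto simp: dist_norm)
    have "norm (B (u s) (h s) - B (u s) (h s')) = norm (B (u s) (h s - h s'))"
      by (simp add: bounded_bilinear.diff_right[OF B])
    also have "\<dots> \<le> norm (u s) * norm (h s - h s') * K"
      by (rule K(2))
    also have "\<dots> \<le> norm (u s) * (e / K) * K"
      using K(1) \<open>norm (h s - h s') \<le> e / K\<close> by (intro mult_right_mono mult_left_mono) auto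
    finally show "norm (B (u s) (h s) - B (u s) (h s')) \<le> e * norm (u s)"
      using K(1) by (simp add: mult.commute)
  qed
qed simp

text \<open>The bound does not depend on \<open>k\<close>; it supplies the dominating constant when
  the step sums pass to the limit in L^2(nu).\<close>

lemma norm_step_sum_le:
  fixes u h :: "real \<Rightarrow> complex"
  assumes t: "0 \<le> t" and u: "u integrable_on {0..t}"
    and nu: "(\<lambda>s. norm (u s)) integrable_on {0..t}" and h: "\<And>s. s \<in> {0..t} \<Longrightarrow> norm (h s) \<le> M"
  shows "norm (step_sum (*) t u h k) \<le> integral {0..t} (\<lambda>s. norm (u s)) * M"
proof -
  note st = step_sum_has_integral[OF bounded_bilinear_mult t u, of h k]
  have "norm (step_sum (*) t u h k) \<le> integral {0..t} (\<lambda>s. norm (u s) * M)"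
    unfolding integral_unique[OF st, symmetric]
  proof (rule integral_norm_bound_integral)
    show "(\<lambda>s. norm (u s) * M) integrable_on {0..t}"
      using integrable_linear[OF nu bounded_linear_mult_left[of M]] by (simp add: o_def)
    show "norm (u s * h (t / Suc k * of_int \<lfloor>s / (t / Suc k)\<rfloor>)) \<le> norm (u s) * M" if "s \<in> {0..t}" for s
      unfolding norm_mult by (intro mult_left_mono h step_floor_mem t that) auto
  qed (use st in blast)
  then show ?thesis by simp
qed

lemma bounded_bilinear_scaleC: "bounded_bilinear ((*\<^sub>C) :: complex \<Rightarrow> 'a::chilbert_space \<Rightarrow> 'a)"
proof
  show "\<exists>K. \<forall>a (b::'a). norm (a *\<^sub>C b) \<le> norm a * norm b * K"
    by (intro exI[of _ 1]) simp
  show "(r *\<^sub>R a) *\<^sub>C (b::'a) = r *\<^sub>R a *\<^sub>C b" for r a b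
    by (simp add: scaleR_conv_of_real scaleC_scaleC[symmetric] scaleC_of_real)
qed (auto simp: scaleC_add_left scaleC_add_right scaleC_scaleR)

section \<open>The semigroup and its convolutions as multiplication operators\<close>

locale spectral_semigroup = pvm E + c0_semigroup S
  for E :: "complex set \<Rightarrow> 'a::chilbert_space \<Rightarrow> 'a" and S +
  assumes gen: "uminus_op (generator S) = spectral_integral E (\<lambda>z. z)"
begin

abbreviation disc :: "nat \<Rightarrow> complex set" where "disc n \<equiv> cball 0 (real n)"

lemma generator_iff: "(x, y) \<in> generator S \<longleftrightarrow> (x, - y) \<in> SI (\<lambda>z. z)"
  unfolding gen[symmetric] uminus_op_def by force

lemma disc_borel [measurable, simp]: "disc n \<in> sets borel"
  by (simp add: borel_closed)

text \<open>Each measure \<open>\<nu> x\<close> is finite, so a bounded function is square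
  integrable; cutting off to a disc provides the boundedness.\<close>

lemma SI_disc_exists:
  assumes f: "f \<in> borel_measurable borel" and bd: "\<And>z. z \<in> disc n \<Longrightarrow> cmod (f z) \<le> K"
  shows "\<exists>y. (x, y) \<in> SI (\<lambda>z. indicator (disc n) z * f z)"
proof -
  have "L2sq x (\<lambda>z. indicator (disc n) z * f z) \<le> (\<integral>\<^sup>+ z. ennreal (K\<^sup>2) \<partial>\<nu> x)"
  proof (rule nn_integral_mono)
    fix z
    show "ennreal ((cmod (indicator (disc n) z * f z))\<^sup>2) \<le> ennreal (K\<^sup>2)"
    proof (cases "z \<in> disc n")
      case True
      then show ?thesis using bd by (auto intro!: ennreal_leI power_mono)
    qed simp
  qed
  also have "\<dots> < \<infinity>"
    by (simp add: emeasure_nu ennreal_mult_less_top)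
  finally show ?thesis
    using SI_exists[of "\<lambda>z. indicator (disc n) z * f z" x] f by auto
qed

lemma SI_norm_le:
  assumes "f \<in> borel_measurable borel" "(x, y) \<in> SI f" "\<And>z. cmod (f z) \<le> K" "0 \<le> K"
  shows "norm y \<le> K * norm x"
proof -
  have "ennreal ((norm y)\<^sup>2) = L2sq x f"
    using assms by (intro SI_norm)
  also have "\<dots> \<le> (\<integral>\<^sup>+ z. ennreal (K\<^sup>2) \<partial>\<nu> x)"
    using assms by (intro nn_integral_mono ennreal_leI power_mono) auto
  also have "\<dots> = ennreal ((K * norm x)\<^sup>2)"
    by (simp add: emeasure_nu E_UNIV ennreal_mult power_mult_distrib)
  finally have "(norm y)\<^sup>2 \<le> (K * norm x)\<^sup>2" by simp
  then show ?thesis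
    using assms(4) by (simp add: power2_le_iff_abs_le)
qed

lemma cmod_exp_le: "z \<in> disc n \<Longrightarrow> 0 \<le> s \<Longrightarrow> s \<le> t \<Longrightarrow> cmod (exp (- z * of_real s)) \<le> exp (real n * t)"
proof -
  assume a: "z \<in> disc n" "0 \<le> s" "s \<le> t"
  have "cmod (exp (- z * of_real s)) \<le> exp (cmod (- z * of_real s))"
    by (rule norm_exp)
  also have "\<dots> \<le> exp (real n * t)"
    using a by (auto simp: norm_mult intro!: mult_mono)
  finally show ?thesis .
qed

text \<open>The candidate orbit \<open>g s\<close>, the integral of the truncated exponential at
  \<open>b\<close>, solves the Cauchy problem of the generator and starts at
  \<open>E (disc n) b\<close>. Norm differentiability needs a Taylor bound uniform in
  \<open>z\<close>, which holds on a disc.\<close>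

lemma SI_S_disc:
  assumes t: "t \<ge> 0"
  shows "(b, S t (E (disc n) b)) \<in> SI (\<lambda>z. indicator (disc n) z * exp (- z * of_real t))"
proof -
  define f where "f s z = indicator (disc n) z * exp (- z * of_real s)" for s :: real and z :: complex
  define f' where "f' s z = indicator (disc n) z * (- z * exp (- z * of_real s))" for s :: real and z :: complex
  have [measurable]: "f s \<in> borel_measurable borel" "f' s \<in> borel_measurable borel" for s
    unfolding f_def f'_def by measurable
  have "\<exists>y. (b, y) \<in> SI (f s)" for s
    unfolding f_def
  proof (rule SI_disc_exists)
    fix z :: complex assume z: "z \<in> disc n"
    have "cmod (exp (- z * of_real s)) \<le> exp (cmod (- z * of_real s))"
      by (rule norm_exp)
    also have "\<dots> \<le> exp (real n * \<bar>s\<bar>)"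
      using z by (auto simp: norm_mult intro!: mult_right_mono)
    finally show "cmod (exp (- z * of_real s)) \<le> exp (real n * \<bar>s\<bar>)" .
  qed measurable
  then obtain g where g: "\<And>s. (b, g s) \<in> SI (f s)" by metis
  have "\<exists>y. (b, y) \<in> SI (f' s)" for s
    unfolding f'_def
  proof (rule SI_disc_exists)
    fix z :: complex assume z: "z \<in> disc n"
    have "cmod (exp (- z * of_real s)) \<le> exp (cmod (- z * of_real s))"
      by (rule norm_exp)
    also have "\<dots> \<le> exp (real n * \<bar>s\<bar>)"
      using z by (auto simp: norm_mult intro!: mult_right_mono)
    finally show "cmod (- z * exp (- z * of_real s)) \<le> real n * exp (real n * \<bar>s\<bar>)"
      unfolding norm_mult using z by (intro mult_mono) auto
  qed measurable
  then obtain g' where g': "\<And>s. (b, g' s) \<in> SI (f' s)" by metis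
  have "S t (g 0) = g t"
  proof (rule cauchy_problem_unique[OF t, of g g'])
    fix s assume s: "s \<in> {0..t}"
    \<comment> \<open>The sign is reversed because \<open>E\<close> represents the negative of the
      generator: multiplication of \<open>f s\<close> by \<open>z\<close> gives
      \<open>- f' s\<close>.\<close>
    have "(b, - g' s) \<in> SI (\<lambda>z. - 1 * f' s z)"
      using SI_scaleC[OF _ g', of s "-1"] by (simp add: scaleC_minus_left)
    also have "(\<lambda>z. - 1 * f' s z) = (\<lambda>z. z * f s z)"
      by (rule ext) (simp add: f_def f'_def)
    finally have "(b, - g' s) \<in> SI (\<lambda>z. z * f s z)" .
    then have "(g s, - g' s) \<in> SI (\<lambda>z. z)"
      by (subst SI_compose[OF _ g]) measurable
    then show "(g s, g' s) \<in> generator S"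
      by (simp add: generator_iff)
    \<comment> \<open>The first factor bounds the exponential at time \<open>s\<close>; the others
      bound the quadratic Taylor remainder \<open>exp (cmod w) * (cmod w)\<^sup>2\<close> up to the
      squared time increment.\<close>
    define C where "C = exp (real n * t) * (exp (real n * t) * (real n)\<^sup>2)"
    have C: "C \<ge> 0" by (simp add: C_def)
    have le: "norm (g y - g s - (y - s) *\<^sub>R g' s) \<le> (C * (y - s)\<^sup>2) * norm b" if y: "y \<in> {0..t}" for y
    proof (rule SI_norm_le)
      have "(b, g y - g s - of_real (y - s) *\<^sub>C g' s) \<in> SI (\<lambda>z. f y z - f s z - of_real (y - s) * f' s z)"
        by (intro SI_diff SI_scaleC g g') measurable
      then show "(b, g y - g s - (y - s) *\<^sub>R g' s) \<in> SI (\<lambda>z. f y z - f s z - of_real (y - s) * f' s z)"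
        by (simp only: scaleC_of_real)
      show "cmod (f y z - f s z - of_real (y - s) * f' s z) \<le> C * (y - s)\<^sup>2" for z
      proof (cases "z \<in> disc n")
        case True
        define w where "w = - z * of_real (y - s)"
        have ys: "\<bar>y - s\<bar> \<le> t" using y s by auto
        have wn: "cmod w \<le> real n * \<bar>y - s\<bar>"
          using True by (simp add: w_def norm_mult mult_right_mono del: of_real_diff)
        have wt: "cmod w \<le> real n * t"
          using wn mult_left_mono[OF ys, of "real n"] by simp
        have "- z * of_real y = - z * of_real s + w"
          by (simp add: w_def algebra_simps)
        then have "exp (- z * of_real y) = exp (- z * of_real s) * exp w"
          by (simp only: exp_add)
        then have "f y z - f s z - of_real (y - s) * f' s z = exp (- z * of_real s) * (exp w - (\<Sum>i\<le>1. w ^ i / fact i))"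
          using True by (simp add: f_def f'_def w_def algebra_simps)
        also have "cmod \<dots> \<le> exp (real n * t) * (exp (cmod w) * cmod w ^ Suc 1 / fact 1)"
          unfolding norm_mult using cmod_exp_le[OF True, of s t] s
          by (intro mult_mono Taylor_exp_field) auto
        also have "\<dots> \<le> exp (real n * t) * (exp (real n * t) * (real n * \<bar>y - s\<bar>)\<^sup>2)"
          using wn wt by (auto simp: numeral_2_eq_2[symmetric] intro!: mult_mono power_mono)
        finally show ?thesis by (simp add: C_def power_mult_distrib mult_ac)
      qed (use C in \<open>simp add: f_def f'_def\<close>)
    qed (use C in auto)
    show "(g has_vector_derivative g' s) (at s within {0..t})"
      unfolding has_vector_derivative_def has_derivative_within_alt
    proof (intro conjI allI impI)
      fix e :: real assume e: "0 < e"
      \<comment> \<open>The summand 1 covers the case in which \<open>C * norm b\<close>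
        vanishes.\<close>
      define d where "d = e / (C * norm b + 1)"
      have pos: "C * norm b + 1 > 0" using C by (simp add: add_nonneg_pos)
      have d: "d > 0" using e pos by (simp add: d_def)
      show "\<exists>d>0. \<forall>y\<in>{0..t}. norm (y - s) < d \<longrightarrow> norm (g y - g s - (y - s) *\<^sub>R g' s) \<le> e * norm (y - s)"
      proof (intro exI[of _ d] conjI d ballI impI)
        fix y assume y: "y \<in> {0..t}" "norm (y - s) < d"
        have "norm (g y - g s - (y - s) *\<^sub>R g' s) \<le> C * (y - s)\<^sup>2 * norm b"
          by (rule le[OF y(1)])
        also have "\<dots> = (C * norm b * \<bar>y - s\<bar>) * \<bar>y - s\<bar>"
          by (simp add: power2_eq_square mult.assoc)
        also have "\<dots> \<le> e * \<bar>y - s\<bar>"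
        proof (rule mult_right_mono)
          have "C * norm b * \<bar>y - s\<bar> \<le> (C * norm b + 1) * d"
            using y(2) C pos by (intro mult_mono) auto
          then show "C * norm b * \<bar>y - s\<bar> \<le> e" using pos by (simp add: d_def)
        qed simp
        finally show "norm (g y - g s - (y - s) *\<^sub>R g' s) \<le> e * norm (y - s)" by simp
      qed
    qed (rule bounded_linear_scaleR_left)
  qed
  moreover have "g 0 = E (disc n) b"
  proof (rule SI_unique[OF _ g])
    show "(b, E (disc n) b) \<in> SI (f 0)"
      using SI_indicator[OF disc_borel, of b n] by (simp add: f_def[abs_def])
  qed measurable
  ultimately show ?thesis
    using g[of t] by (simp add: f_def[abs_def])
qed

lemma E_disc_tendsto: "(\<lambda>n. E (disc n) y) \<longlonglongrightarrow> y"
proof (rule SI_tendsto[OF _ SI_indicator _ _ SI_one])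
  have "(\<lambda>n. L2sq y (\<lambda>z. indicator (disc n) z - 1)) \<longlonglongrightarrow> (\<integral>\<^sup>+ z. 0 \<partial>\<nu> y)"
  proof (rule nn_integral_dominated_convergence[where w = "\<lambda>_. 1"])
    show "AE z in \<nu> y. (\<lambda>n. ennreal ((cmod (indicator (disc n) z - 1))\<^sup>2)) \<longlonglongrightarrow> 0"
    proof (rule AE_I2)
      fix z :: complex
      obtain N :: nat where N: "cmod z \<le> real N" using real_arch_simple by blast
      have "\<forall>\<^sub>F n in sequentially. 0 = ennreal ((cmod (indicator (disc n) z - 1))\<^sup>2)"
        using eventually_ge_at_top[of N] by eventually_elim (use N in auto)
      then show "(\<lambda>n. ennreal ((cmod (indicator (disc n) z - 1))\<^sup>2)) \<longlonglongrightarrow> 0"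
        by (rule Lim_transform_eventually[OF tendsto_const])
    qed
    show "AE z in \<nu> y. ennreal ((cmod (indicator (disc n) z - 1))\<^sup>2) \<le> 1" for n
      by (auto simp: indicator_def)
    show "(\<integral>\<^sup>+ z. 1 \<partial>\<nu> y) < \<infinity>"
      by (simp add: emeasure_nu)
  qed auto
  then show "(\<lambda>n. L2sq y (\<lambda>z. indicator (disc n) z - 1)) \<longlonglongrightarrow> 0" by simp
qed auto

text \<open>Here the missing commutation of \<open>E\<close> with the semigroup is circumvented.
  \<open>S t b\<close> is the limit of \<open>S t (E (disc n) b)\<close>, and after cutting to the
  smaller disc \<open>m\<close> these vectors all have the same integrand as soon as
  \<open>n \<ge> m\<close>, so the sequence is eventually constant.\<close>

lemma SI_E_disc_S:
  assumes t: "t \<ge> 0"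
  shows "(b, E (disc m) (S t b)) \<in> SI (\<lambda>z. indicator (disc m) z * exp (- z * of_real t))"
proof -
  let ?f = "\<lambda>z. indicator (disc m) z * exp (- z * of_real t) :: complex"
  have mem: "(b, E (disc m) (S t (E (disc n) b))) \<in> SI ?f" if mn: "m \<le> n" for n
  proof -
    have "(b, E (disc m) (S t (E (disc n) b)))
        \<in> SI (\<lambda>z. indicator (disc m) z * (indicator (disc n) z * exp (- z * of_real t)))"
      by (rule SI_E[OF _ SI_S_disc[OF t] disc_borel]) measurable
    also have "(\<lambda>z. indicator (disc m) z * (indicator (disc n) z * exp (- z * of_real t))) = ?f"
      using mn by (auto simp: indicator_def)
    finally show ?thesis .
  qed
  define y where "y = E (disc m) (S t (E (disc m) b))"
  have y: "(b, y) \<in> SI ?f"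
    unfolding y_def by (rule mem) simp
  have "(\<lambda>n. E (disc m) (S t (E (disc n) b))) \<longlonglongrightarrow> E (disc m) (S t b)"
    by (intro bounded_linear.tendsto[OF bounded_clinearD(1)[OF bounded_clinear_E[OF disc_borel]]]
        bounded_linear.tendsto[OF T_linear(1)[OF t]] E_disc_tendsto)
  moreover have "(\<lambda>n. E (disc m) (S t (E (disc n) b))) \<longlonglongrightarrow> y"
  proof (rule Lim_transform_eventually[OF tendsto_const])
    show "\<forall>\<^sub>F n in sequentially. y = E (disc m) (S t (E (disc n) b))"
      using eventually_ge_at_top[of m]
      by eventually_elim (rule SI_unique[OF _ y mem], measurable)
  qed
  ultimately show ?thesis
    using y LIMSEQ_unique by blast
qed

text \<open>The scalar integral defining \<open>f z\<close> and the vector integral are limits of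
  step sums with the same coefficients. Inside a disc the sums correspond under the isometry, hence
  so do the limits. Letting the discs grow shows that \<open>f\<close> is square integrable and
  represents the full vector integral.\<close>

lemma SI_convolution:
  assumes t: "0 \<le> t" and u: "u integrable_on {0..t}" and nu: "(\<lambda>s. norm (u s)) integrable_on {0..t}"
    and f: "\<And>z. ((\<lambda>s. u s * exp (- z * of_real (t - s))) has_integral f z) {0..t}"
  shows "f \<in> borel_measurable borel"
    and "\<exists>y. ((\<lambda>s. S (t - s) (u s *\<^sub>C b)) has_integral y) {0..t} \<and> (b, y) \<in> SI f"
proof -
  define e where "e z s = exp (- z * complex_of_real (t - s))" for z s
  have cont_e: "continuous_on {0..t} (e z)" for z
    unfolding e_def by (intro continuous_intros)
  have lim_f: "step_sum (*) t u (e z) \<longlonglongrightarrow> f z" for z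
    using step_sum_tendsto[OF bounded_bilinear_mult t u nu cont_e[of z]] f[of z] has_integral_unique
    unfolding e_def by blast
  \<comment> \<open>A step sum is a finite combination of exponentials in \<open>z\<close>, so
    \<open>f\<close> is measurable as a pointwise limit.\<close>
  have meas_step [measurable]: "(\<lambda>z. step_sum (*) t u (e z) k) \<in> borel_measurable borel" for k
    unfolding step_sum_def e_def by measurable
  show f_meas [measurable]: "f \<in> borel_measurable borel"
    by (rule borel_measurable_LIMSEQ_metric[OF meas_step lim_f])
  define U where "U = integral {0..t} (\<lambda>s. norm (u s))"
  have U: "U \<ge> 0" unfolding U_def by (intro integral_nonneg nu) auto
  have step_le: "cmod (step_sum (*) t u (e z) k) \<le> U * exp (real n * t)" if "z \<in> disc n" for z n k
    unfolding U_def e_def by (intro norm_step_sum_le t u nu cmod_exp_le[OF that]) auto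
  have f_le: "cmod (f z) \<le> U * exp (real n * t)" if "z \<in> disc n" for z n
    using LIMSEQ_le_const2[OF tendsto_norm[OF lim_f]] step_le[OF that] by blast
  have "continuous_on {0..t} (\<lambda>s. S (t - s) b)"
    by (rule continuous_on_compose2[OF T_continuous_on[of t b]]) (auto intro!: continuous_intros)
  then obtain y where y: "((\<lambda>s. u s *\<^sub>C S (t - s) b) has_integral y) {0..t}"
      "step_sum (*\<^sub>C) t u (\<lambda>s. S (t - s) b) \<longlonglongrightarrow> y"
    using step_sum_tendsto[OF bounded_bilinear_scaleC t u nu] by blast
  have y': "((\<lambda>s. S (t - s) (u s *\<^sub>C b)) has_integral y) {0..t}"
    using y(1) by (rule has_integral_eq[rotated]) (auto simp: T_linear)
  \<comment> \<open>\<open>U * exp (real n * t)\<close> bounds the step sums and \<open>f\<close> on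
    the disc uniformly in \<open>k\<close>; twice this value dominates their difference, and
    \<open>\<nu> b\<close> is finite.\<close>
  have En: "(b, E (disc n) y) \<in> SI (\<lambda>z. indicator (disc n) z * f z)" for n
  proof -
    interpret En: bounded_linear "E (disc n)"
      using bounded_clinear_E[OF disc_borel] by (rule bounded_clinearD)
    have mem: "(b, E (disc n) (step_sum (*\<^sub>C) t u (\<lambda>s. S (t - s) b) k))
        \<in> SI (\<lambda>z. indicator (disc n) z * step_sum (*) t u (e z) k)" for k
    proof -
      have "(b, \<Sum>i<Suc k. integral {real i * (t / Suc k)..real (Suc i) * (t / Suc k)} u *\<^sub>C
            E (disc n) (S (t - real i * (t / Suc k)) b))
          \<in> SI (\<lambda>z. \<Sum>i<Suc k. integral {real i * (t / Suc k)..real (Suc i) * (t / Suc k)} u *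
            (indicator (disc n) z * exp (- z * of_real (t - real i * (t / Suc k)))))"
        using step_point_mem[OF t, of _ k]
        by (intro SI_sum SI_scaleC SI_E_disc_S) auto
      also have "(\<Sum>i<Suc k. integral {real i * (t / Suc k)..real (Suc i) * (t / Suc k)} u *\<^sub>C
            E (disc n) (S (t - real i * (t / Suc k)) b)) = E (disc n) (step_sum (*\<^sub>C) t u (\<lambda>s. S (t - s) b) k)"
        unfolding step_sum_def En.sum by (simp only: bounded_clinearD(4)[OF bounded_clinear_E[OF disc_borel]])
      also have "(\<lambda>z. \<Sum>i<Suc k. integral {real i * (t / Suc k)..real (Suc i) * (t / Suc k)} u *
            (indicator (disc n) z * exp (- z * of_real (t - real i * (t / Suc k)))))
          = (\<lambda>z. indicator (disc n) z * step_sum (*) t u (e z) k)"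
        unfolding step_sum_def e_def by (simp only: sum_distrib_left mult_ac)
      finally show ?thesis .
    qed
    obtain w where w: "(b, w) \<in> SI (\<lambda>z. indicator (disc n) z * f z)"
      using SI_disc_exists[OF f_meas f_le] by blast
    have "(\<lambda>k. E (disc n) (step_sum (*\<^sub>C) t u (\<lambda>s. S (t - s) b) k)) \<longlonglongrightarrow> w"
    proof (rule SI_tendsto[OF _ mem _ _ w])
      have "(\<lambda>k. L2sq b (\<lambda>z. indicator (disc n) z * step_sum (*) t u (e z) k - indicator (disc n) z * f z))
          \<longlonglongrightarrow> (\<integral>\<^sup>+ z. 0 \<partial>\<nu> b)"
      proof (rule nn_integral_dominated_convergence[where w = "\<lambda>_. ennreal ((2 * (U * exp (real n * t)))\<^sup>2)"])
        show "AE z in \<nu> b. (\<lambda>k. ennreal ((cmod (indicator (disc n) z * step_sum (*) t u (e z) k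
            - indicator (disc n) z * f z))\<^sup>2)) \<longlonglongrightarrow> 0"
        proof (rule AE_I2)
          fix z
          have "(\<lambda>k. (cmod (indicator (disc n) z * step_sum (*) t u (e z) k - indicator (disc n) z * f z))\<^sup>2)
              \<longlonglongrightarrow> (cmod (indicator (disc n) z * f z - indicator (disc n) z * f z))\<^sup>2"
            by (intro tendsto_intros lim_f)
          from tendsto_ennrealI[OF this]
          show "(\<lambda>k. ennreal ((cmod (indicator (disc n) z * step_sum (*) t u (e z) k
            - indicator (disc n) z * f z))\<^sup>2)) \<longlonglongrightarrow> 0" by simp
        qed
        show "AE z in \<nu> b. ennreal ((cmod (indicator (disc n) z * step_sum (*) t u (e z) k
            - indicator (disc n) z * f z))\<^sup>2) \<le> ennreal ((2 * (U * exp (real n * t)))\<^sup>2)" for k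
        proof (intro AE_I2 ennreal_leI power_mono)
          fix z
          show "cmod (indicator (disc n) z * step_sum (*) t u (e z) k - indicator (disc n) z * f z)
              \<le> 2 * (U * exp (real n * t))"
          proof (cases "z \<in> disc n")
            case True
            then show ?thesis
              using norm_triangle_ineq4[of "step_sum (*) t u (e z) k" "f z"] f_le[OF True] step_le[OF True, of k]
              by simp
          qed (use U in simp)
        qed simp
        show "(\<integral>\<^sup>+ z. ennreal ((2 * (U * exp (real n * t)))\<^sup>2) \<partial>\<nu> b) < \<infinity>"
          by (simp add: emeasure_nu ennreal_mult_less_top)
      qed measurable
      then show "(\<lambda>k. L2sq b (\<lambda>z. indicator (disc n) z * step_sum (*) t u (e z) k - indicator (disc n) z * f z))
          \<longlonglongrightarrow> 0" by simp
    qed measurable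
    moreover have "(\<lambda>k. E (disc n) (step_sum (*\<^sub>C) t u (\<lambda>s. S (t - s) b) k)) \<longlonglongrightarrow> E (disc n) y"
      by (rule En.tendsto[OF y(2)])
    ultimately show ?thesis
      using w LIMSEQ_unique by blast
  qed
  have En_le: "norm (E (disc n) y) \<le> norm y" for n
    using SI_norm_le[OF _ SI_indicator[OF disc_borel], of n 1 y] by (auto simp: indicator_def)
  \<comment> \<open>Increasing discs recover the whole integral, and every truncated norm is that of
    \<open>E (disc n) y\<close>, at most \<open>norm y\<close>. This is how square integrability of
    \<open>f\<close> is obtained.\<close>
  have "L2sq b f = (\<integral>\<^sup>+ z. (SUP n. ennreal ((cmod (indicator (disc n) z * f z))\<^sup>2)) \<partial>\<nu> b)"
  proof (rule nn_integral_cong)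
    fix z
    obtain N :: nat where N: "cmod z \<le> real N" using real_arch_simple by blast
    show "ennreal ((cmod (f z))\<^sup>2) = (SUP n. ennreal ((cmod (indicator (disc n) z * f z))\<^sup>2))"
    proof (rule antisym)
      show "ennreal ((cmod (f z))\<^sup>2) \<le> (SUP n. ennreal ((cmod (indicator (disc n) z * f z))\<^sup>2))"
        using N by (intro SUP_upper2[of N]) auto
      show "(SUP n. ennreal ((cmod (indicator (disc n) z * f z))\<^sup>2)) \<le> ennreal ((cmod (f z))\<^sup>2)"
        by (intro SUP_least) (auto simp: indicator_def)
    qed
  qed
  also have "\<dots> = (SUP n. L2sq b (\<lambda>z. indicator (disc n) z * f z))"
    by (rule nn_integral_monotone_convergence_SUP)
       (auto simp: incseq_def le_fun_def indicator_def)
  also have "\<dots> = (SUP n. ennreal ((norm (E (disc n) y))\<^sup>2))"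
    using SI_norm[OF _ En] by simp
  also have "\<dots> \<le> ennreal ((norm y)\<^sup>2)"
    by (intro SUP_least ennreal_leI power_mono En_le) auto
  finally have fin: "L2sq b f < \<infinity>"
    by (simp add: le_less_trans)
  then obtain w where w: "(b, w) \<in> SI f"
    using SI_exists[OF f_meas] by blast
  \<comment> \<open>The integral \<open>w\<close> of \<open>f\<close> and the convolution
    \<open>y\<close> agree after every cut-off, and the cut-offs converge strongly to the
    identity.\<close>
  have "E (disc n) w = E (disc n) y" for n
    by (rule SI_unique[OF _ SI_E[OF f_meas w disc_borel] En]) measurable
  then have "w = y"
    using LIMSEQ_unique[OF E_disc_tendsto[of w]] E_disc_tendsto[of y] by simp
  then show "\<exists>y. ((\<lambda>s. S (t - s) (u s *\<^sub>C b)) has_integral y) {0..t} \<and> (b, y) \<in> SI f"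
    using y' w by blast
qed

end

section \<open>Lebesgue spaces on the half-line\<close>

lemma enn2real_ge_1: "1 \<le> p \<Longrightarrow> p \<noteq> \<infinity> \<Longrightarrow> 1 \<le> enn2real p"
  using enn2real_mono[of 1 p] by (simp add: less_top)

text \<open>The two measure spaces may differ, which allows comparison across restriction and across
  reflection.\<close>

lemma esssup_cong_AE:
  fixes f :: "'a \<Rightarrow> ennreal" and g :: "'b \<Rightarrow> ennreal"
  assumes "f \<in> borel_measurable M" "g \<in> borel_measurable N"
    and "\<And>c. (AE x in M. f x \<le> c) \<longleftrightarrow> (AE x in N. g x \<le> c)"
  shows "esssup M f = esssup N g"
  using assms by (simp add: esssup_eq_AE)

text \<open>Extension by zero moves the question to the whole line, where reflection is a
  measure-preserving bijection.\<close>

lemma in_Lp_lebesgue_on: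
  fixes u :: "real \<Rightarrow> complex"
  assumes p: "1 \<le> p" and S: "S \<in> sets lebesgue"
  shows "in_Lp p (lebesgue_on S) u \<longleftrightarrow> in_Lp p lebesgue (\<lambda>x. if x \<in> S then u x else 0)"
proof -
  have "(\<exists>C. AE x in lebesgue_on S. cmod (u x) \<le> C)
      \<longleftrightarrow> (\<exists>C. AE x in lebesgue. cmod (if x \<in> S then u x else 0) \<le> C)"
  proof
    assume "\<exists>C. AE x in lebesgue_on S. cmod (u x) \<le> C"
    then obtain C where C: "AE x in lebesgue. x \<in> S \<longrightarrow> cmod (u x) \<le> C"
      using S by (auto simp: AE_restrict_space_iff)
    \<comment> \<open>If \<open>S\<close> is a null set, \<open>C\<close> may be negative, whereas
      the extension takes the value 0; hence the maximum.\<close>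
    show "\<exists>C. AE x in lebesgue. cmod (if x \<in> S then u x else 0) \<le> C"
      by (rule exI[of _ "max C 0"]) (use C in eventually_elim, auto)
  next
    assume "\<exists>C. AE x in lebesgue. cmod (if x \<in> S then u x else 0) \<le> C"
    then obtain C where C: "AE x in lebesgue. cmod (if x \<in> S then u x else 0) \<le> C" by blast
    then have "AE x in lebesgue. x \<in> S \<longrightarrow> cmod (u x) \<le> C"
      by eventually_elim auto
    then show "\<exists>C. AE x in lebesgue_on S. cmod (u x) \<le> C"
      using S by (auto simp: AE_restrict_space_iff)
  qed
  moreover have "integrable (lebesgue_on S) (\<lambda>x. cmod (u x) powr q)
      \<longleftrightarrow> integrable lebesgue (\<lambda>x. cmod (if x \<in> S then u x else 0) powr q)" for q
    using S by (subst integrable_restrict_space) (auto simp: indicator_def intro!: Bochner_Integration.integrable_cong)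
  ultimately show ?thesis
    by (simp add: in_Lp_def borel_measurable_if[OF S])
qed

lemma Lp_norm_lebesgue_on:
  fixes u :: "real \<Rightarrow> complex"
  assumes p: "1 \<le> p" and S: "S \<in> sets lebesgue" and u: "in_Lp p (lebesgue_on S) u"
  shows "Lp_norm p (lebesgue_on S) u = Lp_norm p lebesgue (\<lambda>x. if x \<in> S then u x else 0)"
proof -
  have [measurable]: "u \<in> borel_measurable (lebesgue_on S)"
      "(\<lambda>x. if x \<in> S then u x else 0) \<in> borel_measurable lebesgue"
    using u by (auto simp: in_Lp_def borel_measurable_if[OF S])
  have "esssup (lebesgue_on S) (\<lambda>x. ennreal (cmod (u x)))
      = esssup lebesgue (\<lambda>x. ennreal (cmod (if x \<in> S then u x else 0)))"
  proof (rule esssup_cong_AE)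
    show "(AE x in lebesgue_on S. ennreal (cmod (u x)) \<le> c)
        \<longleftrightarrow> (AE x in lebesgue. ennreal (cmod (if x \<in> S then u x else 0)) \<le> c)" for c
      using S by (subst AE_restrict_space_iff) (auto intro!: AE_cong)
  qed measurable
  moreover have "(LINT x|lebesgue_on S. cmod (u x) powr q)
      = (LINT x|lebesgue. cmod (if x \<in> S then u x else 0) powr q)" for q
    using S by (subst integral_restrict_space) (auto simp: indicator_def intro!: Bochner_Integration.integral_cong)
  ultimately show ?thesis
    by (simp add: Lp_norm_def)
qed

lemma in_Lp_dominated:
  assumes p: "1 \<le> p" and u: "in_Lp p M u" and w: "w \<in> borel_measurable M"
    and le: "\<And>x. cmod (w x) \<le> cmod (u x)"
  shows "in_Lp p M w" and "Lp_norm p M w \<le> Lp_norm p M u"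
proof -
  have [measurable]: "u \<in> borel_measurable M" "w \<in> borel_measurable M"
    using u w by (auto simp: in_Lp_def)
  have "in_Lp p M w \<and> Lp_norm p M w \<le> Lp_norm p M u"
  proof (cases "p = \<infinity>")
    case True
    obtain C where C: "AE x in M. cmod (u x) \<le> C"
      using u True by (auto simp: in_Lp_def)
    have "AE x in M. cmod (w x) \<le> C"
      using C by eventually_elim (use le order_trans in blast)
    \<comment> \<open>Finiteness matters because \<open>enn2real\<close> sends the top element to 0
      and is monotone only below finite values.\<close>
    moreover have "esssup M (\<lambda>x. ennreal (cmod (u x))) \<le> ennreal C"
      by (rule esssup_I) (use C in \<open>auto elim: eventually_mono intro: ennreal_leI\<close>)
    then have "esssup M (\<lambda>x. ennreal (cmod (u x))) < \<top>"
      by (simp add: le_less_trans)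
    then have "enn2real (esssup M (\<lambda>x. ennreal (cmod (w x)))) \<le> enn2real (esssup M (\<lambda>x. ennreal (cmod (u x))))"
      by (intro enn2real_mono esssup_mono) (auto intro: ennreal_leI le)
    ultimately show ?thesis
      using True by (auto simp: in_Lp_def Lp_norm_def)
  next
    case False
    define q where "q = enn2real p"
    have q: "1 \<le> q" unfolding q_def using p False by (rule enn2real_ge_1)
    have int: "integrable M (\<lambda>x. cmod (u x) powr q)"
      using u False by (auto simp: in_Lp_def q_def)
    have "integrable M (\<lambda>x. cmod (w x) powr q)"
      by (rule Bochner_Integration.integrable_bound[OF int]) (use le q in \<open>auto intro!: AE_I2 powr_mono2\<close>)
    moreover have "(LINT x|M. cmod (w x) powr q) powr (1 / q) \<le> (LINT x|M. cmod (u x) powr q) powr (1 / q)"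
      using q le calculation int by (intro powr_mono2 integral_mono integral_nonneg) auto
    ultimately show ?thesis
      using False by (simp add: in_Lp_def Lp_norm_def q_def)
  qed
  then show "in_Lp p M w" "Lp_norm p M w \<le> Lp_norm p M u" by auto
qed

section \<open>Reflection and time reversal\<close>

lemma reflect_measurable: "(\<lambda>x. \<tau> - x) \<in> lebesgue \<rightarrow>\<^sub>M (lebesgue :: real measure)"
  using lebesgue_affine_measurable[where c = "\<lambda>_::real. - 1" and t = \<tau>] by simp

lemma lebesgue_reflect: "distr lebesgue lebesgue (\<lambda>x. \<tau> - x) = (lebesgue :: real measure)"
  using lebesgue_real_affine[of "-1" \<tau>] by (simp add: density_1)

lemma AE_reflect: "(AE x in lebesgue. P (\<tau> - x)) \<longleftrightarrow> (AE x in lebesgue. P (x::real))"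
proof -
  have imp: "AE x in lebesgue. Q (\<tau> - x)" if "AE x in lebesgue. Q x" for Q
    using AE_distrD[OF reflect_measurable[of \<tau>], of Q] that unfolding lebesgue_reflect .
  show ?thesis
  proof
    assume "AE x in lebesgue. P (\<tau> - x)"
    from imp[OF this] show "AE x in lebesgue. P x" by simp
  qed (rule imp)
qed

lemma measurable_reflect:
  "(\<lambda>x. w (\<tau> - x)) \<in> borel_measurable lebesgue \<longleftrightarrow> (w :: real \<Rightarrow> complex) \<in> borel_measurable lebesgue"
proof
  show "(\<lambda>x. w (\<tau> - x)) \<in> borel_measurable lebesgue" if "w \<in> borel_measurable lebesgue"
    by (rule measurable_compose[OF reflect_measurable that])
  assume "(\<lambda>x. w (\<tau> - x)) \<in> borel_measurable lebesgue"
  from measurable_compose[OF reflect_measurable[of \<tau>] this]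
  show "w \<in> borel_measurable lebesgue" by (simp only: diff_diff_eq2 add_diff_cancel_left')
qed

lemma integral_lebesgue_reflect:
  fixes w :: "real \<Rightarrow> 'b::{banach, second_countable_topology}"
  assumes "w \<in> borel_measurable lebesgue"
  shows "(LINT x|lebesgue. w (\<tau> - x)) = (LINT x|lebesgue. w x)"
  using integral_distr[OF reflect_measurable[of \<tau>] assms] by (simp add: lebesgue_reflect)

lemma in_Lp_reflect: "in_Lp p lebesgue (\<lambda>x. w (\<tau> - x)) \<longleftrightarrow> in_Lp p lebesgue (w :: real \<Rightarrow> complex)"
proof (cases "w \<in> borel_measurable lebesgue")
  case [measurable]: True
  have "integrable lebesgue (\<lambda>x. cmod (w (\<tau> - x)) powr q) \<longleftrightarrow> integrable lebesgue (\<lambda>x. cmod (w x) powr q)" for q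
    using integrable_distr_eq[OF reflect_measurable[of \<tau>], of "\<lambda>x. cmod (w x) powr q"]
    by (simp add: lebesgue_reflect)
  then show ?thesis
    using AE_reflect[of "\<lambda>x. cmod (w x) \<le> _" \<tau>] by (simp add: in_Lp_def measurable_reflect)
qed (simp add: in_Lp_def measurable_reflect)

lemma Lp_norm_reflect:
  assumes [measurable]: "w \<in> borel_measurable lebesgue"
  shows "Lp_norm p lebesgue (\<lambda>x. w (\<tau> - x)) = Lp_norm p lebesgue (w :: real \<Rightarrow> complex)"
proof -
  have "esssup lebesgue (\<lambda>x. ennreal (cmod (w (\<tau> - x)))) = esssup lebesgue (\<lambda>x. ennreal (cmod (w x)))"
  proof (rule esssup_cong_AE)
    have "(\<lambda>x. w (\<tau> - x)) \<in> borel_measurable lebesgue"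
      by (simp add: measurable_reflect assms)
    then show "(\<lambda>x. ennreal (cmod (w (\<tau> - x)))) \<in> borel_measurable lebesgue" by measurable
    show "(AE x in lebesgue. ennreal (cmod (w (\<tau> - x))) \<le> c) = (AE x in lebesgue. ennreal (cmod (w x)) \<le> c)" for c
      by (rule AE_reflect)
  qed measurable
  moreover have "(LINT x|lebesgue. cmod (w (\<tau> - x)) powr q) = (LINT x|lebesgue. cmod (w x) powr q)" for q
    by (rule integral_lebesgue_reflect) measurable
  ultimately show ?thesis by (simp add: Lp_norm_def)
qed

text \<open>The interval has finite measure, and for a finite exponent \<open>q \<ge> 1\<close> the
  modulus is at most \<open>1 + cmod (v x) powr q\<close>.\<close>

lemma in_Lp_imp_integrable:
  fixes v :: "real \<Rightarrow> complex"
  assumes p: "1 \<le> p" and v: "in_Lp p (lebesgue_on {0..\<tau>}) v"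
  shows "integrable (lebesgue_on {0..\<tau>}) v"
proof -
  have [measurable]: "v \<in> borel_measurable (lebesgue_on {0..\<tau>})"
    using v by (simp add: in_Lp_def)
  have const: "integrable (lebesgue_on {0..\<tau>}) (\<lambda>_. c :: real)" for c
    by (rule finite_measure.integrable_const, rule finite_measure_lebesgue_on) simp
  show ?thesis
  proof (cases "p = \<infinity>")
    case True
    then obtain C where C: "AE x in lebesgue_on {0..\<tau>}. cmod (v x) \<le> C"
      using v by (auto simp: in_Lp_def)
    show ?thesis
      by (rule Bochner_Integration.integrable_bound[OF const[of C]]) (use C in \<open>auto elim: eventually_mono\<close>)
  next
    case False
    define q where "q = enn2real p"
    have q: "1 \<le> q" unfolding q_def using p False by (rule enn2real_ge_1)
    have int: "integrable (lebesgue_on {0..\<tau>}) (\<lambda>x. 1 + cmod (v x) powr q)"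
      using v False const by (intro Bochner_Integration.integrable_add) (auto simp: in_Lp_def q_def)
    have "cmod (v x) \<le> 1 + cmod (v x) powr q" for x
    proof (cases "cmod (v x) \<le> 1")
      case True
      then show ?thesis using powr_ge_zero[of "cmod (v x)" q] by linarith
    next
      case False
      then show ?thesis using powr_mono[OF q, of "cmod (v x)"] by simp
    qed
    then show ?thesis
      by (intro Bochner_Integration.integrable_bound[OF int]) (auto intro!: AE_I2 order_trans[OF _ abs_ge_self])
  qed
qed

text \<open>The truncation is built in because an input on \<open>{0..\<tau>}\<close> has arbitrary
  values elsewhere, while the Laplace transform sees the whole half-line.\<close>

definition reflected :: "real \<Rightarrow> (real \<Rightarrow> complex) \<Rightarrow> real \<Rightarrow> complex" where
  "reflected \<tau> v x = (if x \<in> {0..\<tau>} then v (\<tau> - x) else 0)"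

lemma compactly_supported_reflected: "compactly_supported (reflected \<tau> v)"
  unfolding compactly_supported_def by (intro exI[of _ \<tau>] AE_I2) (simp add: reflected_def)

text \<open>Both sides are compared through their zero extensions to the full line, which are
  reflections of each other.\<close>

lemma
  assumes p: "1 \<le> p"
  shows in_Lp_reflected:
      "in_Lp p (lebesgue_on {0..}) (reflected \<tau> v) \<longleftrightarrow> in_Lp p (lebesgue_on {0..\<tau>}) v" (is ?A)
    and Lp_norm_reflected: "in_Lp p (lebesgue_on {0..\<tau>}) v \<Longrightarrow>
      Lp_norm p (lebesgue_on {0..}) (reflected \<tau> v) = Lp_norm p (lebesgue_on {0..\<tau>}) v" (is "_ \<Longrightarrow> ?B")
proof -
  have eq0: "(\<lambda>x. if x \<in> {0..} then reflected \<tau> v x else 0) = reflected \<tau> v"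
    by (auto simp: reflected_def)
  have eq1: "(\<lambda>x. reflected \<tau> v (\<tau> - x)) = (\<lambda>x. if x \<in> {0..\<tau>} then v x else 0)"
    by (auto simp: reflected_def)
  have "in_Lp p (lebesgue_on {0..}) (reflected \<tau> v) \<longleftrightarrow> in_Lp p lebesgue (reflected \<tau> v)"
    using in_Lp_lebesgue_on[OF p, of "{0..}" "reflected \<tau> v"] unfolding eq0 by simp
  also have "\<dots> \<longleftrightarrow> in_Lp p lebesgue (\<lambda>x. reflected \<tau> v (\<tau> - x))"
    by (rule in_Lp_reflect[symmetric])
  also have "\<dots> \<longleftrightarrow> in_Lp p (lebesgue_on {0..\<tau>}) v"
    unfolding eq1 by (subst in_Lp_lebesgue_on[OF p]) auto
  finally show A: ?A .
  assume v: "in_Lp p (lebesgue_on {0..\<tau>}) v"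
  have "Lp_norm p (lebesgue_on {0..}) (reflected \<tau> v) = Lp_norm p lebesgue (reflected \<tau> v)"
    using Lp_norm_lebesgue_on[OF p, of "{0..}" "reflected \<tau> v"] A v unfolding eq0 by simp
  also have "\<dots> = Lp_norm p lebesgue (\<lambda>x. reflected \<tau> v (\<tau> - x))"
  proof (rule Lp_norm_reflect[symmetric])
    have "in_Lp p lebesgue (reflected \<tau> v)"
      using A v in_Lp_lebesgue_on[OF p, of "{0..}" "reflected \<tau> v"] unfolding eq0 by simp
    then show "reflected \<tau> v \<in> borel_measurable lebesgue" by (simp add: in_Lp_def)
  qed
  also have "\<dots> = Lp_norm p (lebesgue_on {0..\<tau>}) v"
    unfolding eq1 using v by (subst Lp_norm_lebesgue_on[OF p]) auto
  finally show ?B .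
qed

text \<open>The substitution \<open>x = \<tau> - s\<close> on the full line does it. The exponential
  is bounded on the compact interval, so the integrand is Lebesgue integrable and its integral is
  also the gauge integral.\<close>

lemma laplace_transform_reflected:
  assumes v: "integrable (lebesgue_on {0..\<tau>}) v"
  shows "((\<lambda>s. v s * exp (- z * of_real (\<tau> - s))) has_integral laplace_transform (reflected \<tau> v) z) {0..\<tau>}"
proof -
  have [measurable]: "v \<in> borel_measurable (lebesgue_on {0..\<tau>})"
    using v by auto
  have cont: "continuous_on {0..\<tau>} (\<lambda>s. exp (- z * of_real (\<tau> - s)))"
    by (intro continuous_intros)
  have [measurable]: "(\<lambda>s. exp (- z * of_real (\<tau> - s))) \<in> borel_measurable (lebesgue_on {0..\<tau>})"
    by (rule continuous_imp_measurable_on_sets_lebesgue[OF cont]) auto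
  have "bounded ((\<lambda>s. exp (- z * of_real (\<tau> - s))) ` {0..\<tau>})"
    by (intro compact_imp_bounded compact_continuous_image cont) auto
  then obtain K where K: "\<And>s. s \<in> {0..\<tau>} \<Longrightarrow> cmod (exp (- z * of_real (\<tau> - s))) \<le> K"
    unfolding bounded_iff by blast
  have int: "integrable (lebesgue_on {0..\<tau>}) (\<lambda>s. v s * exp (- z * of_real (\<tau> - s)))"
  proof (rule Bochner_Integration.integrable_bound)
    show "integrable (lebesgue_on {0..\<tau>}) (\<lambda>s. K *\<^sub>R v s)"
      using v by (rule integrable_scaleR_right)
    show "AE s in lebesgue_on {0..\<tau>}. norm (v s * exp (- z * of_real (\<tau> - s))) \<le> norm (K *\<^sub>R v s)"
    proof (rule AE_I2)
      fix s assume "s \<in> space (lebesgue_on {0..\<tau>})"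
      then have "cmod (exp (- z * of_real (\<tau> - s))) \<le> \<bar>K\<bar>"
        using K[of s] by (simp add: space_restrict_space)
      then show "norm (v s * exp (- z * of_real (\<tau> - s))) \<le> norm (K *\<^sub>R v s)"
        unfolding norm_mult norm_scaleR by (subst mult.commute) (rule mult_right_mono, auto)
    qed
  qed measurable
  define w where "w x = exp (- z * complex_of_real x) * reflected \<tau> v x" for x
  have eq: "w (\<tau> - s) = indicator {0..\<tau>} s *\<^sub>R (v s * exp (- z * of_real (\<tau> - s)))" for s
    by (auto simp: w_def reflected_def)
  have meas: "w \<in> borel_measurable lebesgue"
  proof -
    have "(\<lambda>s. if s \<in> {0..\<tau>} then v s * exp (- z * of_real (\<tau> - s)) else 0) \<in> borel_measurable lebesgue"
      by (rule borel_measurable_if_I[OF borel_measurable_integrable[OF int]]) auto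
    also have "(\<lambda>s. if s \<in> {0..\<tau>} then v s * exp (- z * of_real (\<tau> - s)) else 0) = (\<lambda>s. w (\<tau> - s))"
      by (auto simp: eq)
    finally show ?thesis by (simp only: measurable_reflect)
  qed
  have "laplace_transform (reflected \<tau> v) z = (LINT x|lebesgue. indicator {0..} x *\<^sub>R w x)"
    unfolding laplace_transform_def w_def by (subst integral_restrict_space) auto
  also have "\<dots> = (LINT x|lebesgue. w x)"
    by (rule Bochner_Integration.integral_cong) (auto simp: w_def reflected_def)
  also have "\<dots> = (LINT s|lebesgue. w (\<tau> - s))"
    by (rule integral_lebesgue_reflect[OF meas, symmetric])
  also have "\<dots> = (LINT s|lebesgue_on {0..\<tau>}. v s * exp (- z * of_real (\<tau> - s)))"
    unfolding eq by (subst integral_restrict_space) auto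
  finally show ?thesis
    using has_integral_integral_lebesgue_on[OF int] by simp
qed

text \<open>Reversing \<open>u\<close> in time and reflecting again returns \<open>u\<close>
  truncated at \<open>\<tau>\<close>. This changes \<open>u\<close> only on a null set of the
  half-line, which neither increases the norm nor alters the transform.\<close>

lemma compactly_supported_obtains_reflected:
  assumes p: "1 \<le> p" and u: "in_Lp p (lebesgue_on {0..}) u" and cs: "compactly_supported u"
  obtains \<tau> v where "0 \<le> \<tau>" "in_Lp p (lebesgue_on {0..\<tau>}) v"
    "Lp_norm p (lebesgue_on {0..\<tau>}) v \<le> Lp_norm p (lebesgue_on {0..}) u"
    "laplace_transform u = laplace_transform (reflected \<tau> v)"
proof -
  obtain \<tau>0 where \<tau>0: "AE t in lebesgue_on {0..}. t > \<tau>0 \<longrightarrow> u t = 0"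
    using cs by (auto simp: compactly_supported_def)
  \<comment> \<open>The support bound may be negative, while admissibility speaks about times
    \<open>t \<ge> 0\<close>.\<close>
  define \<tau> where "\<tau> = max \<tau>0 0"
  have "\<tau>0 \<le> \<tau>" by (simp add: \<tau>_def)
  define v where "v s = u (\<tau> - s)" for s
  have reflected_eq: "reflected \<tau> v x = (if x \<in> {0..\<tau>} then u x else 0)" for x
    by (simp add: reflected_def v_def)
  have [measurable]: "u \<in> borel_measurable (lebesgue_on {0..})"
    using u by (simp add: in_Lp_def)
  have [measurable]: "(\<lambda>x. x) \<in> borel_measurable (lebesgue_on {0::real..})"
    by (intro continuous_imp_measurable_on_sets_lebesgue continuous_intros) auto
  have meas [measurable]: "reflected \<tau> v \<in> borel_measurable (lebesgue_on {0..})"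
    unfolding reflected_eq[abs_def] by measurable
  have le: "cmod (reflected \<tau> v x) \<le> cmod (u x)" for x
    by (simp add: reflected_eq)
  have Lp: "in_Lp p (lebesgue_on {0..}) (reflected \<tau> v)"
      "Lp_norm p (lebesgue_on {0..}) (reflected \<tau> v) \<le> Lp_norm p (lebesgue_on {0..}) u"
    using in_Lp_dominated[OF p u meas le] by auto
  show ?thesis
  proof (rule that[of \<tau> v])
    show "0 \<le> \<tau>" by (simp add: \<tau>_def)
    show v: "in_Lp p (lebesgue_on {0..\<tau>}) v"
      using Lp(1) in_Lp_reflected[OF p] by blast
    show "Lp_norm p (lebesgue_on {0..\<tau>}) v \<le> Lp_norm p (lebesgue_on {0..}) u"
      using Lp(2) Lp_norm_reflected[OF p v] by simp
    show "laplace_transform u = laplace_transform (reflected \<tau> v)"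
    proof
      fix z
      have "AE t in lebesgue_on {0..}. u t = reflected \<tau> v t"
        using \<tau>0 AE_space by eventually_elim (use \<open>\<tau>0 \<le> \<tau>\<close> in \<open>auto simp: reflected_eq space_restrict_space\<close>)
      then have "AE t in lebesgue_on {0..}. exp (- z * of_real t) * u t = exp (- z * of_real t) * reflected \<tau> v t"
        by eventually_elim simp
      moreover have "(\<lambda>t. exp (- z * complex_of_real t)) \<in> borel_measurable (lebesgue_on {0..})"
        by (intro continuous_imp_measurable_on_sets_lebesgue continuous_intros) auto
      ultimately show "laplace_transform u z = laplace_transform (reflected \<tau> v) z"
        unfolding laplace_transform_def by (intro integral_cong_AE) auto
    qed
  qed
qed

section \<open>Admissibility\<close>

lemma closed_away_equivalent_weights:
  fixes w :: complex
  assumes "closed \<sigma>" "w \<notin> \<sigma>"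
  obtains K where "K > 0" "\<And>z. (cmod (z - w))\<^sup>2 \<le> K * (1 + (cmod z)\<^sup>2)"
    "\<And>z. z \<in> \<sigma> \<Longrightarrow> 1 + (cmod z)\<^sup>2 \<le> K * (cmod (z - w))\<^sup>2"
proof -
  have "open (- \<sigma>)" "w \<in> - \<sigma>" using assms by auto
  then obtain d where d: "d > 0" "ball w d \<subseteq> - \<sigma>"
    using open_contains_ball by blast
  \<comment> \<open>The part before the quotient serves the estimate valid for all \<open>z\<close>.
    The quotient, with the leading 2, serves the converse on \<open>\<sigma>\<close>: there
    \<open>1 + 2 * (cmod w)\<^sup>2\<close> is absorbed by using that \<open>z\<close> has distance
    at least \<open>d\<close> from \<open>w\<close>.\<close>
  define K where "K = 2 + 2 * (cmod w)\<^sup>2 + (1 + 2 * (cmod w)\<^sup>2) / d\<^sup>2"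
  have K: "2 + 2 * (cmod w)\<^sup>2 \<le> K" "2 + (1 + 2 * (cmod w)\<^sup>2) / d\<^sup>2 \<le> K"
    using d(1) by (auto simp: K_def)
  show ?thesis
  proof (rule that[of K])
    show "0 < K" using K(1) zero_le_power2[of "cmod w"] by linarith
    show "(cmod (z - w))\<^sup>2 \<le> K * (1 + (cmod z)\<^sup>2)" for z
    proof -
      have "(cmod (z - w))\<^sup>2 \<le> 2 * (cmod z)\<^sup>2 + 2 * (cmod w)\<^sup>2"
        by (rule norm_diff_sq_le)
      also have "\<dots> \<le> (2 + 2 * (cmod w)\<^sup>2) * (1 + (cmod z)\<^sup>2)"
        by (simp add: algebra_simps)
      also have "\<dots> \<le> K * (1 + (cmod z)\<^sup>2)"
        using K(1) by (intro mult_right_mono) auto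
      finally show ?thesis .
    qed
    show "1 + (cmod z)\<^sup>2 \<le> K * (cmod (z - w))\<^sup>2" if "z \<in> \<sigma>" for z
    proof -
      have "d \<le> cmod (z - w)"
        using d(2) that by (force simp: dist_norm norm_minus_commute not_le[symmetric])
      then have dz: "d\<^sup>2 \<le> (cmod (z - w))\<^sup>2"
        using d(1) by (intro power_mono) auto
      have "(1 + 2 * (cmod w)\<^sup>2) / d\<^sup>2 * d\<^sup>2 \<le> (1 + 2 * (cmod w)\<^sup>2) / d\<^sup>2 * (cmod (z - w))\<^sup>2"
        using dz by (intro mult_left_mono) auto
      then have 1: "1 + 2 * (cmod w)\<^sup>2 \<le> (1 + 2 * (cmod w)\<^sup>2) / d\<^sup>2 * (cmod (z - w))\<^sup>2"
        using d(1) by simp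
      have "(cmod z)\<^sup>2 \<le> 2 * (cmod (z - w))\<^sup>2 + 2 * (cmod w)\<^sup>2"
        using norm_add_sq_le[of "z - w" w] by simp
      then have "1 + (cmod z)\<^sup>2 \<le> (2 + (1 + 2 * (cmod w)\<^sup>2) / d\<^sup>2) * (cmod (z - w))\<^sup>2"
        using 1 by (simp add: distrib_right)
      also have "\<dots> \<le> K * (cmod (z - w))\<^sup>2"
        using K(2) by (intro mult_right_mono) auto
      finally show ?thesis .
    qed
  qed
qed

lemma in_Lp_2_iff:
  assumes f: "f \<in> borel_measurable M"
  shows "in_Lp 2 M f \<longleftrightarrow> (\<integral>\<^sup>+ x. ennreal ((cmod (f x))\<^sup>2) \<partial>M) < \<infinity>"
    and "in_Lp 2 M f \<Longrightarrow> ennreal ((Lp_norm 2 M f)\<^sup>2) = (\<integral>\<^sup>+ x. ennreal ((cmod (f x))\<^sup>2) \<partial>M)"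
proof -
  have [measurable]: "f \<in> borel_measurable M" by fact
  have p: "enn2real 2 = 2" "(2::ennreal) \<noteq> \<infinity>" by simp_all
  have powr: "cmod w powr 2 = (cmod w)\<^sup>2" for w
    by (simp add: powr_numeral)
  show *: "in_Lp 2 M f \<longleftrightarrow> (\<integral>\<^sup>+ x. ennreal ((cmod (f x))\<^sup>2) \<partial>M) < \<infinity>"
    unfolding in_Lp_def p(1) powr using p(2) f by (simp add: integrable_iff_bounded)
  assume L: "in_Lp 2 M f"
  define I where "I = (LINT x|M. (cmod (f x))\<^sup>2)"
  have "Lp_norm 2 M f = sqrt I"
    unfolding Lp_norm_def p(1) powr using p(2)
    by (simp add: I_def powr_half_sqrt integral_nonneg)
  then have "(Lp_norm 2 M f)\<^sup>2 = I"
    by (simp add: I_def integral_nonneg)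
  moreover have "ennreal I = (\<integral>\<^sup>+ x. ennreal ((cmod (f x))\<^sup>2) \<partial>M)"
    unfolding I_def using L p(2) unfolding in_Lp_def p(1) powr
    by (intro nn_integral_eq_integral[symmetric]) auto
  ultimately show "ennreal ((Lp_norm 2 M f)\<^sup>2) = (\<integral>\<^sup>+ x. ennreal ((cmod (f x))\<^sup>2) \<partial>M)" by simp
qed

lemma Lp_norm_nonneg: "0 \<le> Lp_norm p M u"
  by (simp add: Lp_norm_def)

theorem proposition3p3:
  fixes T :: "real \<Rightarrow> 'x::chilbert_space \<Rightarrow> 'x"
    and A :: "('x \<times> 'x) set"
    and p :: ennreal
    and r :: complex
    and J :: "'x \<Rightarrow> 'y::chilbert_space"
    and E :: "complex set \<Rightarrow> 'y \<Rightarrow> 'y"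
    and b :: 'y
    and \<mu> :: "complex measure"
  assumes "C0_semigroup T"
    and "A = generator T"
    and "\<forall>t\<ge>0. normal_operator (T t)"
    and "1 \<le> p"
    and "r \<in> resolvent_set A"
    and "extrapolation_space A r J"
    and "projection_valued_measure E"
    and "E (spectrum (uminus_op A)) = id"
    and "uminus_op (extrapolation_generator J T) = spectral_integral E (\<lambda>z. z)"
    and "\<mu> = density (spectral_scalar_measure E b) (\<lambda>z. ennreal (1 + (cmod z)\<^sup>2))"
  shows "Lp_admissible p J (extrapolation_semigroup J T) b \<longleftrightarrow>
         laplace_bounded p (spectrum (uminus_op A)) \<mu>"
proof -
  interpret X: extrapolation T r J
    using assms(1,2,5,6) by unfold_locales auto
  define S where "S = extrapolation_semigroup J T"
  interpret Y: spectral_semigroup E S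
    using assms(7,9) X.C0_semigroup_S unfolding S_def
    by unfold_locales (auto simp: extrapolation_generator_def)
  define \<sigma> where "\<sigma> = spectrum (uminus_op A)"
  have \<sigma>: "closed \<sigma>"
    unfolding \<sigma>_def by (rule spectrum_closed)
  have [measurable]: "\<sigma> \<in> sets borel"
    using \<sigma> by (rule borel_closed)
  have "- r \<notin> \<sigma>"
    using uminus_resolvent_set[OF assms(5)] by (simp add: \<sigma>_def spectrum_def)
  then obtain K where K: "K > 0" "\<And>z. (cmod (z - (- r)))\<^sup>2 \<le> K * (1 + (cmod z)\<^sup>2)"
      "\<And>z. z \<in> \<sigma> \<Longrightarrow> 1 + (cmod z)\<^sup>2 \<le> K * (cmod (z - (- r)))\<^sup>2"
    using closed_away_equivalent_weights[OF \<sigma>] by blast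
  have id_meas: "(\<lambda>z::complex. z) \<in> borel_measurable borel"
    by measurable
  \<comment> \<open>Multiplicativity of \<open>E\<close> turns \<open>E \<sigma> = id\<close> into
    the vanishing of \<open>E\<close> on the complement.\<close>
  have AE_\<sigma>: "AE z in Y.\<nu> b. z \<in> \<sigma>"
  proof (rule AE_I)
    have "E (- \<sigma>) b = E (- \<sigma>) (E \<sigma> b)"
      using assms(8) by (simp add: \<sigma>_def)
    also have "\<dots> = 0"
      by (subst Y.E_Int) auto
    finally show "emeasure (Y.\<nu> b) (- \<sigma>) = 0"
      by (simp add: Y.emeasure_nu)
  qed auto
  \<comment> \<open>This is the squared norm in L^2(\<open>\<sigma>\<close>, \<open>\<mu>\<close>),
    written as an integral over the whole plane so that it can be compared with spectral
    integrals.\<close>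
  define N where "N f = (\<integral>\<^sup>+ z. ennreal (1 + (cmod z)\<^sup>2) * ennreal ((cmod (f z))\<^sup>2) \<partial>Y.\<nu> b)" for f
  have L2_mu: "(\<integral>\<^sup>+ z. ennreal ((cmod (f z))\<^sup>2) \<partial>restrict_space \<mu> \<sigma>) = N f"
    if [measurable]: "f \<in> borel_measurable borel" for f
  proof -
    have "(\<integral>\<^sup>+ z. ennreal ((cmod (f z))\<^sup>2) \<partial>restrict_space \<mu> \<sigma>)
        = (\<integral>\<^sup>+ z. ennreal ((cmod (f z))\<^sup>2) * indicator \<sigma> z \<partial>\<mu>)"
      by (rule nn_integral_restrict_space) (simp add: assms(10))
    also have "\<dots> = (\<integral>\<^sup>+ z. ennreal (1 + (cmod z)\<^sup>2) * (ennreal ((cmod (f z))\<^sup>2) * indicator \<sigma> z) \<partial>Y.\<nu> b)"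
      unfolding assms(10) by (rule nn_integral_density) measurable
    also have "\<dots> = N f"
      unfolding N_def by (rule nn_integral_cong_AE) (use AE_\<sigma> in eventually_elim, simp)
    finally show ?thesis .
  qed
  have meas_mu: "f \<in> borel_measurable (restrict_space \<mu> \<sigma>)" if "f \<in> borel_measurable borel" for f :: "complex \<Rightarrow> complex"
    using that by (intro measurable_restrict_space1) (simp add: assms(10) measurable_density_eq1)
  \<comment> \<open>In \<open>L\<^sup>2(\<nu>)\<close> the operator \<open>r - A\<^sub>-\<^sub>1\<close>, which maps \<open>X\<close> isometrically onto \<open>X\<^sub>-\<^sub>1\<close>, is
    multiplication by \<open>r + z\<close>.\<close>
  have norm_x: "ennreal ((norm x)\<^sup>2) = Y.L2sq b (\<lambda>z. (z - (- r)) * f z)"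
    if [measurable]: "f \<in> borel_measurable borel" and f: "(b, J x) \<in> Y.SI f" for f x
  proof -
    obtain w where w: "(J x, w) \<in> generator S"
      using X.Domain_generator_S unfolding S_def by blast
    then have "(J x, - w) \<in> Y.SI (\<lambda>z. z)"
      by (simp only: Y.generator_iff)
    then have "(b, - w) \<in> Y.SI (\<lambda>z. z * f z)"
      by (rule iffD1[OF Y.SI_compose[OF that(1) f id_meas]])
    then have "(b, - w + r *\<^sub>C J x) \<in> Y.SI (\<lambda>z. z * f z + r * f z)"
      by (intro Y.SI_add Y.SI_scaleC f) measurable
    then have "(b, r *\<^sub>C J x - w) \<in> Y.SI (\<lambda>z. (z - (- r)) * f z)"
      by (simp add: algebra_simps)
    then have "ennreal ((norm (r *\<^sub>C J x - w))\<^sup>2) = Y.L2sq b (\<lambda>z. (z - (- r)) * f z)"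
      by (intro Y.SI_norm) measurable
    then show ?thesis
      using X.norm_eq_generator_S w unfolding S_def by simp
  qed
  \<comment> \<open>The weight of the right-hand side vanishes at \<open>- r\<close>, so this
    comparison holds only on \<open>\<sigma>\<close>, that is almost everywhere; the converse
    \<open>upper\<close> holds pointwise.\<close>
  have lower: "N f \<le> ennreal K * ennreal ((norm x)\<^sup>2)"
    if [measurable]: "f \<in> borel_measurable borel" and f: "(b, J x) \<in> Y.SI f" for f x
  proof -
    have "N f \<le> (\<integral>\<^sup>+ z. ennreal K * ennreal ((cmod ((z - (- r)) * f z))\<^sup>2) \<partial>Y.\<nu> b)"
      unfolding N_def
    proof (rule nn_integral_mono_AE, use AE_\<sigma> in eventually_elim)
      fix z assume "z \<in> \<sigma>"
      then have "(1 + (cmod z)\<^sup>2) * (cmod (f z))\<^sup>2 \<le> K * (cmod (z - (- r)))\<^sup>2 * (cmod (f z))\<^sup>2"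
        by (intro mult_right_mono K) auto
      then show "ennreal (1 + (cmod z)\<^sup>2) * ennreal ((cmod (f z))\<^sup>2) \<le> ennreal K * ennreal ((cmod ((z - (- r)) * f z))\<^sup>2)"
        using K(1) by (simp add: ennreal_mult[symmetric] norm_mult power_mult_distrib mult.assoc
            del: ennreal_plus)
    qed
    also have "\<dots> = ennreal K * ennreal ((norm x)\<^sup>2)"
      unfolding norm_x[OF that] by (rule nn_integral_cmult) measurable
    finally show ?thesis .
  qed
  have upper: "ennreal ((norm x)\<^sup>2) \<le> ennreal K * N f"
    if [measurable]: "f \<in> borel_measurable borel" and f: "(b, J x) \<in> Y.SI f" for f x
  proof -
    have "ennreal ((norm x)\<^sup>2)
        \<le> (\<integral>\<^sup>+ z. ennreal K * (ennreal (1 + (cmod z)\<^sup>2) * ennreal ((cmod (f z))\<^sup>2)) \<partial>Y.\<nu> b)"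
      unfolding norm_x[OF that]
    proof (rule nn_integral_mono)
      fix z
      have "(cmod (z - (- r)))\<^sup>2 * (cmod (f z))\<^sup>2 \<le> K * (1 + (cmod z)\<^sup>2) * (cmod (f z))\<^sup>2"
        by (intro mult_right_mono K) auto
      then show "ennreal ((cmod ((z - (- r)) * f z))\<^sup>2) \<le> ennreal K * (ennreal (1 + (cmod z)\<^sup>2) * ennreal ((cmod (f z))\<^sup>2))"
        using K(1) by (simp add: ennreal_mult[symmetric] norm_mult power_mult_distrib mult.assoc
            del: ennreal_plus)
    qed
    also have "\<dots> = ennreal K * N f"
      unfolding N_def by (rule nn_integral_cmult) measurable
    finally show ?thesis .
  qed
  \<comment> \<open>Finiteness of \<open>N f\<close> makes \<open>z * f z\<close> square integrable,
    which puts \<open>y\<close> into the domain of A_{-1}, and that domain is X.\<close>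
  have range_J: "\<exists>x. y = J x"
    if [measurable]: "f \<in> borel_measurable borel" and f: "(b, y) \<in> Y.SI f" and fin: "N f < \<infinity>" for f y
  proof -
    have "Y.L2sq b (\<lambda>z. z * f z) \<le> N f"
      unfolding N_def
    proof (rule nn_integral_mono)
      fix z
      have "(cmod z)\<^sup>2 * (cmod (f z))\<^sup>2 \<le> (1 + (cmod z)\<^sup>2) * (cmod (f z))\<^sup>2"
        by (intro mult_right_mono) auto
      then show "ennreal ((cmod (z * f z))\<^sup>2) \<le> ennreal (1 + (cmod z)\<^sup>2) * ennreal ((cmod (f z))\<^sup>2)"
        by (simp add: ennreal_mult[symmetric] norm_mult power_mult_distrib del: ennreal_plus)
    qed
    then have "Y.L2sq b (\<lambda>z. z * f z) < \<infinity>"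
      using fin by (rule le_less_trans)
    then obtain w where "(b, w) \<in> Y.SI (\<lambda>z. z * f z)"
      using Y.SI_exists[of "\<lambda>z. z * f z" b] by auto
    then have "(y, w) \<in> Y.SI (\<lambda>z. z)"
      by (rule iffD2[OF Y.SI_compose[OF that(1) f id_meas]])
    then have "(y, - w) \<in> generator S"
      by (simp add: Y.generator_iff)
    then show ?thesis
      using X.Domain_generator_S unfolding S_def by blast
  qed
  \<comment> \<open>Valid for every L^p input: existence in X_{-1} is automatic, and both
    implications only compare norms of this one vector.\<close>
  have conv: "laplace_transform (reflected t v) \<in> borel_measurable borel"
      "\<exists>y. ((\<lambda>s. S (t - s) (v s *\<^sub>C b)) has_integral y) {0..t} \<and> (b, y) \<in> Y.SI (laplace_transform (reflected t v))"
    if "0 \<le> t" "in_Lp p (lebesgue_on {0..t}) v" for t v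
  proof -
    have int: "integrable (lebesgue_on {0..t}) v"
      using that(2) by (rule in_Lp_imp_integrable[OF assms(4)])
    have "v integrable_on {0..t}" "(\<lambda>s. norm (v s)) integrable_on {0..t}"
      using has_integral_integral_lebesgue_on[OF int]
        has_integral_integral_lebesgue_on[OF integrable_norm[OF int]] by auto
    from Y.SI_convolution[OF that(1) this laplace_transform_reflected[OF int]]
    show "laplace_transform (reflected t v) \<in> borel_measurable borel"
      "\<exists>y. ((\<lambda>s. S (t - s) (v s *\<^sub>C b)) has_integral y) {0..t} \<and> (b, y) \<in> Y.SI (laplace_transform (reflected t v))"
      by auto
  qed
  show ?thesis
    unfolding S_def[symmetric] \<sigma>_def[symmetric]
  proof
    assume "Lp_admissible p J S b"
    then obtain C where C: "C > 0" "\<And>t v. t \<ge> 0 \<Longrightarrow> in_Lp p (lebesgue_on {0..t}) v \<Longrightarrow>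
        \<exists>x. ((\<lambda>s. S (t - s) (v s *\<^sub>C b)) has_integral J x) {0..t} \<and>
             norm x \<le> C * Lp_norm p (lebesgue_on {0..t}) v"
      unfolding Lp_admissible_def by blast
    show "laplace_bounded p \<sigma> \<mu>"
      unfolding laplace_bounded_def
    \<comment> \<open>The root appears because \<open>K\<close> compares squared norms; the converse
      loses the same factor.\<close>
    proof (intro exI[of _ "sqrt K * C"] conjI allI impI)
      show "0 < sqrt K * C" using K(1) C(1) by simp
      fix u assume u: "in_Lp p (lebesgue_on {0..}) u" "compactly_supported u"
      obtain t v where t: "0 \<le> t" and v: "in_Lp p (lebesgue_on {0..t}) v"
        and le: "Lp_norm p (lebesgue_on {0..t}) v \<le> Lp_norm p (lebesgue_on {0..}) u"
        and eq: "laplace_transform u = laplace_transform (reflected t v)"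
        using compactly_supported_obtains_reflected[OF assms(4) u] by blast
      define f where "f = laplace_transform u"
      have f [measurable]: "f \<in> borel_measurable borel"
        unfolding f_def eq by (rule conv[OF t v])
      obtain x where x: "((\<lambda>s. S (t - s) (v s *\<^sub>C b)) has_integral J x) {0..t}"
          "norm x \<le> C * Lp_norm p (lebesgue_on {0..t}) v"
        using C(2)[OF t v] by blast
      \<comment> \<open>Uniqueness of the gauge integral identifies \<open>J x\<close> with the
        vector that \<open>f\<close> represents.\<close>
      have "(b, J x) \<in> Y.SI f"
        unfolding f_def eq using conv(2)[OF t v] has_integral_unique[OF x(1)] by blast
      then have N: "N f \<le> ennreal (K * (norm x)\<^sup>2)"
        using lower[OF f] K(1) by (simp add: ennreal_mult)
      then show L: "in_Lp 2 (restrict_space \<mu> \<sigma>) (laplace_transform u)"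
        unfolding f_def[symmetric] in_Lp_2_iff(1)[OF meas_mu[OF f]] L2_mu[OF f]
        by (simp add: le_less_trans)
      have "ennreal ((Lp_norm 2 (restrict_space \<mu> \<sigma>) f)\<^sup>2) \<le> ennreal (K * (norm x)\<^sup>2)"
        using N L in_Lp_2_iff(2)[OF meas_mu[OF f]] L2_mu[OF f] by (simp add: f_def)
      then have "(Lp_norm 2 (restrict_space \<mu> \<sigma>) f)\<^sup>2 \<le> (sqrt K * norm x)\<^sup>2"
        using K(1) by (simp add: power_mult_distrib)
      then have "Lp_norm 2 (restrict_space \<mu> \<sigma>) f \<le> sqrt K * norm x"
        by (rule power2_le_imp_le) (use K(1) in simp)
      also have "\<dots> \<le> sqrt K * (C * Lp_norm p (lebesgue_on {0..}) u)"
        using x(2) le C(1) K(1) by (intro mult_left_mono order_trans[OF x(2)]) auto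
      finally show "Lp_norm 2 (restrict_space \<mu> \<sigma>) (laplace_transform u)
          \<le> sqrt K * C * Lp_norm p (lebesgue_on {0..}) u"
        by (simp add: f_def mult.assoc)
    qed
  next
    assume "laplace_bounded p \<sigma> \<mu>"
    then obtain C where C: "C > 0" "\<And>u. in_Lp p (lebesgue_on {0..}) u \<Longrightarrow> compactly_supported u \<Longrightarrow>
        in_Lp 2 (restrict_space \<mu> \<sigma>) (laplace_transform u) \<and>
        Lp_norm 2 (restrict_space \<mu> \<sigma>) (laplace_transform u) \<le> C * Lp_norm p (lebesgue_on {0..}) u"
      unfolding laplace_bounded_def by blast
    show "Lp_admissible p J S b"
      unfolding Lp_admissible_def
    proof (intro exI[of _ "sqrt K * C"] conjI allI impI)
      show "0 < sqrt K * C" using K(1) C(1) by simp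
      fix t v assume t: "(0::real) \<le> t" and v: "in_Lp p (lebesgue_on {0..t}) v"
      define f where "f = laplace_transform (reflected t v)"
      have f [measurable]: "f \<in> borel_measurable borel"
        unfolding f_def by (rule conv[OF t v])
      obtain y where y: "((\<lambda>s. S (t - s) (v s *\<^sub>C b)) has_integral y) {0..t}" "(b, y) \<in> Y.SI f"
        using conv(2)[OF t v] unfolding f_def by blast
      have "in_Lp p (lebesgue_on {0..}) (reflected t v)"
        using v in_Lp_reflected[OF assms(4)] by blast
      from C(2)[OF this compactly_supported_reflected]
      have L: "in_Lp 2 (restrict_space \<mu> \<sigma>) f"
          "Lp_norm 2 (restrict_space \<mu> \<sigma>) f \<le> C * Lp_norm p (lebesgue_on {0..t}) v"
        using Lp_norm_reflected[OF assms(4) v] by (auto simp: f_def)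
      \<comment> \<open>Boundedness of the transform enters twice: its finiteness puts the
        convolution into X, its size controls the norm there.\<close>
      have N: "N f = ennreal ((Lp_norm 2 (restrict_space \<mu> \<sigma>) f)\<^sup>2)"
        using in_Lp_2_iff(2)[OF meas_mu[OF f] L(1)] L2_mu[OF f] by simp
      then obtain x where x: "y = J x"
        using range_J[OF f y(2)] by auto
      have "ennreal ((norm x)\<^sup>2) \<le> ennreal K * N f"
        using upper[OF f] y(2) x by simp
      then have "ennreal ((norm x)\<^sup>2) \<le> ennreal ((sqrt K * Lp_norm 2 (restrict_space \<mu> \<sigma>) f)\<^sup>2)"
        using K(1) by (simp add: N ennreal_mult power_mult_distrib)
      then have "(norm x)\<^sup>2 \<le> (sqrt K * Lp_norm 2 (restrict_space \<mu> \<sigma>) f)\<^sup>2"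
        by simp
      then have "norm x \<le> sqrt K * Lp_norm 2 (restrict_space \<mu> \<sigma>) f"
        by (rule power2_le_imp_le) (use K(1) in \<open>simp add: Lp_norm_nonneg\<close>)
      also have "\<dots> \<le> sqrt K * (C * Lp_norm p (lebesgue_on {0..t}) v)"
        using L(2) K(1) by (intro mult_left_mono) auto
      finally show "\<exists>x. ((\<lambda>s. S (t - s) (v s *\<^sub>C b)) has_integral J x) {0..t} \<and>
          norm x \<le> sqrt K * C * Lp_norm p (lebesgue_on {0..t}) v"
        using y(1) x by (auto simp: mult.assoc)
    qed
  qed
qed

end
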